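(* Let $(F_n)_{n\ge1}$ be a sequence in $L^2(\Omega,\sigma(Z),P)$ with complex Wiener–Itô chaos decompositions $F_n=\sum_{p+q\ge1}I_{p,q}(f_{n,p,q})$, $f_{n,p,q}\in\mathfrak H^{\odot p}\otimes\mathfrak H^{\odot q}$, and let $h_{n,q,p}$ denote the reverse complex conjugate of $f_{n,p,q}$. Assume that for every $M\ge1$, $\mathbb E[I_{p,q}(f_{n,p,q})I_{p',q'}(f_{n,p',q'})]=0$ for all $n$ and all $(p,q),(p',q')$ with $1\le p+q\le M$, $1\le p'+q'\le M$. Assume further: (i) for each $p+q\ge1$, $\lim_{n\to\infty}p!q!\|f_{n,p,q}\|^2_{\mathfrak H^{\otimes(p+q)}}=\sigma^2_{p,q}$; (ii) $\sigma^2:=\sum_{p+q\ge1}\sigma^2_{p,q}<\infty$; (iii) for each $p+q\ge2$, $\lim_{n\to\infty}\|f_{n,p,q}\otimes_{i,j}h_{n,q,p}\|^2_{\mathfrak H^{\otimes 2(p+q-i-j)}}=0$ for all $0\le i\le p$, $0\le j\le q$ with $0<i+j<p+q$; (iv) $\lim_{M\to\infty}\sup_{n\ge1}\sum_{p+q>M}p!q!\|f_{n,p,q}\|^2_{\mathfrak H^{\otimes(p+q)}}=0$. Then $F_n$ converges in distribution to $\mathcal{CN}(0,\sigma^2)$ as $n\to\infty$.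
   Context: Let $\mathfrak H$ be a complex separable Hilbert space with orthonormal basis $\{e_k\}_{k\ge1}$, and let $Z=\{Z(h):h\in\mathfrak H\}$ be a complex isonormal Gaussian process on $(\Omega,\mathcal F,P)$: a centered symmetric complex Gaussian family with $\mathbb E[Z(h)^2]=0$ and $\mathbb E[Z(g)\overline{Z(h)}]=\langle g,h\rangle_{\mathfrak H}$; $\sigma(Z)$ is the $\sigma$-field it generates. The complex Hermite polynomials $H_{p,q}$ are defined by $\exp\{\lambda\bar z+\bar\lambda z-2|\lambda|^2\}=\sum_{p,q\ge0}\frac{\bar\lambda^p\lambda^q}{p!q!}H_{p,q}(z)$. The complex multiple Wiener–Itô integral $I_{p,q}$ on $\mathfrak H^{\odot p}\otimes\mathfrak H^{\odot q}$ is determined by $I_{p,q}\big((\tilde\otimes_k e_k^{\otimes p_k})\otimes(\tilde\otimes_k\overline{e_k}^{\otimes q_k})\big)=\prod_k 2^{-(p_k+q_k)/2}H_{p_k,q_k}(\sqrt2 Z(e_k))$ ($\sum p_k=p,\sum q_k=q$), extended linearly and continuously; every $F\in L^2(\Omega,\sigma(Z),P)$ has a unique expansion $F=\sum_{p,q\ge0}I_{p,q}(f_{p,q})$ with $f_{0,0}=\mathbb E F$. The reverse complex conjugate of $f\in\mathfrak H^{\odot p}\otimes\mathfrak H^{\odot q}$ is the $h\in\mathfrak H^{\odot q}\otimes\mathfrak H^{\odot p}$ with $\overline{I_{p,q}(f)}=I_{q,p}(h)$ (for $\mathfrak H=L^2_{\mathbb C}(T,\mu)$: $h(t_1..t_q;s_1..s_p)=\overline{f(s_1..s_p;t_1..t_q)}$).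 For $f\in\mathfrak H^{\odot a}\otimes\mathfrak H^{\odot b}$, $g\in\mathfrak H^{\odot c}\otimes\mathfrak H^{\odot d}$, $0\le i\le a\wedge d$, $0\le j\le b\wedge c$, the contraction is $f\otimes_{i,j}g=\sum_{l_1,\dots,l_{i+j}}\langle f,e_{l_1}\otimes\cdots\otimes e_{l_i}\otimes\overline{e_{l_{i+1}}}\otimes\cdots\otimes\overline{e_{l_{i+j}}}\rangle\otimes\langle g,e_{l_{i+1}}\otimes\cdots\otimes e_{l_{i+j}}\otimes\overline{e_{l_1}}\otimes\cdots\otimes\overline{e_{l_i}}\rangle\in\mathfrak H^{\otimes(a+c-i-j)}\otimes\mathfrak H^{\otimes(b+d-i-j)}$; for $\mathfrak H=L^2_{\mathbb C}$, $f\otimes_{i,j}g(t_1..t_{a+c-i-j};s_1..s_{b+d-i-j})=\int f(t_1..t_{a-i},u_1..u_i;s_1..s_{b-j},v_1..v_j)\,g(t_{a-i+1}..t_{a+c-i-j},v_1..v_j;s_{b-j+1}..s_{b+d-i-j},u_1..u_i)\,d\vec u\,d\vec v$. Convergence in distribution of complex random variables refers to $(\mathrm{Re}F_n,\mathrm{Im}F_n)$, and $\mathcal{CN}(0,\sigma^2)$ is the law with $(\mathrm{Re},\mathrm{Im})\sim\mathcal N_2(0,\frac{\sigma^2}2\mathrm{Id}_2)$. *)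

theory Defs
  imports "HOL-Probability.Probability"
begin

text \<open>Coordinates: the separable Hilbert space H is identified with coordinates
w.r.t. the orthonormal basis (e_k), k :: nat.  An element of
H^{\<otimes>a} \<otimes> H^{\<otimes>b} is given by its coefficient function
c ks ls = <f, e_ks \<otimes> conj(e_ls)> on index lists ks (length a), ls (length b).\<close>

definition idx_lists :: "nat \<Rightarrow> nat \<Rightarrow> (nat list \<times> nat list) set" where
  "idx_lists a b = {(ks, ls). length ks = a \<and> length ls = b}"

definition tnorm2 :: "nat \<Rightarrow> nat \<Rightarrow> (nat list \<Rightarrow> nat list \<Rightarrow> complex) \<Rightarrow> real" where
  "tnorm2 a b c = (\<Sum>\<^sub>\<infinity>(ks, ls) \<in> idx_lists a b. (cmod (c ks ls))\<^sup>2)"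

definition sym_tensor :: "nat \<Rightarrow> nat \<Rightarrow> (nat list \<Rightarrow> nat list \<Rightarrow> complex) \<Rightarrow> bool" where
  "sym_tensor p q c \<longleftrightarrow>
     (\<lambda>(ks, ls). (cmod (c ks ls))\<^sup>2) summable_on idx_lists p q \<and>
     (\<forall>ks ls ks' ls'. length ks = p \<longrightarrow> length ls = q \<longrightarrow>
        (\<forall>k. count_list ks k = count_list ks' k) \<longrightarrow>
        (\<forall>k. count_list ls k = count_list ls' k) \<longrightarrow> c ks ls = c ks' ls')"

definition rev_cnj :: "(nat list \<Rightarrow> nat list \<Rightarrow> complex) \<Rightarrow> nat list \<Rightarrow> nat list \<Rightarrow> complex" where
  "rev_cnj c ks ls = cnj (c ls ks)"

definition contr ::
  "nat \<Rightarrow> nat \<Rightarrow> nat \<Rightarrow> nat \<Rightarrow> (nat list \<Rightarrow> nat list \<Rightarrow> complex) \<Rightarrow> (nat list \<Rightarrow> nat list \<Rightarrow> complex)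
     \<Rightarrow> nat list \<Rightarrow> nat list \<Rightarrow> complex" where
  "contr a b i j f g ks ls =
     (\<Sum>\<^sub>\<infinity>(us, vs) \<in> idx_lists i j.
        f (take (a - i) ks @ us) (take (b - j) ls @ vs) *
        g (drop (a - i) ks @ vs) (drop (b - j) ls @ us))"

text \<open>Complex Hermite polynomials: coefficient extraction from the generating function
  exp(\<lambda> conj z + conj \<lambda> z - 2|\<lambda>|^2) = \<Sum> conj \<lambda>^p \<lambda>^q/(p!q!) H_{p,q}(z).\<close>
definition cHermite :: "nat \<Rightarrow> nat \<Rightarrow> complex \<Rightarrow> complex" where
  "cHermite p q z = (\<Sum>k\<le>min p q.
     of_real (fact p * fact q / (fact (p - k) * fact (q - k) * fact k) * (-2) ^ k)
       * z ^ (p - k) * cnj z ^ (q - k))"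

text \<open>I_{p,q}(e_ks \<otimes> conj(e_ls)) (= I_{p,q} of its symmetrisation), where
  zeta k = Z(e_k).\<close>
definition wi_basis :: "(nat \<Rightarrow> 'w \<Rightarrow> complex) \<Rightarrow> nat list \<Rightarrow> nat list \<Rightarrow> 'w \<Rightarrow> complex" where
  "wi_basis zeta ks ls \<omega> = (\<Prod>k \<in> set ks \<union> set ls.
     of_real (2 powr (- real (count_list ks k + count_list ls k) / 2)) *
     cHermite (count_list ks k) (count_list ls k) (of_real (sqrt 2) * zeta k \<omega>))"

definition wi_trunc :: "(nat \<Rightarrow> 'w \<Rightarrow> complex) \<Rightarrow> nat \<Rightarrow> nat \<Rightarrow> (nat list \<Rightarrow> nat list \<Rightarrow> complex)
     \<Rightarrow> nat \<Rightarrow> 'w \<Rightarrow> complex" where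
  "wi_trunc zeta p q c N \<omega> =
     (\<Sum>(ks, ls) \<in> {(ks, ls) \<in> idx_lists p q. set ks \<subseteq> {..<N} \<and> set ls \<subseteq> {..<N}}.
        c ks ls * wi_basis zeta ks ls \<omega>)"

text \<open>The complex multiple Wiener-Ito integral I_{p,q}(f): the continuous (L^2) extension,
  i.e. the L^2(M)-limit of the truncations.\<close>
definition wi :: "'w measure \<Rightarrow> (nat \<Rightarrow> 'w \<Rightarrow> complex) \<Rightarrow> nat \<Rightarrow> nat
     \<Rightarrow> (nat list \<Rightarrow> nat list \<Rightarrow> complex) \<Rightarrow> 'w \<Rightarrow> complex" where
  "wi M zeta p q c = (SOME X. X \<in> borel_measurable M \<and>
     ((\<lambda>N. \<integral>\<^sup>+ \<omega>. ennreal ((cmod (X \<omega> - wi_trunc zeta p q c N \<omega>))\<^sup>2) \<partial>M) \<longlonglongrightarrow> 0))"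

definition cnormal :: "real \<Rightarrow> (real \<times> real) measure" where
  "cnormal s2 = (if s2 = 0 then return borel (0, 0)
     else density lborel (\<lambda>(x, y). ennreal (normal_density 0 (sqrt (s2 / 2)) x
                                            * normal_density 0 (sqrt (s2 / 2)) y)))"

definition conv_distr :: "'w measure \<Rightarrow> (nat \<Rightarrow> 'w \<Rightarrow> complex) \<Rightarrow> (real \<times> real) measure \<Rightarrow> bool" where
  "conv_distr M X \<mu> \<longleftrightarrow>
     (\<forall>g :: real \<times> real \<Rightarrow> real. continuous_on UNIV g \<longrightarrow> bounded (range g) \<longrightarrow>
        (\<lambda>n. \<integral>\<omega>. g (Re (X n \<omega>), Im (X n \<omega>)) \<partial>M) \<longlonglongrightarrow> (\<integral>x. g x \<partial>\<mu>))"

end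

theory Submission
  imports Defs "HOL-Real_Asymp.Real_Asymp"
begin

text \<open>A chaos \<open>I\<^sub>p\<^sub>q(f)\<close> is an eigenvector, with eigenvalue \<open>p + q\<close>, of the number operator, so Gaussian
  integration by parts shows that \<open>\<phi>(s) = E exp (i s Re (conj u F))\<close> satisfies
  \<open>\<phi>' = - s E[Re (conj u F)\<^sup>2] \<phi>\<close> up to the \<open>L\<^sup>2\<close> fluctuations of the carre du champ of pairs of
  chaoses. No product formula is needed for these: differentiating repeatedly, the Gaussian Poincare
  inequality bounds the variance by the squared norms of all non-trivial mixed contractions, and by
  the Cauchy-Schwarz inequality each of them is at most the geometric mean of a self-contraction
  of either kernel, at least one of which tends to zero. This is carried out for truncated kernels,
  whose contractions are dominated by those of the full kernels; the limit is then taken in the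
  truncation, in \<open>n\<close>, and in the order of the chaos. The vanishing of the products
  \<open>E[I\<^sub>p\<^sub>q I\<^sub>p\<^sub>'\<^sub>q\<^sub>']\<close> makes the limiting Gaussian circular.\<close>

section \<open>Gaussian integration by parts\<close>

text \<open>The two groups of slots of a kernel are merged: \<open>gker\<close> turns a kernel of
  type \<open>(p, q)\<close> into one symmetric kernel of order \<open>p + q\<close> over
  directions, a direction being a variable or its conjugate. Pairs of contraction indices then
  collapse into a single number \<open>r\<close>, and a self-contraction splits back into those of
  \<open>contr_lim\<close>, weighted by binomial coefficients. For two kernels of orders
  \<open>m\<close> and \<open>k\<close>, the contraction over \<open>r = m = k\<close> slots gives
  their mixed moment and need not vanish; it is exactly the mean that a variance removes. For
  \<open>r = m < k\<close> one self-contraction is a full norm, bounded by \<open>lim_var\<close>,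
  and the smallness comes from the other kernel. The calculus runs in finitely many coordinates,
  whereas \<open>contr_lim\<close> concerns infinite inner sums. The contraction of a truncated
  kernel is not the truncation of a contraction, since the inner sum is cut off as well and could
  lose cancellations; a monotonicity of Gram matrices mediates. Every estimate is uniform in the
  number of variables.\<close>

abbreviation half_normal :: "real measure" where
  "half_normal \<equiv> density lborel (\<lambda>x. ennreal (normal_density 0 (sqrt (1/2)) x))"

lemma half_normal_density: "normal_density 0 (sqrt (1/2)) x = exp (- x\<^sup>2) / sqrt pi"
  by (simp add: normal_density_def)

lemma prob_half_normal: "prob_space half_normal"
  by (rule prob_space_normal_density) simp

text \<open>Compared with the standard normal density, variance 1/2 leaves a spare factor
  \<open>exp (- x^2 / 2)\<close>, and completing the square lets it absorb any exponential of
  \<open>c * |x|\<close>.\<close>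

lemma exp_abs_half_normal:
  assumes "c \<ge> 0"
  shows "exp (c * \<bar>x\<bar>) * normal_density 0 (sqrt (1/2)) x \<le> (exp (c\<^sup>2/2) * sqrt 2) * std_normal_density x"
proof -
  have "0 \<le> (c - \<bar>x\<bar>)\<^sup>2" by simp
  then have "c * \<bar>x\<bar> - x\<^sup>2 \<le> c\<^sup>2/2 - x\<^sup>2/2"
    by (simp add: power2_eq_square algebra_simps)
  then have "exp (c * \<bar>x\<bar> - x\<^sup>2) \<le> exp (c\<^sup>2/2 - x\<^sup>2/2)" by simp
  then have "exp (c * \<bar>x\<bar>) * exp (- x\<^sup>2) \<le> exp (c\<^sup>2/2) * exp (- x\<^sup>2/2)"
    by (simp add: mult_exp_exp)
  then show ?thesis
    unfolding half_normal_density std_normal_density_def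
    by (simp add: real_sqrt_mult field_simps)
qed

lemma integrable_std_normal_density: "integrable lborel std_normal_density"
  by (rule integrable_normal_density) simp

lemma integrable_half_normal_exp:
  assumes c: "c \<ge> 0"
  shows "integrable half_normal (\<lambda>x. exp (c * \<bar>x\<bar>))"
proof (subst integrable_density)
  show "integrable lborel (\<lambda>x. normal_density 0 (sqrt (1/2)) x *\<^sub>R exp (c * \<bar>x\<bar>))"
  proof (rule Bochner_Integration.integrable_bound[OF integrable_mult_right[OF integrable_std_normal_density, of "exp (c\<^sup>2/2) * sqrt 2"]])
    show "AE x in lborel. norm (normal_density 0 (sqrt (1/2)) x *\<^sub>R exp (c * \<bar>x\<bar>)) \<le> norm (exp (c\<^sup>2/2) * sqrt 2 * std_normal_density x)"
      using exp_abs_half_normal[OF c] by (intro AE_I2) (simp add: mult.commute)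
  qed measurable
qed auto

text \<open>Stein's identity for variance 1/2: the product of the density and \<open>g\<close>
  vanishes at both ends and has an integrable derivative, so the integral of that derivative is 0.
  Exponential growth is the class in which the later integrands lie.\<close>

lemma half_normal_ibp:
  fixes g g' :: "real \<Rightarrow> complex"
  assumes d: "\<And>x. (g has_vector_derivative g' x) (at x)"
    and cont: "continuous_on UNIV g'"
    and b: "\<And>x. cmod (g x) \<le> C * exp (c * \<bar>x\<bar>)" "\<And>x. cmod (g' x) \<le> C * exp (c * \<bar>x\<bar>)"
    and c: "c \<ge> 0"
  shows "(\<integral>x. of_real x * g x \<partial>half_normal) = (1/2) * (\<integral>x. g' x \<partial>half_normal)"
proof -
  let ?n = "normal_density 0 (sqrt (1/2))"
  \<comment> \<open>The exponent \<open>c + 1\<close> in place of \<open>c\<close> leaves one factor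
    \<open>exp |x|\<close>, which dominates the factor \<open>|x|\<close> on the left of the
    identity.\<close>
  define K where "K = exp ((c+1)\<^sup>2/2) * sqrt 2"
  have C: "C \<ge> 0" using order_trans[OF norm_ge_zero b(1)[of 0]] by simp
  have K: "exp (c * \<bar>x\<bar>) * ?n x \<le> K * std_normal_density x" "\<bar>x\<bar> * exp (c * \<bar>x\<bar>) * ?n x \<le> K * std_normal_density x" for x
  proof -
    have e: "exp ((c+1) * \<bar>x\<bar>) * ?n x \<le> K * std_normal_density x"
      unfolding K_def using c by (intro exp_abs_half_normal) auto
    have "\<bar>x\<bar> \<le> exp \<bar>x\<bar>" using exp_ge_add_one_self[of "\<bar>x\<bar>"] by linarith
    then have "\<bar>x\<bar> * exp (c * \<bar>x\<bar>) \<le> exp ((c+1) * \<bar>x\<bar>)"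
      by (simp add: algebra_simps exp_add mult_left_mono)
    then show "\<bar>x\<bar> * exp (c * \<bar>x\<bar>) * ?n x \<le> K * std_normal_density x"
      using e by (smt (verit) mult_right_mono normal_density_nonneg)
    have "exp (c * \<bar>x\<bar>) \<le> exp ((c+1) * \<bar>x\<bar>)" by (simp add: algebra_simps)
    then show "exp (c * \<bar>x\<bar>) * ?n x \<le> K * std_normal_density x"
      using e by (smt (verit) mult_right_mono normal_density_nonneg)
  qed
  have gc: "continuous_on UNIV g"
    using d by (meson continuous_at_imp_continuous_on has_vector_derivative_continuous)
  have gm[measurable]: "g \<in> borel_measurable borel" "g' \<in> borel_measurable borel"
    using gc cont by (auto intro: borel_measurable_continuous_onI)
  have nn: "normal_density 0 (sqrt (1/2)) x \<ge> 0" for x by simp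
  have i1: "integrable lborel (\<lambda>x. of_real (?n x) * g' x)"
  proof (rule Bochner_Integration.integrable_bound[OF integrable_mult_right[OF integrable_std_normal_density, of "C*K"]])
    show "AE x in lborel. norm (of_real (?n x) * g' x) \<le> norm (C * K * std_normal_density x)"
    proof (rule AE_I2)
      fix x
      have "norm (of_real (?n x) * g' x) = cmod (g' x) * ?n x" by (simp add: norm_mult)
      also have "\<dots> \<le> (C * exp (c * \<bar>x\<bar>)) * ?n x" using b(2)[of x] by (intro mult_right_mono) auto
      also have "\<dots> \<le> C * (K * std_normal_density x)" using K(1)[of x] C by (simp add: mult_left_mono mult.assoc)
      also have "\<dots> \<le> norm (C * K * std_normal_density x)" by simp
      finally show "norm (of_real (?n x) * g' x) \<le> norm (C * K * std_normal_density x)" .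
    qed
  qed measurable
  have xg: "cmod (of_real x * g x) * ?n x \<le> C * (K * std_normal_density x)" for x
  proof -
    have "cmod (of_real x * g x) * ?n x = \<bar>x\<bar> * cmod (g x) * ?n x" by (simp add: norm_mult)
    also have "\<dots> \<le> \<bar>x\<bar> * (C * exp (c * \<bar>x\<bar>)) * ?n x" using b(1)[of x] by (intro mult_right_mono mult_left_mono) auto
    also have "\<dots> \<le> C * (K * std_normal_density x)"
      using mult_left_mono[OF K(2)[of x] C] by (simp add: algebra_simps)
    finally show ?thesis .
  qed
  have i2: "integrable lborel (\<lambda>x. of_real (?n x) * (of_real x * g x))"
  proof (rule Bochner_Integration.integrable_bound[OF integrable_mult_right[OF integrable_std_normal_density, of "C*K"]])
    show "AE x in lborel. norm (of_real (?n x) * (of_real x * g x)) \<le> norm (C * K * std_normal_density x)"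
    proof (rule AE_I2)
      fix x
      have "norm (of_real (?n x) * (of_real x * g x)) = cmod (of_real x * g x) * ?n x" by (simp add: norm_mult)
      also have "\<dots> \<le> C * (K * std_normal_density x)" by (rule xg)
      also have "\<dots> \<le> norm (C * K * std_normal_density x)" by simp
      finally show "norm (of_real (?n x) * (of_real x * g x)) \<le> norm (C * K * std_normal_density x)" .
    qed
  qed measurable
  define F where "F = (\<lambda>x. of_real (?n x) * g x)"
  define f where "f = (\<lambda>x. of_real (?n x) * g' x - 2 * (of_real (?n x) * (of_real x * g x)))"
  have nd: "(?n has_real_derivative (- 2 * x * ?n x)) (at x)" for x
  proof -
    have "((\<lambda>x. exp (- x\<^sup>2)) has_real_derivative (- 2 * x * exp (- x\<^sup>2))) (at x)"
      by (auto intro!: derivative_eq_intros)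
    from DERIV_cdivide[OF this, of "sqrt pi"] show ?thesis
      unfolding half_normal_density by simp
  qed
  have nd': "((\<lambda>x. complex_of_real (?n x)) has_vector_derivative of_real (- 2 * x * ?n x)) (at x)" for x
    using has_vector_derivative_of_real[OF nd] by simp
  have Fd: "(F has_vector_derivative f x) (at x)" for x
    unfolding F_def f_def using has_vector_derivative_mult[OF nd'[of x] d[of x]]
    by (simp add: algebra_simps)
  have nc: "continuous_on UNIV (\<lambda>x. ?n x)"
    by (intro continuous_at_imp_continuous_on ballI) (use nd DERIV_isCont in blast)
  have fc: "isCont f x" for x
  proof -
    have "continuous_on UNIV f" unfolding f_def
      by (intro continuous_intros cont gc nc)
    then show ?thesis by (simp add: continuous_on_eq_continuous_at)
  qed
  have fi: "integrable lborel f" unfolding f_def using i1 i2 by auto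
  have Fle: "cmod (F x) \<le> C * K * std_normal_density x" for x
  proof -
    have "cmod (F x) = cmod (g x) * ?n x" by (simp add: F_def norm_mult)
    also have "\<dots> \<le> (C * exp (c * \<bar>x\<bar>)) * ?n x" using b(1)[of x] by (intro mult_right_mono) auto
    also have "\<dots> \<le> C * K * std_normal_density x" using K(1)[of x] C by (simp add: mult_left_mono mult.assoc)
    finally show ?thesis .
  qed
  have "((\<lambda>x. std_normal_density x) \<longlongrightarrow> 0) at_top" "((\<lambda>x. std_normal_density x) \<longlongrightarrow> 0) at_bot"
    unfolding std_normal_density_def by real_asymp+
  then have sl: "((\<lambda>x. C * K * std_normal_density x) \<longlongrightarrow> 0) at_top" "((\<lambda>x. C * K * std_normal_density x) \<longlongrightarrow> 0) at_bot"
    using tendsto_mult_right_zero by blast+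
  have Fl: "(F \<longlongrightarrow> 0) at_top" "(F \<longlongrightarrow> 0) at_bot"
    by (rule Lim_null_comparison[OF _ sl(1)], simp add: Fle, rule Lim_null_comparison[OF _ sl(2)], simp add: Fle)
  have "(LBINT x=-\<infinity>..\<infinity>. f x) = 0 - 0"
  proof (rule interval_integral_FTC_integrable)
    show "set_integrable lborel (einterval (- \<infinity>) \<infinity>) f"
      using fi by (simp add: set_integrable_def)
    show "((F \<circ> real_of_ereal) \<longlongrightarrow> 0) (at_right (- \<infinity>))" using Fl by (simp add: ereal_tendsto_simps)
    show "((F \<circ> real_of_ereal) \<longlongrightarrow> 0) (at_left \<infinity>)" using Fl by (simp add: ereal_tendsto_simps)
  qed (use Fd fc in auto)
  then have "(\<integral>x. f x \<partial>lborel) = 0"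
    by (simp add: interval_lebesgue_integral_def set_lebesgue_integral_def)
  then have e: "(\<integral>x. of_real (?n x) * g' x \<partial>lborel) = 2 * (\<integral>x. of_real (?n x) * (of_real x * g x) \<partial>lborel)"
    unfolding f_def using i1 i2 by simp
  have dd: "(\<integral>x. h x \<partial>half_normal) = (\<integral>x. of_real (?n x) * h x \<partial>lborel)"
    if [measurable]: "h \<in> borel_measurable borel" for h :: "real \<Rightarrow> complex"
    by (subst integral_density) (auto simp: scaleR_conv_of_real)
  show ?thesis by (subst (1 2) dd) (auto simp: e)
qed


section \<open>The unit complex Gaussian law and its integration by parts\<close>

lemma cnormal_pair:
  assumes "s2 > 0"
  shows "cnormal s2 = density lborel (\<lambda>x. ennreal (normal_density 0 (sqrt (s2/2)) x)) \<Otimes>\<^sub>M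
                      density lborel (\<lambda>x. ennreal (normal_density 0 (sqrt (s2/2)) x))"
proof -
  interpret prob_space "density lborel (\<lambda>x. ennreal (normal_density 0 (sqrt (s2/2)) x))"
    using assms by (intro prob_space_normal_density) simp
  show ?thesis
    unfolding cnormal_def using assms
    by (subst pair_measure_density)
       (auto simp: lborel_prod ennreal_mult' case_prod_beta' sigma_finite_measure_axioms
         intro: lborel.sigma_finite_measure_axioms)
qed

lemma prob_cnormal: "s2 \<ge> 0 \<Longrightarrow> prob_space (cnormal s2)"
proof (cases "s2 = 0")
  case True
  then show ?thesis by (simp add: cnormal_def prob_space_return)
next
  case False
  assume "s2 \<ge> 0"
  with False have s: "s2 > 0" by simp
  interpret N: prob_space "density lborel (\<lambda>x. ennreal (normal_density 0 (sqrt (s2/2)) x))"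
    using s by (intro prob_space_normal_density) simp
  interpret pair_prob_space "density lborel (\<lambda>x. ennreal (normal_density 0 (sqrt (s2/2)) x))"
    "density lborel (\<lambda>x. ennreal (normal_density 0 (sqrt (s2/2)) x))" ..
  show ?thesis unfolding cnormal_pair[OF s] by (rule prob_space_axioms)
qed

lemma sets_cnormal[measurable_cong]: "sets (cnormal s2) = sets borel"
  by (simp add: cnormal_def)

definition cgauss :: "complex measure" where
  "cgauss = distr (cnormal 1) borel (\<lambda>(x, y). Complex x y)"

lemma Complex_measurable[measurable]: "(\<lambda>(x, y). Complex x y) \<in> borel_measurable borel"
proof -
  have "(\<lambda>p::real\<times>real. of_real (fst p) + \<i> * of_real (snd p)) \<in> borel_measurable borel"
    by (intro borel_measurable_continuous_onI continuous_intros)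
  then show ?thesis by (simp add: case_prod_beta' Complex_eq)
qed

lemma sets_cgauss[simp, measurable_cong]: "sets cgauss = sets borel"
  by (simp add: cgauss_def)

lemma space_cgauss[simp]: "space cgauss = UNIV"
  by (simp add: cgauss_def)

lemma prob_cgauss: "prob_space cgauss"
  unfolding cgauss_def
  by (intro prob_space.prob_space_distr prob_cnormal) auto

lemma cgauss_pair: "cgauss = distr (half_normal \<Otimes>\<^sub>M half_normal) borel (\<lambda>(x, y). Complex x y)"
  by (simp add: cgauss_def cnormal_pair)

lemma integral_cgauss:
  fixes h :: "complex \<Rightarrow> 'b :: {banach, second_countable_topology}"
  assumes [measurable]: "h \<in> borel_measurable borel"
  shows "(\<integral>w. h w \<partial>cgauss) = (\<integral>p. h (Complex (fst p) (snd p)) \<partial>(half_normal \<Otimes>\<^sub>M half_normal))"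
    and "integrable cgauss h \<longleftrightarrow> integrable (half_normal \<Otimes>\<^sub>M half_normal) (\<lambda>p. h (Complex (fst p) (snd p)))"
proof -
  have [measurable]: "(\<lambda>(x, y). Complex x y) \<in> borel_measurable (half_normal \<Otimes>\<^sub>M half_normal)"
    using Complex_measurable by (simp add: borel_prod[symmetric])
  show "(\<integral>w. h w \<partial>cgauss) = (\<integral>p. h (Complex (fst p) (snd p)) \<partial>(half_normal \<Otimes>\<^sub>M half_normal))"
    unfolding cgauss_pair by (subst integral_distr) (auto simp: case_prod_beta')
  show "integrable cgauss h \<longleftrightarrow> integrable (half_normal \<Otimes>\<^sub>M half_normal) (\<lambda>p. h (Complex (fst p) (snd p)))"
    unfolding cgauss_pair by (subst integrable_distr_eq) (auto simp: case_prod_beta')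
qed

lemma integrable_half_normal_pair_exp:
  assumes c: "c \<ge> 0"
  shows "integrable (half_normal \<Otimes>\<^sub>M half_normal) (\<lambda>p. exp (c * (\<bar>fst p\<bar> + \<bar>snd p\<bar>)))"
proof -
  interpret prob_space half_normal by (rule prob_half_normal)
  interpret P: pair_prob_space half_normal half_normal ..
  show ?thesis
  proof (rule P.Fubini_integrable)
    show "integrable half_normal (\<lambda>x. \<integral>y. norm (exp (c * (\<bar>fst (x, y)\<bar> + \<bar>snd (x, y)\<bar>))) \<partial>half_normal)"
      using integrable_half_normal_exp[OF c] by (simp add: distrib_left exp_add)
    show "AE x in half_normal. integrable half_normal (\<lambda>y. exp (c * (\<bar>fst (x, y)\<bar> + \<bar>snd (x, y)\<bar>)))"
      using integrable_half_normal_exp[OF c] by (simp add: distrib_left exp_add)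
  qed measurable
qed

lemma integrable_cgauss_exp:
  assumes c: "c \<ge> 0"
  shows "integrable cgauss (\<lambda>w. exp (c * cmod w))"
proof (subst integral_cgauss)
  show "integrable (half_normal \<Otimes>\<^sub>M half_normal) (\<lambda>p. exp (c * cmod (Complex (fst p) (snd p))))"
  proof (rule Bochner_Integration.integrable_bound[OF integrable_half_normal_pair_exp[OF c]])
    have "(\<lambda>p::real \<times> real. Complex (fst p) (snd p)) \<in> borel_measurable (borel \<Otimes>\<^sub>M borel)"
      using Complex_measurable by (simp add: borel_prod case_prod_beta')
    then show "(\<lambda>p. exp (c * cmod (Complex (fst p) (snd p)))) \<in> borel_measurable (half_normal \<Otimes>\<^sub>M half_normal)"
      by measurable
    show "AE p in half_normal \<Otimes>\<^sub>M half_normal. norm (exp (c * cmod (Complex (fst p) (snd p)))) \<le> norm (exp (c * (\<bar>fst p\<bar> + \<bar>snd p\<bar>)))"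
    proof (rule AE_I2)
      fix p
      have "cmod (Complex (fst p) (snd p)) \<le> \<bar>fst p\<bar> + \<bar>snd p\<bar>"
        using cmod_le[of "Complex (fst p) (snd p)"] by simp
      then show "norm (exp (c * cmod (Complex (fst p) (snd p)))) \<le> norm (exp (c * (\<bar>fst p\<bar> + \<bar>snd p\<bar>)))"
        using c by (simp add: mult_left_mono)
    qed
  qed
qed simp

text \<open>The derivative of \<open>g\<close> along the real axis is \<open>a + b\<close>, along
  the imaginary axis \<open>i (a - b)\<close>. Stein's identity in each real variable yields half of
  \<open>a + b\<close> plus half of \<open>i\<close> times \<open>i (a - b)\<close>, and only the
  conjugate derivative \<open>b\<close> survives.\<close>

lemma cgauss_ibp:
  fixes g a b :: "complex \<Rightarrow> complex"
  assumes d: "\<And>w. (g has_derivative (\<lambda>h. a w * h + b w * cnj h)) (at w)"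
    and cont: "continuous_on UNIV a" "continuous_on UNIV b"
    and bd: "\<And>w. cmod (g w) \<le> C * exp (c * cmod w)" "\<And>w. cmod (a w) \<le> C * exp (c * cmod w)"
       "\<And>w. cmod (b w) \<le> C * exp (c * cmod w)"
    and c: "c \<ge> 0"
  shows "(\<integral>w. w * g w \<partial>cgauss) = (\<integral>w. b w \<partial>cgauss)"
proof -
  interpret prob_space half_normal by (rule prob_half_normal)
  interpret P: pair_prob_space half_normal half_normal ..
  let ?HH = "half_normal \<Otimes>\<^sub>M half_normal"
  have C: "C \<ge> 0" using order_trans[OF norm_ge_zero bd(1)[of 0]] by simp
  have gc: "continuous_on UNIV g"
    using d by (meson continuous_at_imp_continuous_on has_derivative_continuous)
  have [measurable]: "g \<in> borel_measurable borel" "a \<in> borel_measurable borel" "b \<in> borel_measurable borel"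
    using gc cont by (auto intro: borel_measurable_continuous_onI)
  have Cm[measurable]: "(\<lambda>p::real \<times> real. Complex (fst p) (snd p)) \<in> borel_measurable (borel \<Otimes>\<^sub>M borel)"
      using Complex_measurable by (simp add: borel_prod case_prod_beta')
  have Cp: "cmod (Complex x y) \<le> \<bar>x\<bar> + \<bar>y\<bar>" for x y using cmod_le[of "Complex x y"] by simp
  have E: "exp (c * cmod (Complex x y)) \<le> exp (c * (\<bar>x\<bar> + \<bar>y\<bar>))" for x y
    using Cp[of x y] c by (simp add: mult_left_mono)
  have int: "integrable ?HH (\<lambda>p. h (Complex (fst p) (snd p)))"
    "integrable ?HH (\<lambda>p. of_real (fst p) * h (Complex (fst p) (snd p)))"
    "integrable ?HH (\<lambda>p. of_real (snd p) * h (Complex (fst p) (snd p)))"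
    if h: "\<And>w. cmod (h w) \<le> C * exp (c * cmod w)" and [measurable]: "h \<in> borel_measurable borel" for h :: "complex \<Rightarrow> complex"
  proof -
    have hb: "cmod (h (Complex x y)) \<le> C * exp (c * (\<bar>x\<bar> + \<bar>y\<bar>))" for x y
      using h[of "Complex x y"] mult_left_mono[OF E[of x y] C] by linarith
    have l: "r \<le> exp r" for r :: real using exp_ge_add_one_self[of r] by linarith
    have i1: "integrable ?HH (\<lambda>p. C * exp (c * (\<bar>fst p\<bar> + \<bar>snd p\<bar>)))"
      using integrable_half_normal_pair_exp[OF c] by simp
    have i2: "integrable ?HH (\<lambda>p. C * exp ((c+1) * (\<bar>fst p\<bar> + \<bar>snd p\<bar>)))"
      using integrable_half_normal_pair_exp[of "c+1"] c by simp
    have b2: "\<bar>t\<bar> * (C * exp (c * (\<bar>x\<bar> + \<bar>y\<bar>))) \<le> C * exp ((c+1) * (\<bar>x\<bar> + \<bar>y\<bar>))" if "\<bar>t\<bar> \<le> \<bar>x\<bar> + \<bar>y\<bar>" for t x y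
    proof -
      have "\<bar>t\<bar> \<le> exp (\<bar>x\<bar> + \<bar>y\<bar>)" using l[of "\<bar>x\<bar> + \<bar>y\<bar>"] that by linarith
      then have "\<bar>t\<bar> * (C * exp (c * (\<bar>x\<bar> + \<bar>y\<bar>))) \<le> exp (\<bar>x\<bar> + \<bar>y\<bar>) * (C * exp (c * (\<bar>x\<bar> + \<bar>y\<bar>)))"
        using C by (intro mult_right_mono) auto
      also have "\<dots> = C * exp ((c+1) * (\<bar>x\<bar> + \<bar>y\<bar>))"
        by (simp add: distrib_right exp_add)
      finally show ?thesis .
    qed
    show "integrable ?HH (\<lambda>p. h (Complex (fst p) (snd p)))"
      by (rule Bochner_Integration.integrable_bound[OF i1]) (use hb C in \<open>auto simp: abs_mult intro!: AE_I2\<close>)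
    show "integrable ?HH (\<lambda>p. of_real (fst p) * h (Complex (fst p) (snd p)))"
    proof (rule Bochner_Integration.integrable_bound[OF i2])
      show "AE p in ?HH. norm (of_real (fst p) * h (Complex (fst p) (snd p))) \<le> norm (C * exp ((c+1) * (\<bar>fst p\<bar> + \<bar>snd p\<bar>)))"
      proof (rule AE_I2)
        fix p :: "real \<times> real"
        have "norm (of_real (fst p) * h (Complex (fst p) (snd p))) \<le> \<bar>fst p\<bar> * (C * exp (c * (\<bar>fst p\<bar> + \<bar>snd p\<bar>)))"
          using hb[of "fst p" "snd p"] by (simp add: norm_mult mult_left_mono)
        also have "\<dots> \<le> C * exp ((c+1) * (\<bar>fst p\<bar> + \<bar>snd p\<bar>))" by (rule b2) simp
        finally show "norm (of_real (fst p) * h (Complex (fst p) (snd p))) \<le> norm (C * exp ((c+1) * (\<bar>fst p\<bar> + \<bar>snd p\<bar>)))"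
          using C by (simp add: abs_mult)
      qed
    qed measurable
    show "integrable ?HH (\<lambda>p. of_real (snd p) * h (Complex (fst p) (snd p)))"
    proof (rule Bochner_Integration.integrable_bound[OF i2])
      show "AE p in ?HH. norm (of_real (snd p) * h (Complex (fst p) (snd p))) \<le> norm (C * exp ((c+1) * (\<bar>fst p\<bar> + \<bar>snd p\<bar>)))"
      proof (rule AE_I2)
        fix p :: "real \<times> real"
        have "norm (of_real (snd p) * h (Complex (fst p) (snd p))) \<le> \<bar>snd p\<bar> * (C * exp (c * (\<bar>fst p\<bar> + \<bar>snd p\<bar>)))"
          using hb[of "fst p" "snd p"] by (simp add: norm_mult mult_left_mono)
        also have "\<dots> \<le> C * exp ((c+1) * (\<bar>fst p\<bar> + \<bar>snd p\<bar>))" by (rule b2) simp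
        finally show "norm (of_real (snd p) * h (Complex (fst p) (snd p))) \<le> norm (C * exp ((c+1) * (\<bar>fst p\<bar> + \<bar>snd p\<bar>)))"
          using C by (simp add: abs_mult)
      qed
    qed measurable
  qed
  have cxc: "continuous_on UNIV (\<lambda>x. h (Complex x y))" "continuous_on UNIV (\<lambda>y. h (Complex x y))"
    if "continuous_on UNIV h" for h :: "complex \<Rightarrow> complex" and x y
    using that by (auto intro!: continuous_on_compose2[OF that] continuous_intros simp: Complex_eq)
  have ibx: "(\<integral>x. of_real x * g (Complex x y) \<partial>half_normal) = (1/2) * (\<integral>x. a (Complex x y) + b (Complex x y) \<partial>half_normal)" for y
  proof (rule half_normal_ibp[where C="2 * C * exp (c * \<bar>y\<bar>)" and c=c])
    show "((\<lambda>x. g (Complex x y)) has_vector_derivative a (Complex x y) + b (Complex x y)) (at x)" for x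
    proof -
      have "((\<lambda>x. Complex x y) has_derivative (\<lambda>h. of_real h)) (at x)"
        unfolding Complex_eq by (auto intro!: derivative_eq_intros)
      from has_derivative_compose[OF this d[of "Complex x y"]] show ?thesis
        unfolding has_vector_derivative_def by (simp add: scaleR_conv_of_real algebra_simps)
    qed
    show "continuous_on UNIV (\<lambda>x. a (Complex x y) + b (Complex x y))"
      by (intro continuous_on_add cxc cont)
    fix x
    have e: "C * exp (c * cmod (Complex x y)) \<le> C * exp (c * \<bar>y\<bar>) * exp (c * \<bar>x\<bar>)"
      using mult_left_mono[OF E[of x y] C] by (simp add: distrib_left exp_add mult_ac)
    have z: "0 \<le> C * exp (c * \<bar>y\<bar>) * exp (c * \<bar>x\<bar>)" using C by simp
    show "cmod (g (Complex x y)) \<le> 2 * C * exp (c * \<bar>y\<bar>) * exp (c * \<bar>x\<bar>)"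
      using bd(1)[of "Complex x y"] e z by linarith
    show "cmod (a (Complex x y) + b (Complex x y)) \<le> 2 * C * exp (c * \<bar>y\<bar>) * exp (c * \<bar>x\<bar>)"
      using bd(2,3)[of "Complex x y"] e norm_triangle_ineq[of "a (Complex x y)" "b (Complex x y)"] by linarith
  qed (rule c)
  have iby: "(\<integral>y. of_real y * g (Complex x y) \<partial>half_normal) = (1/2) * (\<integral>y. \<i> * (a (Complex x y) - b (Complex x y)) \<partial>half_normal)" for x
  proof (rule half_normal_ibp[where C="2 * C * exp (c * \<bar>x\<bar>)" and c=c])
    show "((\<lambda>y. g (Complex x y)) has_vector_derivative \<i> * (a (Complex x y) - b (Complex x y))) (at y)" for y
    proof -
      have "((\<lambda>y. Complex x y) has_derivative (\<lambda>h. \<i> * of_real h)) (at y)"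
        unfolding Complex_eq by (auto intro!: derivative_eq_intros)
      from has_derivative_compose[OF this d[of "Complex x y"]] show ?thesis
        unfolding has_vector_derivative_def by (simp add: scaleR_conv_of_real algebra_simps)
    qed
    show "continuous_on UNIV (\<lambda>y. \<i> * (a (Complex x y) - b (Complex x y)))"
      by (intro continuous_on_mult continuous_on_diff cxc cont continuous_on_const)
    fix y
    have e: "C * exp (c * cmod (Complex x y)) \<le> C * exp (c * \<bar>x\<bar>) * exp (c * \<bar>y\<bar>)"
      using mult_left_mono[OF E[of x y] C] by (simp add: distrib_left exp_add mult_ac)
    have z: "0 \<le> C * exp (c * \<bar>x\<bar>) * exp (c * \<bar>y\<bar>)" using C by simp
    show "cmod (g (Complex x y)) \<le> 2 * C * exp (c * \<bar>x\<bar>) * exp (c * \<bar>y\<bar>)"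
      using bd(1)[of "Complex x y"] e z by linarith
    show "cmod (\<i> * (a (Complex x y) - b (Complex x y))) \<le> 2 * C * exp (c * \<bar>x\<bar>) * exp (c * \<bar>y\<bar>)"
      using bd(2,3)[of "Complex x y"] e norm_triangle_ineq4[of "a (Complex x y)" "b (Complex x y)"]
      by (simp add: norm_mult)
  qed (rule c)
  note ig = int[of g, OF bd(1)] and ia = int[of a, OF bd(2)] and ib = int[of b, OF bd(3)]
  let ?z = "\<lambda>p. Complex (fst p) (snd p)"
  have "(\<integral>w. w * g w \<partial>cgauss) = (\<integral>p. ?z p * g (?z p) \<partial>?HH)"
    by (rule integral_cgauss) measurable
  also have "\<dots> = (\<integral>p. of_real (fst p) * g (?z p) + \<i> * (of_real (snd p) * g (?z p)) \<partial>?HH)"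
    by (simp add: Complex_eq algebra_simps)
  also have "\<dots> = (\<integral>p. of_real (fst p) * g (?z p) \<partial>?HH) + \<i> * (\<integral>p. of_real (snd p) * g (?z p) \<partial>?HH)"
    using ig by (subst Bochner_Integration.integral_add) auto
  also have "(\<integral>p. of_real (fst p) * g (?z p) \<partial>?HH) = (\<integral>y. (\<integral>x. of_real x * g (Complex x y) \<partial>half_normal) \<partial>half_normal)"
    using P.integral_snd[of "\<lambda>x y. of_real x * g (Complex x y)"] ig(2) by (simp add: case_prod_beta')
  also have "\<dots> = (1/2) * (\<integral>y. (\<integral>x. a (Complex x y) + b (Complex x y) \<partial>half_normal) \<partial>half_normal)"
    unfolding ibx by simp
  also have "(\<integral>y. (\<integral>x. a (Complex x y) + b (Complex x y) \<partial>half_normal) \<partial>half_normal) = (\<integral>p. a (?z p) + b (?z p) \<partial>?HH)"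
    using P.integral_snd[of "\<lambda>x y. a (Complex x y) + b (Complex x y)"] ia(1) ib(1) by (simp add: case_prod_beta')
  also have "(\<integral>p. of_real (snd p) * g (?z p) \<partial>?HH) = (\<integral>x. (\<integral>y. of_real y * g (Complex x y) \<partial>half_normal) \<partial>half_normal)"
    using P.integral_fst[of "\<lambda>x y. of_real y * g (Complex x y)"] ig(3) by (simp add: case_prod_beta')
  also have "\<dots> = (1/2) * (\<integral>x. (\<integral>y. \<i> * (a (Complex x y) - b (Complex x y)) \<partial>half_normal) \<partial>half_normal)"
    unfolding iby by simp
  also have "(\<integral>x. (\<integral>y. \<i> * (a (Complex x y) - b (Complex x y)) \<partial>half_normal) \<partial>half_normal) = (\<integral>p. \<i> * (a (?z p) - b (?z p)) \<partial>?HH)"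
    using P.integral_fst[of "\<lambda>x y. \<i> * (a (Complex x y) - b (Complex x y))"] ia(1) ib(1) by (simp add: case_prod_beta')
  also have "1/2 * (\<integral>p. a (?z p) + b (?z p) \<partial>?HH) + \<i> * (1/2 * (\<integral>p. \<i> * (a (?z p) - b (?z p)) \<partial>?HH)) = (\<integral>p. b (?z p) \<partial>?HH)"
    using ia(1) ib(1) by (simp add: field_simps)
  also have "\<dots> = (\<integral>w. b w \<partial>cgauss)"
    by (rule integral_cgauss[symmetric]) measurable
  finally show ?thesis .
qed

section \<open>Levy continuity in the plane\<close>

text \<open>A trigonometric polynomial in \<open>sin (c x)\<close>, \<open>sin (c y)\<close> stays close to a bounded function on
  the whole plane if it does so on one box, because \<open>arcsin (sin (c x)) / c\<close> retracts the line
  onto an interval; together with tightness this yields Levy's continuity theorem in the plane.\<close>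

inductive trig_poly :: "(real \<times> real \<Rightarrow> complex) \<Rightarrow> bool" where
  char: "trig_poly (\<lambda>p. iexp (a * fst p + b * snd p))"
| add: "trig_poly q \<Longrightarrow> trig_poly r \<Longrightarrow> trig_poly (\<lambda>p. q p + r p)"
| cmult: "trig_poly q \<Longrightarrow> trig_poly (\<lambda>p. c * q p)"

lemma trig_poly_mult: "trig_poly q \<Longrightarrow> trig_poly r \<Longrightarrow> trig_poly (\<lambda>p. q p * r p)"
proof (induction rule: trig_poly.induct)
  case (char a b)
  from char show ?case
  proof (induction rule: trig_poly.induct)
    case (char a' b')
    have "trig_poly (\<lambda>p. iexp ((a + a') * fst p + (b + b') * snd p))" by (rule trig_poly.char)
    moreover have "iexp ((a + a') * fst p + (b + b') * snd p) = iexp (a * fst p + b * snd p) * iexp (a' * fst p + b' * snd p)" for p :: "real \<times> real"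
    proof -
      have "(a + a') * fst p + (b + b') * snd p = (a * fst p + b * snd p) + (a' * fst p + b' * snd p)"
        by (simp add: algebra_simps)
      then show ?thesis by (simp only: of_real_add[of "a * fst p + b * snd p"] distrib_left[of \<i>] exp_add)
    qed
    ultimately show ?case by simp
  next
    case (add q r)
    then show ?case by (simp add: distrib_left trig_poly.add)
  next
    case (cmult q c)
    have "trig_poly (\<lambda>p. c * (iexp (a * fst p + b * snd p) * q p))" by (rule trig_poly.cmult[OF cmult.IH])
    then show ?case by (simp only: mult.left_commute)
  qed
next
  case (add q q')
  then show ?case by (simp add: distrib_right trig_poly.add)
next
  case (cmult q c)
  then show ?case by (simp add: mult.assoc trig_poly.cmult)
qed

lemma trig_poly_const: "trig_poly (\<lambda>_. c)"
  using trig_poly.cmult[OF trig_poly.char[of 0 0], of c] by simp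

lemma trig_poly_sin: "trig_poly (\<lambda>p. of_real (sin (a * fst p + b * snd p)))"
proof -
  have "trig_poly (\<lambda>p. (1 / (2 * \<i>)) * iexp (a * fst p + b * snd p) + (- 1 / (2 * \<i>)) * iexp ((- a) * fst p + (- b) * snd p))"
    by (intro trig_poly.add trig_poly.cmult trig_poly.char)
  moreover have "(1 / (2 * \<i>)) * iexp (a * fst p + b * snd p) + (- 1 / (2 * \<i>)) * iexp ((- a) * fst p + (- b) * snd p)
      = of_real (sin (a * fst p + b * snd p))" for p :: "real \<times> real"
  proof -
    have n: "(- a) * fst p + (- b) * snd p = - (a * fst p + b * snd p)" by simp
    have "(1 / (2 * \<i>)) * iexp t + (- 1 / (2 * \<i>)) * iexp (- t) = of_real (sin t)" for t
      unfolding sin_of_real[symmetric] sin_exp_eq by (simp add: diff_divide_distrib right_diff_distrib)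
    then show ?thesis unfolding n .
  qed
  ultimately show ?thesis by simp
qed

lemma trig_poly_real_polynomial:
  fixes P :: "real \<times> real \<Rightarrow> real"
  assumes "real_polynomial_function P"
  shows "trig_poly (\<lambda>p. of_real (P (sin (c * fst p), sin (c * snd p))))"
  using assms
proof (induction rule: real_polynomial_function.induct)
  case (linear h)
  interpret bounded_linear h by fact
  have h: "h (s, t) = s * h (1, 0) + t * h (0, 1)" for s t
    using add[of "s *\<^sub>R (1, 0)" "t *\<^sub>R (0, 1)"] scaleR[of s "(1, 0)"] scaleR[of t "(0, 1)"]
    by (simp del: split_paired_All)
  have "trig_poly (\<lambda>p. of_real (h (1, 0)) * of_real (sin (c * fst p + 0 * snd p)) + of_real (h (0, 1)) * of_real (sin (0 * fst p + c * snd p)))"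
    by (intro trig_poly.add trig_poly.cmult trig_poly_sin)
  moreover have "h (sin (c * fst p), sin (c * snd p)) = sin (c * fst p) * h (1, 0) + sin (c * snd p) * h (0, 1)" for p :: "real \<times> real"
    by (rule h)
  ultimately show ?case by (simp add: mult.commute)
next
  case (const k)
  then show ?case by (simp add: trig_poly_const)
next
  case (add P Q)
  then show ?case by (simp add: trig_poly.add)
next
  case (mult P Q)
  then show ?case by (simp add: trig_poly_mult)
qed

lemma trig_poly_continuous: "trig_poly q \<Longrightarrow> continuous_on UNIV q"
  by (induction rule: trig_poly.induct) (auto intro!: continuous_intros)

lemma trig_poly_bounded: "trig_poly q \<Longrightarrow> \<exists>B. \<forall>p. cmod (q p) \<le> B"
proof (induction rule: trig_poly.induct)
  case (char a b)
  then show ?case by (auto intro!: exI[of _ 1])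
next
  case (add q r)
  then obtain B C where "\<forall>p. cmod (q p) \<le> B" "\<forall>p. cmod (r p) \<le> C" by blast
  then show ?case by (intro exI[of _ "B + C"]) (meson add_mono norm_triangle_ineq order_trans)
next
  case (cmult q c)
  then obtain B where "\<forall>p. cmod (q p) \<le> B" by blast
  then show ?case by (intro exI[of _ "cmod c * B"]) (simp add: norm_mult mult_left_mono)
qed

lemma trig_poly_integrable:
  assumes q: "trig_poly q" and "prob_space \<nu>" and s: "sets \<nu> = sets (borel :: (real \<times> real) measure)"
  shows "integrable \<nu> q"
proof -
  interpret prob_space \<nu> by fact
  obtain B where B: "\<forall>p. cmod (q p) \<le> B" using trig_poly_bounded[OF q] by blast
  have "q \<in> borel_measurable \<nu>"
    using borel_measurable_continuous_onI[OF trig_poly_continuous[OF q]] measurable_cong_sets[OF s refl] by blast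
  then show ?thesis by (intro integrable_const_bound[where B=B]) (auto simp: B)
qed

lemma trig_poly_tendsto:
  assumes q: "trig_poly q" and pm: "\<And>n. prob_space (\<mu> n)" "prob_space \<nu>"
    and s: "\<And>n. sets (\<mu> n) = sets (borel :: (real \<times> real) measure)" "sets \<nu> = sets (borel :: (real \<times> real) measure)"
    and cf: "\<And>a b. (\<lambda>n. \<integral>p. iexp (a * fst p + b * snd p) \<partial>\<mu> n) \<longlonglongrightarrow> (\<integral>p. iexp (a * fst p + b * snd p) \<partial>\<nu>)"
  shows "(\<lambda>n. \<integral>p. q p \<partial>\<mu> n) \<longlonglongrightarrow> (\<integral>p. q p \<partial>\<nu>)"
  using q
proof (induction rule: trig_poly.induct)
  case (char a b)
  then show ?case by (rule cf)
next
  case (add q r)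
  note i = trig_poly_integrable[OF _ pm(1) s(1)] trig_poly_integrable[OF _ pm(2) s(2)]
  show ?case using add by (simp add: i tendsto_add)
next
  case (cmult q c)
  then show ?case by (simp add: tendsto_mult_left)
qed

lemma trig_approx:
  fixes g :: "real \<times> real \<Rightarrow> real"
  assumes g: "continuous_on UNIV g" and K: "\<And>p. \<bar>g p\<bar> \<le> K" and L: "L > 0" and e: "e > 0"
  shows "\<exists>q. trig_poly (\<lambda>p. of_real (q p)) \<and> (\<forall>p. \<bar>q p\<bar> \<le> K + e) \<and> (\<forall>p. norm p \<le> L \<longrightarrow> \<bar>g p - q p\<bar> \<le> e)"
proof -
  \<comment> \<open>With this frequency, coordinates of modulus at most \<open>L\<close> are mapped
    into the interval from -pi/2 to pi/2, where \<open>arcsin\<close> inverts \<open>sin\<close>.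
    Elsewhere \<open>H\<close> still takes only values of \<open>g\<close>, which gives the global
    bound \<open>K + e\<close>.\<close>
  define c where "c = pi / (2 * L)"
  have c: "c > 0" using L by (simp add: c_def)
  define H where "H = (\<lambda>p::real \<times> real. g (arcsin (fst p) / c, arcsin (snd p) / c))"
  let ?S = "{-1..1} \<times> {-1..1} :: (real \<times> real) set"
  have "continuous_on ?S H"
    unfolding H_def using c
    by (intro continuous_on_compose2[OF g] continuous_intros) auto
  moreover have "compact ?S" by (intro compact_Times compact_Icc)
  ultimately obtain P where P: "real_polynomial_function P" "\<And>p. p \<in> ?S \<Longrightarrow> \<bar>H p - P p\<bar> < e"
    using Stone_Weierstrass_real_polynomial_function[of ?S H e] e by blast
  define q where "q = (\<lambda>p. P (sin (c * fst p), sin (c * snd p)))"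
  have S: "(sin (c * fst p), sin (c * snd p)) \<in> ?S" for p by simp
  have "trig_poly (\<lambda>p. of_real (q p))"
    unfolding q_def by (rule trig_poly_real_polynomial[OF P(1)])
  moreover have "\<bar>q p\<bar> \<le> K + e" for p
    using P(2)[OF S[of p]] K[of "(arcsin (sin (c * fst p)) / c, arcsin (sin (c * snd p)) / c)"]
    unfolding q_def H_def by simp
  moreover have "\<bar>g p - q p\<bar> \<le> e" if p: "norm p \<le> L" for p
  proof -
    have a: "arcsin (sin (c * t)) / c = t" if "\<bar>t\<bar> \<le> L" for t
    proof -
      have "\<bar>c * t\<bar> \<le> c * L" using that c by (simp add: abs_mult)
      also have "c * L = pi / 2" using L by (simp add: c_def)
      finally have "arcsin (sin (c * t)) = c * t" by (intro arcsin_sin) auto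
      then show ?thesis using c by simp
    qed
    have "\<bar>fst p\<bar> \<le> L" "\<bar>snd p\<bar> \<le> L"
      using p norm_fst_le[of "fst p" "snd p"] norm_snd_le[of "snd p" "fst p"] by auto
    then have "H (sin (c * fst p), sin (c * snd p)) = g p" unfolding H_def by (simp add: a)
    then show ?thesis using P(2)[OF S[of p]] by (simp add: q_def)
  qed
  ultimately show ?thesis by blast
qed

text \<open>Inside the ball the two functions differ by at most \<open>e\<close>; outside they are
  bounded by \<open>K\<close> and \<open>K + e\<close>, and the tail probability weighs the
  difference.\<close>

lemma trig_error:
  assumes "prob_space \<mu>" and s: "sets \<mu> = sets (borel :: (real \<times> real) measure)"
    and g: "continuous_on UNIV g" and K: "\<And>p. \<bar>g p\<bar> \<le> K"
    and q: "trig_poly (\<lambda>p. of_real (q p))" "\<And>p. \<bar>q p\<bar> \<le> K + e" "\<And>p. norm p \<le> L \<Longrightarrow> \<bar>g p - q p\<bar> \<le> e" and e: "e > 0"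
    and t: "measure \<mu> {p. norm p > L} \<le> \<eta>"
  shows "\<bar>(\<integral>p. g p \<partial>\<mu>) - (\<integral>p. q p \<partial>\<mu>)\<bar> \<le> e + (2 * K + e) * \<eta>"
proof -
  interpret prob_space \<mu> by fact
  have K0: "K \<ge> 0" using K[of undefined] by linarith
  have gm[measurable]: "g \<in> borel_measurable \<mu>"
    using borel_measurable_continuous_onI[OF g] measurable_cong_sets[OF s refl] by blast
  have gi: "integrable \<mu> g" by (rule integrable_const_bound[where B=K]) (auto simp: K)
  have qi: "integrable \<mu> q"
    using integrable_Re[OF trig_poly_integrable[OF q(1) prob_space_axioms s]] by simp
  have op: "{p::real \<times> real. norm p > L} \<in> sets \<mu>"
    unfolding s by (intro borel_open open_Collect_less continuous_intros)
  have "\<bar>(\<integral>p. g p \<partial>\<mu>) - (\<integral>p. q p \<partial>\<mu>)\<bar> = \<bar>\<integral>p. g p - q p \<partial>\<mu>\<bar>" using gi qi by simp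
  also have "\<dots> \<le> (\<integral>p. \<bar>g p - q p\<bar> \<partial>\<mu>)" by (rule integral_abs_bound)
  also have "\<dots> \<le> (\<integral>p. e + (2 * K + e) * indicator {p. norm p > L} p \<partial>\<mu>)"
  proof (rule integral_mono)
    show "integrable \<mu> (\<lambda>p. \<bar>g p - q p\<bar>)" using gi qi by auto
    show "integrable \<mu> (\<lambda>p. e + (2 * K + e) * indicator {p. norm p > L} p)"
      using op by (auto intro!: integrable_real_indicator simp: emeasure_eq_measure)
    fix p
    show "\<bar>g p - q p\<bar> \<le> e + (2 * K + e) * indicator {p. norm p > L} p"
    proof (cases "norm p \<le> L")
      case True then show ?thesis using q(3)[OF True] by simp
    next
      case False
      then show ?thesis using K[of p] q(2)[of p] e by simp
    qed
  qed
  also have "\<dots> = e + (2 * K + e) * measure \<mu> {p. norm p > L}"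
    using op by (subst Bochner_Integration.integral_add) (auto intro!: integrable_real_indicator simp: emeasure_eq_measure prob_space)
  also have "\<dots> \<le> e + (2 * K + e) * \<eta>" using t K0 e by (simp add: mult_left_mono)
  finally show ?thesis .
qed

lemma tail_measure_tendsto:
  assumes "prob_space \<nu>" and s: "sets \<nu> = sets (borel :: (real \<times> real) measure)"
  shows "(\<lambda>k::nat. measure \<nu> {p. norm p > real k}) \<longlonglongrightarrow> 0"
proof -
  interpret prob_space \<nu> by fact
  have "(\<lambda>k. measure \<nu> {p. norm p > real k}) \<longlonglongrightarrow> measure \<nu> (\<Inter>k. {p. norm p > real k})"
  proof (rule finite_Lim_measure_decseq)
    show "range (\<lambda>k. {p::real \<times> real. norm p > real k}) \<subseteq> sets \<nu>"
      unfolding s by (auto intro!: borel_open open_Collect_less continuous_intros)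
    show "decseq (\<lambda>k. {p::real \<times> real. norm p > real k})" by (auto simp: decseq_def)
  qed
  moreover have "(\<Inter>k. {p::real \<times> real. norm p > real k}) = {}"
  proof (rule equals0I)
    fix p :: "real \<times> real" assume p: "p \<in> (\<Inter>k. {p. norm p > real k})"
    obtain k where "norm p \<le> real k" using real_arch_simple by blast
    moreover have "norm p > real k" using p by blast
    ultimately show False by simp
  qed
  ultimately show ?thesis by simp
qed

lemma levy_continuity_plane:
  fixes g :: "real \<times> real \<Rightarrow> real"
  assumes pm: "\<And>n. prob_space (\<mu> n)" "prob_space \<nu>"
    and s: "\<And>n. sets (\<mu> n) = sets (borel :: (real \<times> real) measure)" "sets \<nu> = sets (borel :: (real \<times> real) measure)"
    and cf: "\<And>a b. (\<lambda>n. \<integral>p. iexp (a * fst p + b * snd p) \<partial>\<mu> n) \<longlonglongrightarrow> (\<integral>p. iexp (a * fst p + b * snd p) \<partial>\<nu>)"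
    and tight: "\<And>\<eta>. \<eta> > 0 \<Longrightarrow> \<exists>L. \<forall>n. measure (\<mu> n) {p. norm p > L} \<le> \<eta>"
    and g: "continuous_on UNIV g" and bg: "bounded (range g)"
  shows "(\<lambda>n. \<integral>p. g p \<partial>\<mu> n) \<longlonglongrightarrow> (\<integral>p. g p \<partial>\<nu>)"
proof (rule LIMSEQ_I)
  fix r :: real assume r: "r > 0"
  obtain K where K: "K > 0" "\<And>p. \<bar>g p\<bar> \<le> K"
    using bg unfolding bounded_pos by auto
  \<comment> \<open>One trigonometric replacement costs \<open>e + (2 * K + e) * \<eta>\<close>. The
    cap at 1 lets \<eta> be chosen from \<open>2 * K + 1\<close>, which makes both terms at most
    \<open>r / 8\<close>. The two replacements and the convergence of the trigonometric integrals
    cost \<open>r / 4\<close> each.\<close>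
  define e where "e = min 1 (r / 8)"
  define \<eta> where "\<eta> = r / (8 * (2 * K + 1))"
  have e: "e > 0" "e \<le> 1" "e \<le> r / 8" using r by (auto simp: e_def)
  have \<eta>: "\<eta> > 0" using r K by (simp add: \<eta>_def)
  obtain L1 where L1: "\<And>n. measure (\<mu> n) {p. norm p > L1} \<le> \<eta>" using tight[OF \<eta>] by blast
  obtain k where k: "measure \<nu> {p. norm p > real k} \<le> \<eta>"
    using order_tendstoD(2)[OF tail_measure_tendsto[OF pm(2) s(2)] \<eta>] by (auto simp: eventually_sequentially intro: less_imp_le)
  define L where "L = max 1 (max L1 (real k))"
  have L0: "L > 0" by (simp add: L_def)
  have mono: "measure \<rho> {p. norm p > L} \<le> measure \<rho> {p. norm p > L'}"
    if "prob_space \<rho>" "sets \<rho> = sets (borel :: (real \<times> real) measure)" "L' \<le> L" for \<rho> L'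
  proof -
    interpret prob_space \<rho> by fact
    show ?thesis using that(3)
      by (intro finite_measure_mono) (auto simp: that(2) intro!: borel_open open_Collect_less continuous_intros)
  qed
  have tL: "measure (\<mu> n) {p. norm p > L} \<le> \<eta>" "measure \<nu> {p. norm p > L} \<le> \<eta>" for n
    using mono[OF pm(1) s(1), of L1 n] L1[of n] mono[OF pm(2) s(2), of "real k"] k unfolding L_def by linarith+
  obtain q where q: "trig_poly (\<lambda>p. of_real (q p))" "\<And>p. \<bar>q p\<bar> \<le> K + e" "\<And>p. norm p \<le> L \<Longrightarrow> \<bar>g p - q p\<bar> \<le> e"
    using trig_approx[OF g K(2) L0 e(1)] by blast
  have "(\<lambda>n. complex_of_real (\<integral>p. q p \<partial>\<mu> n)) \<longlonglongrightarrow> complex_of_real (\<integral>p. q p \<partial>\<nu>)"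
    using trig_poly_tendsto[OF q(1) pm s cf] by simp
  then have "(\<lambda>n. \<integral>p. q p \<partial>\<mu> n) \<longlonglongrightarrow> (\<integral>p. q p \<partial>\<nu>)" unfolding tendsto_of_real_iff .
  note lq = this
  obtain n0 where n0: "\<And>n. n \<ge> n0 \<Longrightarrow> \<bar>(\<integral>p. q p \<partial>\<mu> n) - (\<integral>p. q p \<partial>\<nu>)\<bar> < r / 4"
    using LIMSEQ_D[OF lq, of "r / 4"] r unfolding real_norm_def by (metis divide_pos_pos zero_less_numeral)
  have b: "e + (2 * K + e) * \<eta> \<le> r / 4"
  proof -
    have "(2 * K + e) * \<eta> \<le> (2 * K + 1) * \<eta>" using e \<eta> by (intro mult_right_mono) auto
    also have "\<dots> = r / 8"
    proof -
      have "x * (r / (8 * x)) = r / 8" if "x \<noteq> 0" for x :: real using that by simp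
      then show ?thesis unfolding \<eta>_def using K(1) by (metis add_nonneg_pos less_irrefl mult_nonneg_nonneg less_imp_le zero_le_numeral zero_less_one)
    qed
    finally show ?thesis using e by linarith
  qed
  show "\<exists>n0. \<forall>n\<ge>n0. norm ((\<integral>p. g p \<partial>\<mu> n) - (\<integral>p. g p \<partial>\<nu>)) < r"
  proof (intro exI[of _ n0] allI impI)
    fix n assume n: "n \<ge> n0"
    have "\<bar>(\<integral>p. g p \<partial>\<mu> n) - (\<integral>p. q p \<partial>\<mu> n)\<bar> \<le> e + (2 * K + e) * \<eta>"
      by (rule trig_error[OF pm(1) s(1) g K(2) q e(1) tL(1)])
    moreover have "\<bar>(\<integral>p. g p \<partial>\<nu>) - (\<integral>p. q p \<partial>\<nu>)\<bar> \<le> e + (2 * K + e) * \<eta>"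
      by (rule trig_error[OF pm(2) s(2) g K(2) q e(1) tL(2)])
    ultimately show "norm ((\<integral>p. g p \<partial>\<mu> n) - (\<integral>p. g p \<partial>\<nu>)) < r"
      using n0[OF n] b r unfolding real_norm_def by linarith
  qed
qed

section \<open>Fourier transform of the circular Gaussian law\<close>

lemma normal_cf:
  assumes \<sigma>: "\<sigma> > 0"
  shows "(\<integral>x. iexp (a * x) \<partial>density lborel (\<lambda>x. ennreal (normal_density 0 \<sigma> x))) = of_real (exp (- (a\<^sup>2 * \<sigma>\<^sup>2) / 2))"
proof -
  have [measurable]: "(\<lambda>x. iexp (b * x)) \<in> borel_measurable borel" for b
    by (intro borel_measurable_continuous_onI continuous_intros)
  have n: "normal_density 0 \<sigma> (\<sigma> * y) = std_normal_density y / \<sigma>" for y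
    using \<sigma> by (simp add: normal_density_def real_sqrt_mult power_mult_distrib field_simps)
  have "(\<integral>x. iexp (a * x) \<partial>density lborel (\<lambda>x. ennreal (normal_density 0 \<sigma> x))) = (\<integral>x. normal_density 0 \<sigma> x *\<^sub>R iexp (a * x) \<partial>lborel)"
    by (rule integral_density) auto
  also have "\<dots> = \<bar>\<sigma>\<bar> *\<^sub>R (\<integral>y. normal_density 0 \<sigma> (0 + \<sigma> * y) *\<^sub>R iexp (a * (0 + \<sigma> * y)) \<partial>lborel)"
    by (rule lborel_integral_real_affine) (use \<sigma> in simp)
  also have "\<dots> = (\<integral>y. std_normal_density y *\<^sub>R iexp ((a * \<sigma>) * y) \<partial>lborel)"
    using \<sigma> by (simp add: n integral_scaleR_right[symmetric] mult.assoc del: integral_scaleR_right)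
  also have "\<dots> = char std_normal_distribution (a * \<sigma>)"
    unfolding char_def by (rule integral_density[symmetric]) auto
  also have "\<dots> = of_real (exp (- (a\<^sup>2 * \<sigma>\<^sup>2) / 2))"
    by (simp add: char_std_normal_distribution power_mult_distrib)
  finally show ?thesis .
qed

text \<open>The divisor 4 combines the 2 of the Gaussian exponent with the variance
  \<open>s2 / 2\<close> of each coordinate. The degenerate case is a point mass and is treated
  apart.\<close>

lemma cnormal_cf:
  assumes s2: "s2 \<ge> 0"
  shows "(\<integral>p. iexp (a * fst p + b * snd p) \<partial>cnormal s2) = of_real (exp (- (a\<^sup>2 + b\<^sup>2) * s2 / 4))"
proof (cases "s2 = 0")
  case True
  have "(\<lambda>p::real \<times> real. iexp (a * fst p + b * snd p)) \<in> borel_measurable borel"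
    by (intro borel_measurable_continuous_onI continuous_intros)
  then show ?thesis using True by (simp add: cnormal_def integral_return)
next
  case False
  then have s: "s2 > 0" using s2 by simp
  let ?N = "density lborel (\<lambda>x. ennreal (normal_density 0 (sqrt (s2/2)) x))"
  interpret N: prob_space ?N using s by (intro prob_space_normal_density) simp
  interpret P: pair_prob_space ?N ?N ..
  have i: "integrable (?N \<Otimes>\<^sub>M ?N) (\<lambda>(x, y). iexp (a * x) * iexp (b * y))"
  proof (rule P.integrable_const_bound[where B=1])
    have "(\<lambda>p::real \<times> real. iexp (a * fst p) * iexp (b * snd p)) \<in> borel_measurable borel"
      by (intro borel_measurable_continuous_onI continuous_intros)
    then show "(\<lambda>(x, y). iexp (a * x) * iexp (b * y)) \<in> borel_measurable (?N \<Otimes>\<^sub>M ?N)"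
      by (simp add: borel_prod[symmetric] case_prod_beta' cong: measurable_cong_sets)
  qed (auto simp: norm_mult)
  have "(\<integral>p. iexp (a * fst p + b * snd p) \<partial>cnormal s2) = (\<integral>p. iexp (a * fst p) * iexp (b * snd p) \<partial>(?N \<Otimes>\<^sub>M ?N))"
    unfolding cnormal_pair[OF s] by (simp add: distrib_left exp_add)
  also have "\<dots> = (\<integral>x. (\<integral>y. iexp (a * x) * iexp (b * y) \<partial>?N) \<partial>?N)"
    using P.integral_fst[of "\<lambda>x y. iexp (a * x) * iexp (b * y)"] i by (simp add: case_prod_beta')
  also have "\<dots> = (\<integral>x. iexp (a * x) \<partial>?N) * (\<integral>y. iexp (b * y) \<partial>?N)" by simp
  also have "\<dots> = of_real (exp (- (a\<^sup>2 + b\<^sup>2) * s2 / 4))"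
    using s by (simp only: normal_cf real_sqrt_gt_zero half_gt_zero of_real_mult[symmetric] exp_add[symmetric])
      (simp add: field_simps)
  finally show ?thesis .
qed

section \<open>Wirtinger calculus over infinitely many Gaussian variables\<close>

type_synonym gfun = "(nat \<Rightarrow> complex) \<Rightarrow> complex"

text \<open>Canonical model of the sequence of Gaussian variables. The calculus takes place on the
  coordinate space, where a function can be varied in one coordinate, and is transported to the
  given probability space by \<open>sample_path\<close>.\<close>

definition GP :: "(nat \<Rightarrow> complex) measure" where
  "GP = (\<Pi>\<^sub>M k\<in>UNIV. cgauss)"

lemma prob_GP: "prob_space GP"
  unfolding GP_def by (intro prob_space_PiM prob_cgauss)

interpretation GP: prob_space GP by (rule prob_GP)

lemma space_GP[simp]: "space GP = UNIV"
  by (simp add: GP_def space_PiM)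

lemma sets_GP[measurable_cong]: "sets GP = sets (\<Pi>\<^sub>M k\<in>(UNIV::nat set). (borel :: complex measure))"
  unfolding GP_def by (intro sets_PiM_cong) auto

lemma coord_measurable: "(\<lambda>z. z k) \<in> borel_measurable GP"
  by measurable

lemma GP_split:
  "GP = distr (cgauss \<Otimes>\<^sub>M (\<Pi>\<^sub>M i\<in>UNIV - {k}. cgauss)) GP (\<lambda>(w, X). X(k := w))"
proof -
  have "insert k (UNIV - {k}) = UNIV" by auto
  with distr_pair_PiM_eq_PiM[of "UNIV - {k}" "\<lambda>_. cgauss" k] prob_cgauss
  show ?thesis unfolding GP_def by simp
qed

text \<open>Coordinate \<open>k\<close> is integrated on its own while the others are frozen; this
  reduces integration by parts under \<open>GP\<close> to a single complex Gaussian.\<close>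

lemma GP_fubini:
  fixes G :: gfun
  assumes G: "integrable GP G"
  shows "(\<integral>z. G z \<partial>GP) = (\<integral>X. (\<integral>w. G (X(k := w)) \<partial>cgauss) \<partial>(\<Pi>\<^sub>M i\<in>UNIV - {k}. cgauss))"
proof -
  let ?P = "\<Pi>\<^sub>M i\<in>UNIV - {k}. cgauss"
  interpret C: prob_space cgauss by (rule prob_cgauss)
  interpret P: prob_space ?P by (intro prob_space_PiM prob_cgauss)
  interpret CP: pair_prob_space cgauss ?P ..
  have m: "(\<lambda>(w, X). X(k := w)) \<in> measurable (cgauss \<Otimes>\<^sub>M ?P) GP"
    unfolding GP_def case_prod_beta' by (rule measurable_fun_upd[where J="UNIV - {k}"]) auto
  have Gm: "G \<in> borel_measurable GP" using G by auto
  have i: "integrable (cgauss \<Otimes>\<^sub>M ?P) (\<lambda>(w, X). G (X(k := w)))"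
    using G integrable_distr_eq[OF m Gm] GP_split[of k] by (simp add: case_prod_beta')
  have "(\<integral>z. G z \<partial>GP) = (\<integral>p. G ((\<lambda>(w, X). X(k := w)) p) \<partial>(cgauss \<Otimes>\<^sub>M ?P))"
    using integral_distr[OF m Gm] GP_split[of k] by simp
  also have "\<dots> = (\<integral>X. (\<integral>w. G (X(k := w)) \<partial>cgauss) \<partial>?P)"
    using CP.integral_snd[of "\<lambda>w X. G (X(k := w))"] i by (simp add: case_prod_beta')
  finally show ?thesis .
qed

lemma integrable_GP_exp:
  assumes c: "c \<ge> 0"
  shows "integrable GP (\<lambda>z. exp (c * (\<Sum>k<N. cmod (z k))))"
proof -
  interpret C: prob_space cgauss by (rule prob_cgauss)
  interpret product_prob_space "\<lambda>_::nat. cgauss" UNIV by (intro product_prob_spaceI prob_cgauss)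
  have "integrable (\<Pi>\<^sub>M k\<in>{..<N}. cgauss) (\<lambda>z. \<Prod>k\<in>{..<N}. exp (c * cmod (z k)))"
    using product_integrable_prod[of "{..<N}" "\<lambda>_ w. exp (c * cmod w)"] integrable_cgauss_exp[OF c] by simp
  then have i: "integrable (\<Pi>\<^sub>M k\<in>{..<N}. cgauss) (\<lambda>z. exp (c * (\<Sum>k<N. cmod (z k))))"
    by (simp add: sum_distrib_left exp_sum)
  have d: "(\<Pi>\<^sub>M k\<in>{..<N}. cgauss) = distr GP (\<Pi>\<^sub>M k\<in>{..<N}. cgauss) (\<lambda>x. restrict x {..<N})"
    using distr_PiM_restrict_finite[of "{..<N}"] by (simp add: GP_def)
  have m: "(\<lambda>x. restrict x {..<N}) \<in> measurable GP (\<Pi>\<^sub>M k\<in>{..<N}. cgauss)"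
    unfolding GP_def by (rule measurable_restrict_subset) simp
  have m2: "(\<lambda>z. exp (c * (\<Sum>k<N. cmod (z k)))) \<in> borel_measurable (\<Pi>\<^sub>M k\<in>{..<N}. cgauss)"
    using i by auto
  show ?thesis using i integrable_distr_eq[OF m m2] d by simp
qed

text \<open>Growth at most exponential in finitely many coordinates. The class is closed under sums
  and products, and the exponential moments of \<open>cgauss\<close> together with independence make
  its measurable members integrable.\<close>

definition exp_bounded :: "gfun \<Rightarrow> bool" where
  "exp_bounded G \<longleftrightarrow> (\<exists>C c N. C \<ge> 0 \<and> c \<ge> 0 \<and> (\<forall>z. cmod (G z) \<le> C * exp (c * (\<Sum>k<N. cmod (z k)))))"

lemma exp_bounded_mono:
  fixes z :: "nat \<Rightarrow> complex"
  assumes "0 \<le> c" "c \<le> c'" "N \<le> N'" "0 \<le> C" "C \<le> C'"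
  shows "C * exp (c * (\<Sum>k<N. cmod (z k))) \<le> C' * exp (c' * (\<Sum>k<N'. cmod (z k)))"
proof -
  have s: "(\<Sum>k<N. cmod (z k)) \<le> (\<Sum>k<N'. cmod (z k))"
    using assms by (intro sum_mono2) auto
  have "c * (\<Sum>k<N. cmod (z k)) \<le> c' * (\<Sum>k<N'. cmod (z k))"
    using assms s by (intro mult_mono) (auto intro: sum_nonneg)
  then show ?thesis using assms by (intro mult_mono) auto
qed

lemma exp_bounded_add:
  assumes "exp_bounded F" "exp_bounded G"
  shows "exp_bounded (\<lambda>z. F z + G z)"
proof -
  from assms obtain C c N C' c' N' where *: "C \<ge> 0" "c \<ge> 0" "C' \<ge> 0" "c' \<ge> 0"
    and F: "\<And>z. cmod (F z) \<le> C * exp (c * (\<Sum>k<N. cmod (z k)))"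
    and G: "\<And>z. cmod (G z) \<le> C' * exp (c' * (\<Sum>k<N'. cmod (z k)))"
    unfolding exp_bounded_def by metis
  have "cmod (F z + G z) \<le> (C + C') * exp (max c c' * (\<Sum>k<max N N'. cmod (z k)))" for z
  proof -
    have "cmod (F z) \<le> C * exp (max c c' * (\<Sum>k<max N N'. cmod (z k)))"
      by (rule order_trans[OF F exp_bounded_mono]) (use * in auto)
    moreover have "cmod (G z) \<le> C' * exp (max c c' * (\<Sum>k<max N N'. cmod (z k)))"
      by (rule order_trans[OF G exp_bounded_mono]) (use * in auto)
    ultimately show ?thesis using norm_triangle_ineq[of "F z" "G z"] by (simp add: distrib_right)
  qed
  then show ?thesis unfolding exp_bounded_def
    using * by (metis add_nonneg_nonneg max.coboundedI1)
qed

lemma exp_bounded_mult: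
  assumes "exp_bounded F" "exp_bounded G"
  shows "exp_bounded (\<lambda>z. F z * G z)"
proof -
  from assms obtain C c N C' c' N' where *: "C \<ge> 0" "c \<ge> 0" "C' \<ge> 0" "c' \<ge> 0"
    and F: "\<And>z. cmod (F z) \<le> C * exp (c * (\<Sum>k<N. cmod (z k)))"
    and G: "\<And>z. cmod (G z) \<le> C' * exp (c' * (\<Sum>k<N'. cmod (z k)))"
    unfolding exp_bounded_def by metis
  have "cmod (F z * G z) \<le> (C * C') * exp ((c + c') * (\<Sum>k<max N N'. cmod (z k)))" for z
  proof -
    have "cmod (F z) \<le> C * exp (c * (\<Sum>k<max N N'. cmod (z k)))"
      by (rule order_trans[OF F exp_bounded_mono]) (use * in auto)
    moreover have "cmod (G z) \<le> C' * exp (c' * (\<Sum>k<max N N'. cmod (z k)))"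
      by (rule order_trans[OF G exp_bounded_mono]) (use * in auto)
    ultimately have "cmod (F z) * cmod (G z) \<le> (C * exp (c * (\<Sum>k<max N N'. cmod (z k)))) * (C' * exp (c' * (\<Sum>k<max N N'. cmod (z k))))"
      using * by (intro mult_mono) auto
    then show ?thesis by (simp add: norm_mult distrib_right exp_add mult_ac)
  qed
  then show ?thesis unfolding exp_bounded_def
    using * by (metis add_nonneg_nonneg mult_nonneg_nonneg)
qed

lemma exp_bounded_integrable:
  assumes "exp_bounded G" and [measurable]: "G \<in> borel_measurable GP"
  shows "integrable GP G"
proof -
  from assms obtain C c N where *: "C \<ge> 0" "c \<ge> 0" "\<And>z. cmod (G z) \<le> C * exp (c * (\<Sum>k<N. cmod (z k)))"
    unfolding exp_bounded_def by metis
  show ?thesis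
    by (rule Bochner_Integration.integrable_bound[OF integrable_mult_right[OF integrable_GP_exp[OF *(2)], of C]])
       (use * in \<open>auto intro!: AE_I2\<close>)
qed

text \<open>The direction \<open>(k, False)\<close> stands for \<open>z\<^sub>k\<close> and \<open>(k, True)\<close> for its conjugate; \<open>wirt\<close> is the
  corresponding Wirtinger derivative.\<close>

type_synonym dir = "nat \<times> bool"

definition zc :: "dir \<Rightarrow> gfun" where
  "zc d z = (if snd d then cnj (z (fst d)) else z (fst d))"

definition star :: "dir \<Rightarrow> dir" where
  "star d = (fst d, \<not> snd d)"

definition wirt :: "dir \<Rightarrow> gfun \<Rightarrow> gfun" where
  "wirt d G z = (let L = frechet_derivative (\<lambda>w. G (z(fst d := w))) (at (z (fst d)))
     in if snd d then (L 1 + \<i> * L \<i>) / 2 else (L 1 - \<i> * L \<i>) / 2)"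

text \<open>Every real-linear map of the plane has the form \<open>a * h + b * cnj h\<close>, so
  this is real differentiability in each coordinate separately, with both coefficients named.
  Gaussian integration by parts moves one coordinate at a time in the same way.\<close>

definition wdiff :: "gfun \<Rightarrow> bool" where
  "wdiff G \<longleftrightarrow> (\<forall>k z. ((\<lambda>w. G (z(k := w))) has_derivative
     (\<lambda>h. wirt (k, False) G z * h + wirt (k, True) G z * cnj h)) (at (z k)))"

lemma star_star[simp]: "star (star d) = d"
  by (simp add: star_def)

lemma zc_star: "zc (star d) z = cnj (zc d z)"
  by (simp add: zc_def star_def)

text \<open>A derivative \<open>L h = a * h + b * cnj h\<close> has \<open>L 1 = a + b\<close> and
  \<open>L i = i (a - b)\<close>; the two combinations in \<open>wirt\<close> isolate
  \<open>a\<close> and \<open>b\<close>.\<close>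

lemma wirt_unique:
  assumes "((\<lambda>w. G (z(k := w))) has_derivative (\<lambda>h. a * h + b * cnj h)) (at (z k))"
  shows "wirt (k, False) G z = a" "wirt (k, True) G z = b"
  unfolding wirt_def Let_def using frechet_derivative_at[OF assms, symmetric]
  by (auto simp: algebra_simps)

lemma wdiffI:
  assumes "\<forall>k z. ((\<lambda>w. G (z(k := w))) has_derivative (\<lambda>h. a k z * h + b k z * cnj h)) (at (z k))"
  shows "wdiff G" "\<And>k z. wirt (k, False) G z = a k z" "\<And>k z. wirt (k, True) G z = b k z"
proof -
  have h: "((\<lambda>w. G (z(k := w))) has_derivative (\<lambda>h. a k z * h + b k z * cnj h)) (at (z k))" for k z
    using assms by blast
  show wirt: "wirt (k, False) G z = a k z" "wirt (k, True) G z = b k z" for k z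
    using wirt_unique[where G=G and k=k and z=z and a="a k z" and b="b k z"] h[of z k] by auto
  show "wdiff G" unfolding wdiff_def wirt using assms by blast
qed

lemma dir_cases:
  assumes "\<And>k. P (k, False)" "\<And>k. P (k, True)"
  shows "P (d::dir)"
  using assms by (cases d) (metis (full_types))

lemma wdiff_const: "wdiff (\<lambda>_. c)" "wirt d (\<lambda>_. c) = (\<lambda>_. 0)"
proof -
  have *: "\<forall>k (z::nat \<Rightarrow> complex). ((\<lambda>w. c) has_derivative (\<lambda>h. 0 * h + 0 * cnj h)) (at (z k))"
    by simp
  note r = wdiffI[of "\<lambda>_. c" "\<lambda>_ _. 0" "\<lambda>_ _. 0", OF *]
  show "wdiff (\<lambda>_. c)" by (rule r)
  show "wirt d (\<lambda>_. c) = (\<lambda>_. 0)" using r(2,3) by (induct d rule: dir_cases) auto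
qed

lemma wdiff_zc: "wdiff (zc e)" "wirt d (zc e) = (\<lambda>_. if d = e then 1 else 0)"
proof -
  have *: "\<forall>k (z::nat \<Rightarrow> complex). ((\<lambda>w. zc e (z(k := w))) has_derivative (\<lambda>h. (if (k, False) = e then 1 else 0) * h + (if (k, True) = e then 1 else 0) * cnj h)) (at (z k))"
    by (intro allI, case_tac "snd e"; case_tac "fst e = k"; cases e)
       (auto simp: zc_def intro!: derivative_eq_intros bounded_linear_imp_has_derivative bounded_linear_cnj)
  note r = wdiffI[of "zc e" "\<lambda>k _. if (k, False) = e then 1 else 0" "\<lambda>k _. if (k, True) = e then 1 else 0", OF *]
  show "wdiff (zc e)" by (rule r)
  show "wirt d (zc e) = (\<lambda>_. if d = e then 1 else 0)" using r(2,3) by (induct d rule: dir_cases) auto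
qed

lemma wdiff_add:
  assumes "wdiff F" "wdiff G"
  shows "wdiff (\<lambda>z. F z + G z)" "wirt d (\<lambda>z. F z + G z) = (\<lambda>z. wirt d F z + wirt d G z)"
proof -
  have *: "\<forall>k (z::nat \<Rightarrow> complex). ((\<lambda>w. F (z(k := w)) + G (z(k := w))) has_derivative
      (\<lambda>h. (wirt (k, False) F z + wirt (k, False) G z) * h + (wirt (k, True) F z + wirt (k, True) G z) * cnj h)) (at (z k))" (is "\<forall>k z. ?thesis2 k z")
  proof (intro allI)
    fix k and z :: "nat \<Rightarrow> complex"
    have "((\<lambda>w. H (z(k := w))) has_derivative (\<lambda>h. wirt (k, False) H z * h + wirt (k, True) H z * cnj h)) (at (z k))" if "wdiff H" for H
      using that unfolding wdiff_def by blast
    from has_derivative_add[OF this[OF assms(1)] this[OF assms(2)]] show "?thesis2 k z"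
      by (simp add: algebra_simps)
  qed
  note r = wdiffI[of "\<lambda>z. F z + G z", OF *]
  show "wdiff (\<lambda>z. F z + G z)" by (rule r)
  show "wirt d (\<lambda>z. F z + G z) = (\<lambda>z. wirt d F z + wirt d G z)" using r(2,3) by (induct d rule: dir_cases) auto
qed

lemma wdiff_mult:
  assumes "wdiff F" "wdiff G"
  shows "wdiff (\<lambda>z. F z * G z)" "wirt d (\<lambda>z. F z * G z) = (\<lambda>z. wirt d F z * G z + F z * wirt d G z)"
proof -
  have *: "\<forall>k (z::nat \<Rightarrow> complex). ((\<lambda>w. F (z(k := w)) * G (z(k := w))) has_derivative
      (\<lambda>h. (wirt (k, False) F z * G z + F z * wirt (k, False) G z) * h + (wirt (k, True) F z * G z + F z * wirt (k, True) G z) * cnj h)) (at (z k))" (is "\<forall>k z. ?thesis2 k z")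
  proof (intro allI)
    fix k and z :: "nat \<Rightarrow> complex"
    have "((\<lambda>w. H (z(k := w))) has_derivative (\<lambda>h. wirt (k, False) H z * h + wirt (k, True) H z * cnj h)) (at (z k))" if "wdiff H" for H
      using that unfolding wdiff_def by blast
    from has_derivative_mult[OF this[OF assms(1)] this[OF assms(2)]] show "?thesis2 k z"
      by (simp add: algebra_simps)
  qed
  note r = wdiffI[of "\<lambda>z. F z * G z", OF *]
  show "wdiff (\<lambda>z. F z * G z)" by (rule r)
  show "wirt d (\<lambda>z. F z * G z) = (\<lambda>z. wirt d F z * G z + F z * wirt d G z)" using r(2,3) by (induct d rule: dir_cases) auto
qed

lemma wdiff_exp:
  assumes "wdiff R"
  shows "wdiff (\<lambda>z. exp (\<i> * R z))" "wirt d (\<lambda>z. exp (\<i> * R z)) = (\<lambda>z. \<i> * (wirt d R z * exp (\<i> * R z)))"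
proof -
  have *: "\<forall>k (z::nat \<Rightarrow> complex). ((\<lambda>w. exp (\<i> * R (z(k := w)))) has_derivative
      (\<lambda>h. (\<i> * (wirt (k, False) R z * exp (\<i> * R z))) * h + (\<i> * (wirt (k, True) R z * exp (\<i> * R z))) * cnj h)) (at (z k))"
  proof (intro allI)
    fix k and z :: "nat \<Rightarrow> complex"
    have "((\<lambda>w. R (z(k := w))) has_derivative (\<lambda>h. wirt (k, False) R z * h + wirt (k, True) R z * cnj h)) (at (z k))"
      using assms unfolding wdiff_def by blast
    then have h: "((\<lambda>w. \<i> * R (z(k := w))) has_derivative (\<lambda>h. \<i> * (wirt (k, False) R z * h + wirt (k, True) R z * cnj h))) (at (z k))"
      by (rule has_derivative_mult_right)
    show "((\<lambda>w. exp (\<i> * R (z(k := w)))) has_derivative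
      (\<lambda>h. (\<i> * (wirt (k, False) R z * exp (\<i> * R z))) * h + (\<i> * (wirt (k, True) R z * exp (\<i> * R z))) * cnj h)) (at (z k))"
      using has_derivative_compose[OF h has_field_derivative_imp_has_derivative[OF DERIV_exp]]
      by (simp add: algebra_simps)
  qed
  note r = wdiffI[of "\<lambda>z. exp (\<i> * R z)", OF *]
  show "wdiff (\<lambda>z. exp (\<i> * R z))" by (rule r)
  show "wirt d (\<lambda>z. exp (\<i> * R z)) = (\<lambda>z. \<i> * (wirt d R z * exp (\<i> * R z)))" using r(2,3) by (induct d rule: dir_cases) auto
qed

lemma wdiff_cnj:
  assumes "wdiff F"
  shows "wdiff (\<lambda>z. cnj (F z))" "wirt d (\<lambda>z. cnj (F z)) = (\<lambda>z. cnj (wirt (star d) F z))"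
proof -
  have *: "\<forall>k (z::nat \<Rightarrow> complex). ((\<lambda>w. cnj (F (z(k := w)))) has_derivative
      (\<lambda>h. cnj (wirt (k, True) F z) * h + cnj (wirt (k, False) F z) * cnj h)) (at (z k))" (is "\<forall>k z. ?thesis2 k z")
  proof (intro allI)
    fix k and z :: "nat \<Rightarrow> complex"
    have "((\<lambda>w. F (z(k := w))) has_derivative (\<lambda>h. wirt (k, False) F z * h + wirt (k, True) F z * cnj h)) (at (z k))"
      using assms unfolding wdiff_def by blast
    from has_derivative_cnj[OF this] show "?thesis2 k z"
      by (simp add: algebra_simps)
  qed
  note r = wdiffI[of "\<lambda>z. cnj (F z)", OF *]
  show "wdiff (\<lambda>z. cnj (F z))" by (rule r)
  show "wirt d (\<lambda>z. cnj (F z)) = (\<lambda>z. cnj (wirt (star d) F z))" using r(2,3) by (induct d rule: dir_cases) (auto simp: star_def)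
qed

text \<open>A syntactic class that contains the polynomials in finitely many variables and the
  exponentials of a characteristic function. It is closed under Wirtinger derivatives and
  conjugation, so that differentiability, measurability and integrability all come by induction. A
  real exponent keeps the exponentials of modulus 1.\<close>

inductive smooth :: "gfun \<Rightarrow> bool" where
  const: "smooth (\<lambda>_. c)"
| zc: "smooth (zc d)"
| add: "smooth F \<Longrightarrow> smooth G \<Longrightarrow> smooth (\<lambda>z. F z + G z)"
| mult: "smooth F \<Longrightarrow> smooth G \<Longrightarrow> smooth (\<lambda>z. F z * G z)"
| exp: "smooth R \<Longrightarrow> (\<And>z. R z \<in> \<real>) \<Longrightarrow> smooth (\<lambda>z. exp (\<i> * R z))"

lemma smooth_wdiff: "smooth G \<Longrightarrow> wdiff G"
  by (induction rule: smooth.induct) (auto intro: wdiff_const wdiff_zc wdiff_add wdiff_mult wdiff_exp)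

lemma wirt_const[simp]: "wirt d (\<lambda>_. c) = (\<lambda>_. 0)" by (rule wdiff_const)
lemma wirt_zc[simp]: "wirt d (zc e) = (\<lambda>_. if d = e then 1 else 0)" by (rule wdiff_zc)
lemma wirt_add: "smooth F \<Longrightarrow> smooth G \<Longrightarrow> wirt d (\<lambda>z. F z + G z) = (\<lambda>z. wirt d F z + wirt d G z)"
  by (intro wdiff_add smooth_wdiff)
lemma wirt_mult: "smooth F \<Longrightarrow> smooth G \<Longrightarrow> wirt d (\<lambda>z. F z * G z) = (\<lambda>z. wirt d F z * G z + F z * wirt d G z)"
  by (intro wdiff_mult smooth_wdiff)
lemma wirt_exp: "smooth R \<Longrightarrow> wirt d (\<lambda>z. exp (\<i> * R z)) = (\<lambda>z. \<i> * (wirt d R z * exp (\<i> * R z)))"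
  by (intro wdiff_exp smooth_wdiff)
lemma wirt_cnj: "smooth F \<Longrightarrow> wirt d (\<lambda>z. cnj (F z)) = (\<lambda>z. cnj (wirt (star d) F z))"
  by (intro wdiff_cnj smooth_wdiff)

lemma smooth_cmult: "smooth F \<Longrightarrow> smooth (\<lambda>z. c * F z)"
  by (intro smooth.mult smooth.const)

lemma wirt_cmult: "smooth F \<Longrightarrow> wirt d (\<lambda>z. c * F z) = (\<lambda>z. c * wirt d F z)"
  by (subst wirt_mult) (auto intro: smooth.const)

lemma smooth_wirt: "smooth G \<Longrightarrow> smooth (wirt d G)"
proof (induction rule: smooth.induct)
  case (exp R)
  then show ?case unfolding wirt_exp[OF exp(1)]
    by (intro smooth_cmult smooth.mult smooth.exp)
qed (auto simp: wirt_add wirt_mult intro: smooth.intros)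

lemma smooth_diff: "smooth F \<Longrightarrow> smooth G \<Longrightarrow> smooth (\<lambda>z. F z - G z)"
  using smooth.add[of F "\<lambda>z. -1 * G z"] smooth_cmult[of G "-1"] by simp

lemma wirt_diff: "smooth F \<Longrightarrow> smooth G \<Longrightarrow> wirt d (\<lambda>z. F z - G z) = (\<lambda>z. wirt d F z - wirt d G z)"
  using wirt_add[of F "\<lambda>z. -1 * G z" d] wirt_cmult[of G d "-1"] smooth_cmult[of G "-1"] by simp

lemma smooth_sum: "(\<And>i. i \<in> I \<Longrightarrow> smooth (F i)) \<Longrightarrow> smooth (\<lambda>z. \<Sum>i\<in>I. F i z)"
  by (induction I rule: infinite_finite_induct) (auto intro: smooth.intros)

lemma wirt_sum: "(\<And>i. i \<in> I \<Longrightarrow> smooth (F i)) \<Longrightarrow> wirt d (\<lambda>z. \<Sum>i\<in>I. F i z) = (\<lambda>z. \<Sum>i\<in>I. wirt d (F i) z)"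
  by (induction I rule: infinite_finite_induct) (auto simp: wirt_add smooth_sum)

lemma smooth_cnj: "smooth G \<Longrightarrow> smooth (\<lambda>z. cnj (G z))"
proof (induction rule: smooth.induct)
  case (zc d)
  then show ?case using smooth.zc[of "star d"] by (simp add: zc_star[abs_def])
next
  case (exp R)
  have "smooth (\<lambda>z. exp (\<i> * (-1 * R z)))"
    using exp by (intro smooth.exp smooth_cmult) auto
  then show ?case using exp by (simp add: exp_cnj Reals_cnj_iff)
qed (auto intro: smooth.intros)

text \<open>By induction over the construction: after two applications the product and chain rules
  are symmetric in the two directions.\<close>

lemma wirt_commute: "smooth G \<Longrightarrow> wirt d (wirt e G) = wirt e (wirt d G)"
proof (induction rule: smooth.induct)
  case (add F G)
  then show ?case by (simp add: wirt_add smooth_wirt)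
next
  case (mult F G)
  then show ?case by (simp add: wirt_add wirt_mult smooth_wirt smooth.intros fun_eq_iff algebra_simps)
next
  case (exp R)
  then show ?case by (simp add: wirt_mult wirt_exp wirt_cmult smooth_wirt smooth.intros fun_eq_iff algebra_simps)
qed auto

lemma smooth_measurable: "smooth G \<Longrightarrow> G \<in> borel_measurable GP"
proof (induction rule: smooth.induct)
  case (zc d)
  have "(\<lambda>z. zc d z) \<in> borel_measurable GP"
    unfolding zc_def using coord_measurable[of "fst d"]
    by (cases "snd d") (auto intro!: borel_measurable_continuous_onI continuous_intros measurable_compose[of _ GP borel cnj borel])
  then show ?case by simp
next
  case (add F G)
  then show ?case by (intro borel_measurable_add)
next
  case (mult F G)
  then show ?case by (intro borel_measurable_times)
next
  case (exp R)
  have "(\<lambda>w::complex. exp (\<i> * w)) \<in> borel_measurable borel"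
    by (intro borel_measurable_continuous_onI continuous_intros)
  from measurable_compose[OF exp(3) this] show ?case .
qed simp

lemma smooth_exp_bounded: "smooth G \<Longrightarrow> exp_bounded G"
proof (induction rule: smooth.induct)
  case (const c)
  have "cmod c \<le> cmod c * exp (0 * (\<Sum>k<0. cmod (z k)))" for z :: "nat \<Rightarrow> complex" by simp
  then show ?case unfolding exp_bounded_def by (metis norm_ge_zero order_refl)
next
  case (zc d)
  have "cmod (zc d z) \<le> 1 * exp (1 * (\<Sum>k<Suc (fst d). cmod (z k)))" for z
  proof -
    have "cmod (zc d z) = cmod (z (fst d))" by (simp add: zc_def)
    also have "\<dots> \<le> (\<Sum>k<Suc (fst d). cmod (z k))" by (simp add: sum_nonneg)
    also have "\<dots> \<le> 1 * exp (1 * (\<Sum>k<Suc (fst d). cmod (z k)))"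
      using exp_ge_add_one_self[of "\<Sum>k<Suc (fst d). cmod (z k)"] unfolding mult_1 by linarith
    finally show ?thesis .
  qed
  then show ?case unfolding exp_bounded_def by (metis zero_le_one)
next
  case (exp R)
  have "cmod (exp (\<i> * R z)) \<le> 1 * exp (0 * (\<Sum>k<0. cmod (z k)))" for z
    using exp(2)[of z] by (auto elim!: Reals_cases)
  then show ?case unfolding exp_bounded_def by (metis zero_le_one order_refl)
qed (auto intro: exp_bounded_add exp_bounded_mult)

lemma smooth_integrable: "smooth G \<Longrightarrow> integrable GP G"
  by (intro exp_bounded_integrable smooth_exp_bounded smooth_measurable)

section \<open>Expectation and integration by parts in each direction\<close>

definition EE :: "gfun \<Rightarrow> complex" where
  "EE G = (\<integral>z. G z \<partial>GP)"

lemma EE_const[simp]: "EE (\<lambda>_. c) = c"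
  by (simp add: EE_def GP.prob_space[simplified])

lemma EE_add: "smooth F \<Longrightarrow> smooth G \<Longrightarrow> EE (\<lambda>z. F z + G z) = EE F + EE G"
  unfolding EE_def by (intro Bochner_Integration.integral_add smooth_integrable)

lemma EE_diff: "smooth F \<Longrightarrow> smooth G \<Longrightarrow> EE (\<lambda>z. F z - G z) = EE F - EE G"
  unfolding EE_def by (intro Bochner_Integration.integral_diff smooth_integrable)

lemma EE_cmult: "EE (\<lambda>z. c * F z) = c * EE F"
  unfolding EE_def by simp

lemma EE_sum: "(\<And>i. i \<in> I \<Longrightarrow> smooth (F i)) \<Longrightarrow> EE (\<lambda>z. \<Sum>i\<in>I. F i z) = (\<Sum>i\<in>I. EE (F i))"
  unfolding EE_def by (intro Bochner_Integration.integral_sum smooth_integrable)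

lemma EE_cnj: "EE (\<lambda>z. cnj (F z)) = cnj (EE F)"
  unfolding EE_def by simp

lemma slice_bound:
  assumes "smooth G"
  shows "\<exists>C c. c \<ge> 0 \<and> (\<forall>w. cmod (G (z(k := w))) \<le> C * exp (c * cmod w))"
proof -
  from smooth_exp_bounded[OF assms] obtain C c N where *: "C \<ge> 0" "c \<ge> 0"
    "\<And>z. cmod (G z) \<le> C * exp (c * (\<Sum>k<N. cmod (z k)))"
    unfolding exp_bounded_def by metis
  let ?S = "\<Sum>k<N. cmod (z k)"
  have "cmod (G (z(k := w))) \<le> (C * exp (c * ?S)) * exp (c * cmod w)" for w
  proof -
    have "(\<Sum>j<N. cmod ((z(k := w)) j)) \<le> (\<Sum>j<N. cmod (z j) + (if j = k then cmod w else 0))"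
      by (intro sum_mono) auto
    also have "\<dots> \<le> ?S + cmod w" by (simp add: sum.distrib sum.delta)
    finally have "c * (\<Sum>j<N. cmod ((z(k := w)) j)) \<le> c * ?S + c * cmod w"
      using *(2) by (metis distrib_left mult_left_mono)
    then have "C * exp (c * (\<Sum>j<N. cmod ((z(k := w)) j))) \<le> C * exp (c * ?S + c * cmod w)"
      using *(1) by (intro mult_left_mono) auto
    then show ?thesis using *(3)[of "z(k := w)"] by (simp add: exp_add mult.assoc)
  qed
  with *(2) show ?thesis by blast
qed

lemma slice_continuous:
  assumes "smooth G"
  shows "continuous_on UNIV (\<lambda>w. G (z(k := w)))"
proof (intro continuous_at_imp_continuous_on ballI)
  fix w :: complex
  have "((\<lambda>w'. G ((z(k := w))(k := w'))) has_derivative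
     (\<lambda>h. wirt (k, False) G (z(k := w)) * h + wirt (k, True) G (z(k := w)) * cnj h)) (at ((z(k := w)) k))"
    using smooth_wdiff[OF assms] unfolding wdiff_def by blast
  then show "isCont (\<lambda>w. G (z(k := w))) w"
    using has_derivative_continuous by fastforce
qed

lemma EE_ibp_aux:
  assumes G: "smooth G"
  shows "EE (\<lambda>z. z k * G z) = EE (wirt (k, True) G)"
proof -
  have s: "smooth (\<lambda>z. z k * G z)"
    using smooth.mult[OF smooth.zc[of "(k, False)"] G] by (simp add: zc_def)
  have sD: "smooth (wirt (k, b) G)" for b using smooth_wirt[OF G] .
  have "(\<integral>w. w * G (X(k := w)) \<partial>cgauss) = (\<integral>w. wirt (k, True) G (X(k := w)) \<partial>cgauss)" for X
  proof -
    obtain C1 c1 where 1: "c1 \<ge> 0" "\<And>w. cmod (G (X(k := w))) \<le> C1 * exp (c1 * cmod w)"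
      using slice_bound[OF G] by blast
    obtain C2 c2 where 2: "c2 \<ge> 0" "\<And>w. cmod (wirt (k, False) G (X(k := w))) \<le> C2 * exp (c2 * cmod w)"
      using slice_bound[OF sD] by blast
    obtain C3 c3 where 3: "c3 \<ge> 0" "\<And>w. cmod (wirt (k, True) G (X(k := w))) \<le> C3 * exp (c3 * cmod w)"
      using slice_bound[OF sD] by blast
    define C where "C = \<bar>C1\<bar> + \<bar>C2\<bar> + \<bar>C3\<bar>"
    define c where "c = c1 + c2 + c3"
    have b: "C' * exp (c' * cmod w) \<le> C * exp (c * cmod w)" if "C' \<le> C" "0 \<le> c'" "c' \<le> c" for C' c' and w :: complex
    proof -
      have "C' * exp (c' * cmod w) \<le> C * exp (c' * cmod w)" using that by simp
      also have "\<dots> \<le> C * exp (c * cmod w)"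
        using that by (intro mult_left_mono) (auto simp: C_def mult_right_mono)
      finally show ?thesis .
    qed
    show ?thesis
    proof (rule cgauss_ibp[where C=C and c=c and a="\<lambda>w. wirt (k, False) G (X(k := w))"])
      show "((\<lambda>w. G (X(k := w))) has_derivative (\<lambda>h. wirt (k, False) G (X(k := w)) * h + wirt (k, True) G (X(k := w)) * cnj h)) (at w)" for w
        using smooth_wdiff[OF G, unfolded wdiff_def, rule_format, of "X(k := w)" k] by simp
      show "continuous_on UNIV (\<lambda>w. wirt (k, False) G (X(k := w)))" "continuous_on UNIV (\<lambda>w. wirt (k, True) G (X(k := w)))"
        by (intro slice_continuous sD)+
      fix w
      show "cmod (G (X(k := w))) \<le> C * exp (c * cmod w)"
        by (rule order_trans[OF 1(2) b]) (use 1 2 3 in \<open>auto simp: C_def c_def\<close>)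
      show "cmod (wirt (k, False) G (X(k := w))) \<le> C * exp (c * cmod w)"
        by (rule order_trans[OF 2(2) b]) (use 1 2 3 in \<open>auto simp: C_def c_def\<close>)
      show "cmod (wirt (k, True) G (X(k := w))) \<le> C * exp (c * cmod w)"
        by (rule order_trans[OF 3(2) b]) (use 1 2 3 in \<open>auto simp: C_def c_def\<close>)
    qed (use 1 2 3 in \<open>auto simp: c_def\<close>)
  qed
  then show ?thesis
    unfolding EE_def GP_fubini[OF smooth_integrable[OF s], where k=k] GP_fubini[OF smooth_integrable[OF sD], where k=k] by simp
qed

text \<open>Multiplication by a variable turns into the derivative in the conjugate variable. For a
  conjugated variable the identity is the complex conjugate of the one for
  \<open>cnj G\<close>.\<close>

lemma EE_ibp:
  assumes G: "smooth G"
  shows "EE (\<lambda>z. zc d z * G z) = EE (wirt (star d) G)"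
proof (cases d)
  case (Pair k b)
  show ?thesis
  proof (cases b)
    case False
    then show ?thesis using EE_ibp_aux[OF G, of k] Pair by (simp add: zc_def star_def)
  next
    case True
    have "EE (\<lambda>z. cnj (z k * cnj (G z))) = cnj (EE (wirt (k, True) (\<lambda>z. cnj (G z))))"
      using EE_ibp_aux[OF smooth_cnj[OF G], of k] by (subst EE_cnj) simp
    moreover have "cnj (EE (\<lambda>z. cnj (wirt (star (k, True)) G z))) = EE (wirt (star (k, True)) G)"
      by (subst EE_cnj) simp
    ultimately show ?thesis using True Pair
      by (simp add: wirt_cnj[OF G] zc_def star_def)
  qed
qed

section \<open>Creation operators and the Poincare inequality\<close>

text \<open>The adjoint of \<open>wirt (star d)\<close> for the bilinear pairing
  \<open>EE (F G)\<close>, equivalently of \<open>wirt d\<close> for the Hermitian pairing.\<close>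

definition creation :: "dir \<Rightarrow> gfun \<Rightarrow> gfun" where
  "creation d G = (\<lambda>z. zc d z * G z - wirt (star d) G z)"

lemma smooth_creation: "smooth G \<Longrightarrow> smooth (creation d G)"
  unfolding creation_def by (intro smooth_diff smooth.mult smooth.zc smooth_wirt)

lemma creation_add: "smooth F \<Longrightarrow> smooth G \<Longrightarrow> creation d (\<lambda>z. F z + G z) = (\<lambda>z. creation d F z + creation d G z)"
  by (simp add: creation_def wirt_add fun_eq_iff algebra_simps)

lemma creation_cmult: "smooth F \<Longrightarrow> creation d (\<lambda>z. c * F z) = (\<lambda>z. c * creation d F z)"
  by (simp add: creation_def wirt_cmult fun_eq_iff algebra_simps)

lemma creation_sum: "(\<And>i. i \<in> I \<Longrightarrow> smooth (F i)) \<Longrightarrow> creation d (\<lambda>z. \<Sum>i\<in>I. F i z) = (\<lambda>z. \<Sum>i\<in>I. creation d (F i) z)"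
  by (simp add: creation_def wirt_sum fun_eq_iff sum_subtractf sum_distrib_left)

lemma creation_zero[simp]: "creation d (\<lambda>_. 0) = (\<lambda>_. 0)"
  by (simp add: creation_def)

lemma EE_creation:
  assumes "smooth F" "smooth G"
  shows "EE (\<lambda>z. creation d F z * G z) = EE (\<lambda>z. F z * wirt (star d) G z)"
proof -
  have "EE (\<lambda>z. creation d F z * G z) = EE (\<lambda>z. zc d z * (F z * G z) - wirt (star d) F z * G z)"
    by (simp add: creation_def algebra_simps)
  also have "\<dots> = EE (wirt (star d) (\<lambda>z. F z * G z)) - EE (\<lambda>z. wirt (star d) F z * G z)"
    using assms by (subst EE_diff) (auto intro!: smooth.intros smooth_wirt simp: EE_ibp smooth.mult)
  also have "\<dots> = EE (\<lambda>z. F z * wirt (star d) G z)"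
    using assms by (simp add: wirt_mult EE_add smooth.mult smooth_wirt)
  finally show ?thesis .
qed

text \<open>The canonical commutation relation: differentiation and creation commute up to the
  identity, which appears for equal directions.\<close>

lemma wirt_creation:
  assumes "smooth G"
  shows "wirt d (creation e G) = (\<lambda>z. (if d = e then G z else 0) + creation e (wirt d G) z)"
  unfolding creation_def using assms
  by (simp add: wirt_diff wirt_mult smooth_wirt smooth.intros wirt_commute[of G d] fun_eq_iff)

text \<open>Wick monomials. Building them from creation operators gives adjointness and commutation
  without explicit formulas; \<open>wick_hermite_prod\<close> identifies them with products of
  complex Hermite polynomials.\<close>

fun wick :: "dir list \<Rightarrow> gfun" where
  "wick [] = (\<lambda>_. 1)"
| "wick (d # ds) = creation d (wick ds)"

lemma smooth_wick: "smooth (wick ds)"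
  by (induction ds) (auto intro: smooth_creation smooth.const)

definition dirs :: "nat \<Rightarrow> dir set" where
  "dirs N = {..<N} \<times> UNIV"

lemma finite_dirs[simp]: "finite (dirs N)"
  by (simp add: dirs_def)

lemma star_dirs[simp]: "star d \<in> dirs N \<longleftrightarrow> d \<in> dirs N"
  by (cases d) (simp add: dirs_def star_def)

text \<open>The eigenvalue equation of the number operator in weak form, with the Dirichlet form
  over \<open>dirs N\<close> in place of the operator. Testing against every smooth
  \<open>G\<close>, and not only against polynomials, lets \<open>G\<close> be the exponential of a
  characteristic function.\<close>

definition eig :: "nat \<Rightarrow> nat \<Rightarrow> gfun \<Rightarrow> bool" where
  "eig N m Y \<longleftrightarrow> smooth Y \<and> (\<forall>G. smooth G \<longrightarrow>
     of_nat m * EE (\<lambda>z. Y z * G z) = (\<Sum>d\<in>dirs N. EE (\<lambda>z. wirt d Y z * wirt (star d) G z)))"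

lemma eig_smooth: "eig N m Y \<Longrightarrow> smooth Y"
  by (simp add: eig_def)

lemma eigD: "eig N m Y \<Longrightarrow> smooth G \<Longrightarrow>
     of_nat m * EE (\<lambda>z. Y z * G z) = (\<Sum>d\<in>dirs N. EE (\<lambda>z. wirt d Y z * wirt (star d) G z))"
  by (simp add: eig_def)

lemma eig_const: "eig N 0 (\<lambda>_. c)"
  by (simp add: eig_def smooth.const)

lemma eig_zero: "eig N m (\<lambda>_. 0)"
  by (simp add: eig_def smooth.const)

lemma eig_add:
  assumes "eig N m X" "eig N m Y"
  shows "eig N m (\<lambda>z. X z + Y z)"
  unfolding eig_def
proof (intro conjI allI impI)
  show "smooth (\<lambda>z. X z + Y z)" using assms by (auto intro: smooth.add eig_smooth)
  fix G assume G: "smooth G"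
  have s: "smooth X" "smooth Y" using assms by (auto intro: eig_smooth)
  show "of_nat m * EE (\<lambda>z. (X z + Y z) * G z) = (\<Sum>d\<in>dirs N. EE (\<lambda>z. wirt d (\<lambda>z. X z + Y z) z * wirt (star d) G z))"
    using eigD[OF assms(1) G] eigD[OF assms(2) G] s G
    by (simp add: wirt_add distrib_right EE_add smooth.mult smooth_wirt sum.distrib distrib_left)
qed

lemma eig_cmult:
  assumes "eig N m Y"
  shows "eig N m (\<lambda>z. c * Y z)"
  unfolding eig_def
proof (intro conjI allI impI)
  show "smooth (\<lambda>z. c * Y z)" using assms by (auto intro: smooth_cmult eig_smooth)
  fix G assume G: "smooth G"
  show "of_nat m * EE (\<lambda>z. (c * Y z) * G z) = (\<Sum>d\<in>dirs N. EE (\<lambda>z. wirt d (\<lambda>z. c * Y z) z * wirt (star d) G z))"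
    using eigD[OF assms G] eig_smooth[OF assms] G
    by (simp add: wirt_cmult EE_cmult mult.assoc sum_distrib_left[symmetric] mult.left_commute[of _ c])
qed

lemma eig_sum: "(\<And>i. i \<in> I \<Longrightarrow> eig N m (F i)) \<Longrightarrow> eig N m (\<lambda>z. \<Sum>i\<in>I. F i z)"
  by (induction I rule: infinite_finite_induct) (auto intro: eig_zero eig_add)

text \<open>By the commutation relation the Dirichlet form of \<open>creation d Y\<close> and
  \<open>G\<close> is that of \<open>Y\<close> and \<open>wirt (star d) G\<close> plus one pairing
  of these two; adjointness turns the pairing into that of \<open>creation d Y\<close> with
  \<open>G\<close>, so the eigenvalue rises by one.\<close>

lemma eig_creation:
  assumes Y: "eig N m Y" and d: "d \<in> dirs N"
  shows "eig N (Suc m) (creation d Y)"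
  unfolding eig_def
proof (intro conjI allI impI)
  have s: "smooth Y" using Y by (rule eig_smooth)
  show "smooth (creation d Y)" using s by (rule smooth_creation)
  fix G assume G: "smooth G"
  have "(\<Sum>e\<in>dirs N. EE (\<lambda>z. wirt e (creation d Y) z * wirt (star e) G z))
      = (\<Sum>e\<in>dirs N. (if e = d then EE (\<lambda>z. Y z * wirt (star d) G z) else 0) + EE (\<lambda>z. wirt e Y z * wirt (star e) (wirt (star d) G) z))"
  proof (rule sum.cong[OF refl])
    fix e
    have "EE (\<lambda>z. wirt e (creation d Y) z * wirt (star e) G z) =
          EE (\<lambda>z. (if e = d then Y z else 0) * wirt (star e) G z + creation d (wirt e Y) z * wirt (star e) G z)"
      using s by (simp add: wirt_creation distrib_right)
    also have "\<dots> = EE (\<lambda>z. (if e = d then Y z else 0) * wirt (star e) G z) + EE (\<lambda>z. creation d (wirt e Y) z * wirt (star e) G z)"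
      using s G by (cases "e = d") (auto intro!: EE_add smooth.mult smooth_wirt smooth_creation smooth.const)
    also have "EE (\<lambda>z. creation d (wirt e Y) z * wirt (star e) G z) = EE (\<lambda>z. wirt e Y z * wirt (star e) (wirt (star d) G) z)"
      using s G by (subst EE_creation) (auto intro: smooth_wirt simp: wirt_commute[of G "star d"])
    also have "EE (\<lambda>z. (if e = d then Y z else 0) * wirt (star e) G z) = (if e = d then EE (\<lambda>z. Y z * wirt (star d) G z) else 0)"
      by (cases "e = d") auto
    finally show "EE (\<lambda>z. wirt e (creation d Y) z * wirt (star e) G z) = (if e = d then EE (\<lambda>z. Y z * wirt (star d) G z) else 0) + EE (\<lambda>z. wirt e Y z * wirt (star e) (wirt (star d) G) z)" .
  qed
  also have "\<dots> = EE (\<lambda>z. Y z * wirt (star d) G z) + of_nat m * EE (\<lambda>z. Y z * wirt (star d) G z)"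
    using d eigD[OF Y smooth_wirt[OF G]] by (simp add: sum.distrib)
  also have "\<dots> = of_nat (Suc m) * EE (\<lambda>z. creation d Y z * G z)"
    using s G by (simp add: EE_creation distrib_right)
  finally show "of_nat (Suc m) * EE (\<lambda>z. creation d Y z * G z) = (\<Sum>e\<in>dirs N. EE (\<lambda>z. wirt e (creation d Y) z * wirt (star e) G z))" by simp
qed

lemma eig_wick: "set ds \<subseteq> dirs N \<Longrightarrow> eig N (length ds) (wick ds)"
  by (induction ds) (auto intro: eig_const eig_creation)

section \<open>Polynomials and their chaos decomposition\<close>

inductive polyf :: "nat \<Rightarrow> gfun \<Rightarrow> bool" for N where
  const: "polyf N (\<lambda>_. c)"
| add: "polyf N F \<Longrightarrow> polyf N G \<Longrightarrow> polyf N (\<lambda>z. F z + G z)"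
| zmul: "d \<in> dirs N \<Longrightarrow> polyf N G \<Longrightarrow> polyf N (\<lambda>z. zc d z * G z)"

lemma polyf_smooth: "polyf N G \<Longrightarrow> smooth G"
  by (induction rule: polyf.induct) (auto intro: smooth.intros)

lemma polyf_cmult: "polyf N G \<Longrightarrow> polyf N (\<lambda>z. c * G z)"
proof (induction rule: polyf.induct)
  case (const c') show ?case by (rule polyf.const)
next
  case (add F G) then show ?case by (simp add: distrib_left polyf.add)
next
  case (zmul d G)
  then show ?case using polyf.zmul[of d N "\<lambda>z. c * G z"] by (simp add: mult.left_commute)
qed

lemma polyf_mult: "polyf N F \<Longrightarrow> polyf N G \<Longrightarrow> polyf N (\<lambda>z. F z * G z)"
proof (induction rule: polyf.induct)
  case (const c) then show ?case by (intro polyf_cmult)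
next
  case (add F F') then show ?case by (simp add: distrib_right polyf.add)
next
  case (zmul d F)
  then show ?case using polyf.zmul[of d N "\<lambda>z. F z * G z"] by (simp add: mult.assoc)
qed

lemma polyf_diff: "polyf N F \<Longrightarrow> polyf N G \<Longrightarrow> polyf N (\<lambda>z. F z - G z)"
  using polyf.add[of N F "\<lambda>z. -1 * G z"] polyf_cmult[of N G "-1"] by simp

lemma polyf_wirt: "polyf N G \<Longrightarrow> polyf N (wirt d G)"
proof (induction rule: polyf.induct)
  case (zmul e G)
  have "polyf N (\<lambda>z. (if d = e then 1 else 0) * G z + zc e z * wirt d G z)"
    using zmul by (intro polyf.add polyf.zmul polyf_cmult)
  then show ?case using zmul by (simp add: wirt_mult smooth.zc polyf_smooth)
qed (auto simp: wirt_add polyf_smooth intro: polyf.intros)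

lemma polyf_sum: "(\<And>i. i \<in> I \<Longrightarrow> polyf N (F i)) \<Longrightarrow> polyf N (\<lambda>z. \<Sum>i\<in>I. F i z)"
  by (induction I rule: infinite_finite_induct) (auto intro: polyf.intros)

lemma polyf_wick: "set ds \<subseteq> dirs N \<Longrightarrow> polyf N (wick ds)"
  by (induction ds) (auto simp: creation_def intro!: polyf.intros polyf_diff polyf_wirt)

inductive wick_span :: "nat \<Rightarrow> gfun \<Rightarrow> bool" for N where
  wick: "set ds \<subseteq> dirs N \<Longrightarrow> wick_span N (wick ds)"
| add: "wick_span N F \<Longrightarrow> wick_span N G \<Longrightarrow> wick_span N (\<lambda>z. F z + G z)"
| cmult: "wick_span N F \<Longrightarrow> wick_span N (\<lambda>z. c * F z)"

lemma wick_span_smooth: "wick_span N G \<Longrightarrow> smooth G"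
  by (induction rule: wick_span.induct) (auto intro: smooth_wick smooth.add smooth_cmult)

lemma wick_span_creation: "wick_span N G \<Longrightarrow> d \<in> dirs N \<Longrightarrow> wick_span N (creation d G)"
proof (induction rule: wick_span.induct)
  case (wick ds)
  then show ?case using wick_span.wick[of "d # ds"] by simp
next
  case (add F G)
  then show ?case by (simp add: creation_add wick_span_smooth wick_span.add)
next
  case (cmult F c)
  then show ?case by (simp add: creation_cmult wick_span_smooth wick_span.cmult)
qed

lemma wick_span_const: "wick_span N (\<lambda>_. c)"
  using wick_span.cmult[OF wick_span.wick[of "[]"], of N c] by simp

lemma wick_span_wirt: "wick_span N G \<Longrightarrow> wick_span N (wirt d G)"
proof (induction rule: wick_span.induct)
  case (wick ds)
  then show ?case
  proof (induction ds)
    case Nil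
    then show ?case by (simp add: wick_span_const)
  next
    case (Cons e ds)
    have "wick_span N (\<lambda>z. (if d = e then 1 else 0) * wick ds z + creation e (wirt d (wick ds)) z)"
      using Cons by (intro wick_span.add wick_span.cmult wick_span.wick wick_span_creation) auto
    moreover have "wirt d (wick (e # ds)) = (\<lambda>z. (if d = e then 1 else 0) * wick ds z + creation e (wirt d (wick ds)) z)"
      by (simp add: wirt_creation smooth_wick)
    ultimately show ?case by simp
  qed
next
  case (add F G)
  then show ?case by (simp add: wirt_add wick_span_smooth wick_span.add)
next
  case (cmult F c)
  then show ?case by (simp add: wirt_cmult wick_span_smooth wick_span.cmult)
qed

text \<open>Multiplication by a variable is the sum of a creation and a differentiation, and the
  span of the Wick monomials is stable under both.\<close>

lemma polyf_wick_span: "polyf N G \<Longrightarrow> wick_span N G"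
proof (induction rule: polyf.induct)
  case (zmul d G)
  have "wick_span N (\<lambda>z. creation d G z + wirt (star d) G z)"
    using zmul by (intro wick_span.add wick_span_creation wick_span_wirt)
  then show ?case by (simp add: creation_def)
qed (auto intro: wick_span.intros wick_span_const)

text \<open>Sorting Wick monomials by length gives the components. They form a sequence that
  vanishes from \<open>K\<close> on, so that two decompositions can be added over the longer range;
  the component of order 0 is recorded as a constant because it becomes the mean.\<close>

lemma wick_span_decomp:
  "wick_span N Y \<Longrightarrow> \<exists>K Z c. (\<forall>m. eig N m (Z m)) \<and> (\<forall>m\<ge>K. Z m = (\<lambda>_. 0)) \<and> Z 0 = (\<lambda>_. c) \<and>
     Y = (\<lambda>z. \<Sum>m<K. Z m z)"
proof (induction rule: wick_span.induct)
  case (wick ds)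
  define Z where "Z = (\<lambda>m. if m = length ds then wick ds else (\<lambda>_. 0))"
  have "wick ds = (\<lambda>z. \<Sum>m<Suc (length ds). Z m z)"
    by (simp add: Z_def fun_eq_iff)
  moreover have "Z 0 = (\<lambda>_. if ds = [] then 1 else 0)" by (auto simp: Z_def)
  moreover have "eig N m (Z m)" for m using eig_wick[OF wick] by (auto simp: Z_def eig_zero)
  moreover have "\<forall>m\<ge>Suc (length ds). Z m = (\<lambda>_. 0)" by (auto simp: Z_def)
  ultimately show ?case by blast
next
  case (add F G)
  then obtain K Z c K' Z' c' where
    1: "\<forall>m. eig N m (Z m)" "\<forall>m\<ge>K. Z m = (\<lambda>_. 0)" "Z 0 = (\<lambda>_. c)" "F = (\<lambda>z. \<Sum>m<K. Z m z)" and
    2: "\<forall>m. eig N m (Z' m)" "\<forall>m\<ge>K'. Z' m = (\<lambda>_. 0)" "Z' 0 = (\<lambda>_. c')" "G = (\<lambda>z. \<Sum>m<K'. Z' m z)"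
    by blast
  let ?K = "max K K'"
  have F: "F z = (\<Sum>m<?K. Z m z)" for z
    unfolding 1(4) using 1(2) by (intro sum.mono_neutral_left) auto
  have G: "G z = (\<Sum>m<?K. Z' m z)" for z
    unfolding 2(4) using 2(2) by (intro sum.mono_neutral_left) auto
  have "\<forall>m. eig N m (\<lambda>z. Z m z + Z' m z)" using 1 2 by (auto intro: eig_add)
  moreover have "\<forall>m\<ge>?K. (\<lambda>z. Z m z + Z' m z) = (\<lambda>_. 0)" using 1 2 by auto
  moreover have "(\<lambda>z. Z 0 z + Z' 0 z) = (\<lambda>_. c + c')" using 1 2 by auto
  moreover have "(\<lambda>z. F z + G z) = (\<lambda>z. \<Sum>m<?K. Z m z + Z' m z)"
    using F G by (simp add: sum.distrib)
  ultimately show ?case by (intro exI[of _ ?K] exI[of _ "\<lambda>m z. Z m z + Z' m z"] exI[of _ "c + c'"]) blast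
next
  case (cmult F a)
  then obtain K Z c where
    1: "\<forall>m. eig N m (Z m)" "\<forall>m\<ge>K. Z m = (\<lambda>_. 0)" "Z 0 = (\<lambda>_. c)" "F = (\<lambda>z. \<Sum>m<K. Z m z)" by blast
  have "\<forall>m. eig N m (\<lambda>z. a * Z m z)" using 1 by (auto intro: eig_cmult)
  moreover have "\<forall>m\<ge>K. (\<lambda>z. a * Z m z) = (\<lambda>_. 0)" using 1 by auto
  moreover have "(\<lambda>z. a * Z 0 z) = (\<lambda>_. a * c)" using 1 by auto
  moreover have "(\<lambda>z. a * F z) = (\<lambda>z. \<Sum>m<K. a * Z m z)" using 1 by (simp add: sum_distrib_left)
  ultimately show ?case by (intro exI[of _ K] exI[of _ "\<lambda>m z. a * Z m z"] exI[of _ "a * c"]) blast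
qed

section \<open>Orthogonality of the chaoses and the spectral gap\<close>

definition n2 :: "gfun \<Rightarrow> real" where
  "n2 F = (\<integral>z. (cmod (F z))\<^sup>2 \<partial>GP)"

lemma n2_nonneg[simp]: "n2 F \<ge> 0"
  unfolding n2_def by simp

lemma n2_EE: "EE (\<lambda>z. F z * cnj (F z)) = of_real (n2 F)"
  unfolding EE_def n2_def by (simp add: complex_norm_square[symmetric] del: of_real_power)

lemma n2_cmult: "n2 (\<lambda>z. c * F z) = (cmod c)\<^sup>2 * n2 F"
  unfolding n2_def by (simp add: norm_mult power_mult_distrib)

lemma smooth_sq_integrable: "smooth F \<Longrightarrow> integrable GP (\<lambda>z. (cmod (F z))\<^sup>2)"
proof -
  assume F: "smooth F"
  have "integrable GP (\<lambda>z. Re (F z * cnj (F z)))"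
    by (intro integrable_Re smooth_integrable smooth.mult smooth_cnj F)
  then show ?thesis by (simp add: complex_norm_square[symmetric] del: of_real_power complex_mult_cnj)
qed

lemma cmod_add_sq_le: "(cmod (a + b))\<^sup>2 \<le> 2 * (cmod a)\<^sup>2 + 2 * (cmod b)\<^sup>2"
proof -
  have "(cmod (a + b))\<^sup>2 \<le> (cmod a + cmod b)\<^sup>2"
    by (intro power_mono norm_triangle_ineq) auto
  also have "\<dots> \<le> 2 * (cmod a)\<^sup>2 + 2 * (cmod b)\<^sup>2"
    using zero_le_power2[of "cmod a - cmod b"] by (simp add: power2_eq_square algebra_simps)
  finally show ?thesis .
qed

lemma n2_add:
  assumes "smooth F" "smooth G"
  shows "n2 (\<lambda>z. F z + G z) \<le> 2 * n2 F + 2 * n2 G"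
proof -
  have "n2 (\<lambda>z. F z + G z) \<le> (\<integral>z. 2 * (cmod (F z))\<^sup>2 + 2 * (cmod (G z))\<^sup>2 \<partial>GP)"
    unfolding n2_def using assms
    by (intro integral_mono Bochner_Integration.integrable_add integrable_mult_right smooth_sq_integrable smooth.add cmod_add_sq_le)
  also have "\<dots> = 2 * n2 F + 2 * n2 G"
    unfolding n2_def using assms by (simp add: smooth_sq_integrable)
  finally show ?thesis .
qed

lemma eig_form:
  assumes X: "eig N m X" and Y: "smooth Y"
  shows "of_nat m * EE (\<lambda>z. X z * cnj (Y z)) = (\<Sum>d\<in>dirs N. EE (\<lambda>z. wirt d X z * cnj (wirt d Y z)))"
  using eigD[OF X smooth_cnj[OF Y]] by (simp add: wirt_cnj Y)

text \<open>The Dirichlet form is Hermitian; evaluated through either argument it is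
  \<open>m\<close> times and \<open>m'\<close> times the same inner product.\<close>

lemma eig_orth:
  assumes X: "eig N m X" and Y: "eig N m' Y" and ne: "m \<noteq> m'"
  shows "EE (\<lambda>z. X z * cnj (Y z)) = 0"
proof -
  have s: "smooth X" "smooth Y" using X Y by (auto intro: eig_smooth)
  have "of_nat m' * EE (\<lambda>z. X z * cnj (Y z)) = cnj (of_nat m' * EE (\<lambda>z. Y z * cnj (X z)))"
    by (simp add: EE_cnj[symmetric] mult.commute)
  also have "\<dots> = (\<Sum>d\<in>dirs N. cnj (EE (\<lambda>z. wirt d Y z * cnj (wirt d X z))))"
    using eig_form[OF Y s(1)] by (simp add: cnj_sum)
  also have "\<dots> = (\<Sum>d\<in>dirs N. EE (\<lambda>z. wirt d X z * cnj (wirt d Y z)))"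
    by (simp add: EE_cnj[symmetric] mult.commute)
  also have "\<dots> = of_nat m * EE (\<lambda>z. X z * cnj (Y z))"
    using eig_form[OF X s(2)] by simp
  finally show ?thesis using ne by simp
qed

text \<open>Spectral gap: the component of order \<open>m\<close> enters the squared norm once and
  the Dirichlet form \<open>m\<close> times. Only the component of order 0 escapes this control, and
  it is the mean.\<close>

lemma poincare:
  assumes "polyf N Y"
  shows "n2 Y \<le> (cmod (EE Y))\<^sup>2 + (\<Sum>d\<in>dirs N. n2 (wirt d Y))"
proof -
  obtain K Z c where Z: "\<And>m. eig N m (Z m)" and Z0: "Z 0 = (\<lambda>_. c)" and Y: "Y = (\<lambda>z. \<Sum>m<K. Z m z)"
    and ZK: "\<And>m. m \<ge> K \<Longrightarrow> Z m = (\<lambda>_. 0)"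
    using wick_span_decomp[OF polyf_wick_span[OF assms]] by blast
  have s: "smooth (Z m)" for m using Z by (rule eig_smooth)
  have o: "EE (\<lambda>z. Z m z * cnj (Z m' z)) = (if m = m' then of_real (n2 (Z m)) else 0)" for m m'
    using eig_orth[OF Z Z] by (auto simp: n2_EE)
  have "complex_of_real (n2 Y) = EE (\<lambda>z. \<Sum>m<K. \<Sum>m'<K. Z m z * cnj (Z m' z))"
    unfolding n2_EE[symmetric] Y by (simp add: sum_product)
  also have "\<dots> = (\<Sum>m<K. \<Sum>m'<K. EE (\<lambda>z. Z m z * cnj (Z m' z)))"
    using s by (simp add: EE_sum smooth_sum smooth.mult smooth_cnj)
  also have "\<dots> = of_real (\<Sum>m<K. n2 (Z m))" by (simp add: o)
  finally have n: "n2 Y = (\<Sum>m<K. n2 (Z m))" using of_real_eq_iff by blast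
  have "complex_of_real (\<Sum>d\<in>dirs N. n2 (wirt d Y)) = (\<Sum>d\<in>dirs N. EE (\<lambda>z. \<Sum>m<K. \<Sum>m'<K. wirt d (Z m) z * cnj (wirt d (Z m') z)))"
    unfolding of_real_sum n2_EE[symmetric] Y by (simp add: sum_product wirt_sum s)
  also have "\<dots> = (\<Sum>d\<in>dirs N. \<Sum>m<K. \<Sum>m'<K. EE (\<lambda>z. wirt d (Z m) z * cnj (wirt d (Z m') z)))"
    using s by (simp add: EE_sum smooth_sum smooth.mult smooth_cnj smooth_wirt)
  also have "\<dots> = (\<Sum>m<K. \<Sum>m'<K. \<Sum>d\<in>dirs N. EE (\<lambda>z. wirt d (Z m) z * cnj (wirt d (Z m') z)))"
    by (subst sum.swap) (rule sum.cong[OF refl], subst sum.swap, rule refl)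
  also have "\<dots> = (\<Sum>m<K. \<Sum>m'<K. of_nat m * (if m = m' then of_real (n2 (Z m)) else 0))"
    by (simp add: eig_form[OF Z s, symmetric] o)
  also have "\<dots> = of_real (\<Sum>m<K. of_nat m * n2 (Z m))" by (simp add: if_distrib[of "\<lambda>x. _ * x"] cong: if_cong)
  finally have e: "(\<Sum>d\<in>dirs N. n2 (wirt d Y)) = (\<Sum>m<K. of_nat m * n2 (Z m))" using of_real_eq_iff by blast
  have Em: "EE (Z m) = (if m = 0 then c else 0)" for m
    using eigD[OF Z[of m] smooth.const[of 1]] by (auto simp: Z0)
  have "EE Y = (\<Sum>m<K. EE (Z m))" unfolding Y using s by (simp add: EE_sum)
  also have "\<dots> = (if K > 0 then c else 0)" by (simp add: Em)
  finally have EY: "EE Y = (if K > 0 then c else 0)" .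
  have n0: "n2 (Z 0) = (cmod c)\<^sup>2" unfolding Z0 n2_def by (simp add: GP.prob_space[simplified])
  have "n2 Y \<le> (\<Sum>m<K. (if m = 0 then (cmod c)\<^sup>2 else 0) + of_nat m * n2 (Z m))"
    unfolding n
  proof (rule sum_mono)
    fix m
    show "n2 (Z m) \<le> (if m = 0 then (cmod c)\<^sup>2 else 0) + real m * n2 (Z m)"
      using n0 mult_right_mono[of 1 "real m" "n2 (Z m)"] by (cases "m = 0") auto
  qed
  also have "\<dots> = (cmod (EE Y))\<^sup>2 + (\<Sum>d\<in>dirs N. n2 (wirt d Y))"
    unfolding sum.distrib e EY by simp
  finally show ?thesis .
qed

section \<open>Chaoses and contractions\<close>

definition dir_lists :: "nat \<Rightarrow> nat \<Rightarrow> dir list set" where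
  "dir_lists N m = {ds. length ds = m \<and> set ds \<subseteq> dirs N}"

lemma finite_dir_lists[simp]: "finite (dir_lists N m)"
  using finite_lists_length_eq[OF finite_dirs[of N], of m] by (simp add: dir_lists_def conj_commute)

lemma dir_lists_0[simp]: "dir_lists N 0 = {[]}"
  by (auto simp: dir_lists_def)

lemma sum_dir_lists_Suc: "(\<Sum>ds\<in>dir_lists N (Suc m). F ds) = (\<Sum>d\<in>dirs N. \<Sum>ds\<in>dir_lists N m. F (d # ds))"
proof -
  have "dir_lists N (Suc m) = (\<lambda>(d, ds). d # ds) ` (dirs N \<times> dir_lists N m)"
    by (force simp: dir_lists_def length_Suc_conv image_iff)
  moreover have "inj_on (\<lambda>(d, ds). d # ds) (dirs N \<times> dir_lists N m)" by (auto simp: inj_on_def)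
  ultimately have "(\<Sum>ds\<in>dir_lists N (Suc m). F ds) = (\<Sum>p\<in>dirs N \<times> dir_lists N m. F (fst p # snd p))"
    by (simp add: sum.reindex case_prod_beta' o_def)
  then show ?thesis by (simp add: sum.cartesian_product case_prod_beta')
qed

lemma sum_dir_lists_add: "(\<Sum>ds\<in>dir_lists N (a + b). F ds) = (\<Sum>x\<in>dir_lists N a. \<Sum>y\<in>dir_lists N b. F (x @ y))"
  by (induction a arbitrary: F) (simp_all add: sum_dir_lists_Suc)

lemma sum_dir_lists_star: "(\<Sum>ds\<in>dir_lists N m. F (map star ds)) = (\<Sum>ds\<in>dir_lists N m. F ds)"
proof (rule sum.reindex_bij_witness[where i="map star" and j="map star"])
  have inv: "map star (map star ds) = ds" for ds by (induction ds) auto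
  have mem: "map star ds \<in> dir_lists N m" if "ds \<in> dir_lists N m" for ds
    using that star_dirs unfolding dir_lists_def by fastforce
  show "map star (map star ds) = ds" "map star (map star ds) = ds" for ds by (rule inv)+
  show "map star ds \<in> dir_lists N m" "map star ds \<in> dir_lists N m" if "ds \<in> dir_lists N m" for ds by (rule mem[OF that])+
qed simp

text \<open>Invariance under permutations of all slots at once, plain and conjugated directions
  mixed. In this form a single order \<open>m\<close> describes an integral, and a derivative in any
  direction can act on the leading slot.\<close>

definition symk :: "(dir list \<Rightarrow> complex) \<Rightarrow> bool" where
  "symk g \<longleftrightarrow> (\<forall>ds ds'. mset ds = mset ds' \<longrightarrow> g ds = g ds')"

lemma symkD: "symk g \<Longrightarrow> mset ds = mset ds' \<Longrightarrow> g ds = g ds'"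
  unfolding symk_def by blast

lemma symkI: "(\<And>ds ds'. mset ds = mset ds' \<Longrightarrow> g ds = g ds') \<Longrightarrow> symk g"
  unfolding symk_def by blast

lemma symk_Cons: "symk g \<Longrightarrow> symk (\<lambda>ds. g (d # ds))"
  by (rule symkI, erule symkD, simp)

lemma symk_append: "symk g \<Longrightarrow> symk (\<lambda>ds. g (xs @ ds))"
  by (rule symkI, erule symkD, simp)

definition wick_int :: "nat \<Rightarrow> nat \<Rightarrow> (dir list \<Rightarrow> complex) \<Rightarrow> gfun" where
  "wick_int N m g = (\<lambda>z. \<Sum>ds\<in>dir_lists N m. g ds * wick ds z)"

lemma wick_int_0: "wick_int N 0 g = (\<lambda>_. g [])"
  by (simp add: wick_int_def)

lemma polyf_wick_int: "polyf N (wick_int N m g)"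
  unfolding wick_int_def by (rule polyf_sum, rule polyf_cmult, rule polyf_wick) (auto simp: dir_lists_def)

lemma smooth_wick_int: "smooth (wick_int N m g)"
  by (rule polyf_smooth[OF polyf_wick_int])

lemma eig_wick_int: "eig N m (wick_int N m g)"
  unfolding wick_int_def using eig_wick by (intro eig_sum eig_cmult) (auto simp: dir_lists_def)

lemma wick_int_Suc: "wick_int N (Suc m) g = (\<lambda>z. \<Sum>d\<in>dirs N. creation d (wick_int N m (\<lambda>ds. g (d # ds))) z)"
proof -
  have "creation d (wick_int N m (\<lambda>ds. g (d # ds))) = (\<lambda>z. \<Sum>ds\<in>dir_lists N m. g (d # ds) * creation d (wick ds) z)" for d
    unfolding wick_int_def by (simp add: creation_sum creation_cmult smooth_cmult smooth_wick)
  then show ?thesis by (simp add: wick_int_def sum_dir_lists_Suc)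
qed

lemma wick_int_cmult: "wick_int N m (\<lambda>ds. c * g ds) = (\<lambda>z. c * wick_int N m g z)"
  by (simp add: wick_int_def sum_distrib_left mult.assoc)

text \<open>Moving the derivative through the creation operators removes one slot at a time, and by
  symmetry each of the \<open>m\<close> slots yields the same integral.\<close>

lemma wirt_wick_int:
  assumes "symk g" "d \<in> dirs N"
  shows "wirt d (wick_int N m g) = (\<lambda>z. of_nat m * wick_int N (m - 1) (\<lambda>ds. g (d # ds)) z)"
  using assms(1)
proof (induction m arbitrary: g)
  case 0
  then show ?case by (simp add: wick_int_0)
next
  case (Suc m)
  have "wirt d (wick_int N (Suc m) g) z = of_nat (Suc m) * wick_int N m (\<lambda>ds. g (d # ds)) z" for z
  proof -
    have "wirt d (wick_int N (Suc m) g) z = (\<Sum>e\<in>dirs N. (if d = e then wick_int N m (\<lambda>ds. g (e # ds)) z else 0)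
            + creation e (wirt d (wick_int N m (\<lambda>ds. g (e # ds)))) z)"
      by (simp add: wick_int_Suc wirt_sum smooth_creation smooth_wick_int wirt_creation)
    also have "\<dots> = wick_int N m (\<lambda>ds. g (d # ds)) z + (\<Sum>e\<in>dirs N. creation e (wirt d (wick_int N m (\<lambda>ds. g (e # ds)))) z)"
      using assms(2) by (simp add: sum.distrib)
    also have "(\<Sum>e\<in>dirs N. creation e (wirt d (wick_int N m (\<lambda>ds. g (e # ds)))) z) = of_nat m * wick_int N m (\<lambda>ds. g (d # ds)) z"
    proof (cases m)
      case 0
      then show ?thesis using Suc.IH[OF symk_Cons[OF Suc.prems]] by simp
    next
      case (Suc k)
      have "g (e # d # ds) = g (d # e # ds)" for e ds
        by (rule symkD[OF \<open>symk g\<close>]) simp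
      then have "creation e (wirt d (wick_int N m (\<lambda>ds. g (e # ds)))) z = of_nat m * creation e (wick_int N k (\<lambda>ds. g (d # e # ds))) z" for e
        using Suc.IH[OF symk_Cons[OF Suc.prems]] Suc by (simp add: creation_cmult smooth_wick_int)
      then show ?thesis by (simp add: Suc wick_int_Suc sum_distrib_left)
    qed
    finally show ?thesis by (simp add: distrib_right)
  qed
  then show ?case by (simp add: fun_eq_iff)
qed

text \<open>Each creation operator of the left factor becomes a derivative of the right one. The
  pairing is bilinear, hence the starred directions in \<open>h\<close>. Orders that differ leave
  either the mean of a nontrivial integral or the derivative of a constant, and both are 0.\<close>

lemma EE_wick_int_mult:
  assumes "symk h"
  shows "EE (\<lambda>z. wick_int N m g z * wick_int N k h z) = (if m = k then fact m * (\<Sum>ds\<in>dir_lists N m. g ds * h (map star ds)) else 0)"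
  using assms
proof (induction m arbitrary: k g h)
  case 0
  have "EE (wick_int N k h) = 0" if "k = Suc k'" for k'
  proof -
    have "EE (\<lambda>z. creation d (wick_int N k' (\<lambda>ds. h (d # ds))) z * 1) = 0" for d
      by (subst EE_creation) (auto simp: smooth_wick_int smooth.const)
    then show ?thesis using that by (simp add: wick_int_Suc EE_sum smooth_creation smooth_wick_int)
  qed
  then show ?case by (cases k) (auto simp: wick_int_0 EE_cmult)
next
  case (Suc m)
  have "EE (\<lambda>z. wick_int N (Suc m) g z * wick_int N k h z)
      = (\<Sum>d\<in>dirs N. EE (\<lambda>z. creation d (wick_int N m (\<lambda>ds. g (d # ds))) z * wick_int N k h z))"
    by (simp add: wick_int_Suc[of _ m] sum_distrib_right EE_sum smooth_creation smooth_wick_int smooth.mult)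
  also have "\<dots> = (\<Sum>d\<in>dirs N. of_nat k * EE (\<lambda>z. wick_int N m (\<lambda>ds. g (d # ds)) z * wick_int N (k - 1) (\<lambda>ds. h (star d # ds)) z))"
  proof (rule sum.cong[OF refl])
    fix d assume d: "d \<in> dirs N"
    have "EE (\<lambda>z. creation d (wick_int N m (\<lambda>ds. g (d # ds))) z * wick_int N k h z) =
          EE (\<lambda>z. of_nat k * (wick_int N m (\<lambda>ds. g (d # ds)) z * wick_int N (k - 1) (\<lambda>ds. h (star d # ds)) z))"
      using d Suc.prems by (simp add: EE_creation smooth_wick_int wirt_wick_int mult.left_commute)
    then show "EE (\<lambda>z. creation d (wick_int N m (\<lambda>ds. g (d # ds))) z * wick_int N k h z) =
        of_nat k * EE (\<lambda>z. wick_int N m (\<lambda>ds. g (d # ds)) z * wick_int N (k - 1) (\<lambda>ds. h (star d # ds)) z)"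
      by (simp only: EE_cmult)
  qed
  also have "\<dots> = (if Suc m = k then fact (Suc m) * (\<Sum>ds\<in>dir_lists N (Suc m). g ds * h (map star ds)) else 0)"
    by (cases k) (simp_all add: Suc.IH[OF symk_Cons[OF Suc.prems]] sum_dir_lists_Suc sum_distrib_left mult.assoc)
  finally show ?case .
qed

text \<open>An intermediate stage in differentiating a product of two integrals: \<open>i\<close>
  pairs of slots are contracted, \<open>x\<close> and \<open>y\<close> are the slots freed by
  derivatives, and \<open>m\<close> and \<open>k\<close> slots are still integrated.\<close>

definition cross :: "nat \<Rightarrow> nat \<Rightarrow> nat \<Rightarrow> nat \<Rightarrow> (dir list \<Rightarrow> complex) \<Rightarrow> (dir list \<Rightarrow> complex) \<Rightarrow> dir list \<Rightarrow> dir list \<Rightarrow> gfun" where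
  "cross N i m k g h x y = (\<lambda>z. \<Sum>s\<in>dir_lists N i. wick_int N m (\<lambda>ds. g (x @ s @ ds)) z * wick_int N k (\<lambda>ds. h (y @ map star s @ ds)) z)"

definition cross_sum :: "nat \<Rightarrow> nat \<Rightarrow> nat \<Rightarrow> nat \<Rightarrow> nat \<Rightarrow> nat \<Rightarrow> (dir list \<Rightarrow> complex) \<Rightarrow> (dir list \<Rightarrow> complex) \<Rightarrow> real" where
  "cross_sum N m k a b i g h = (\<Sum>x\<in>dir_lists N a. \<Sum>y\<in>dir_lists N b. n2 (cross N i m k g h x y))"

text \<open>The stage at which no integrated slot is left: the squared norm of the contraction of
  \<open>g\<close> and \<open>h\<close> over \<open>r\<close> pairs of slots, not symmetrised in the
  \<open>a\<close> and \<open>b\<close> free ones.\<close>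

definition contr_norm :: "nat \<Rightarrow> nat \<Rightarrow> nat \<Rightarrow> nat \<Rightarrow> (dir list \<Rightarrow> complex) \<Rightarrow> (dir list \<Rightarrow> complex) \<Rightarrow> real" where
  "contr_norm N a b r g h = (\<Sum>x\<in>dir_lists N a. \<Sum>y\<in>dir_lists N b. (cmod (\<Sum>s\<in>dir_lists N r. g (x @ s) * h (y @ map star s)))\<^sup>2)"

lemma contr_norm_nonneg: "contr_norm N a b r g h \<ge> 0"
  unfolding contr_norm_def by (intro sum_nonneg) auto

lemma polyf_cross: "polyf N (cross N i m k g h x y)"
  unfolding cross_def by (intro polyf_sum polyf_mult polyf_wick_int)

lemma wirt_cross:
  assumes g: "symk g" and h: "symk h" and d: "d \<in> dirs N"
  shows "wirt d (cross N i m k g h x y) = (\<lambda>z. of_nat m * cross N i (m - 1) k g h (d # x) y z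
           + of_nat k * cross N i m (k - 1) g h x (d # y) z)"
proof -
  have g': "symk (\<lambda>ds. g (x @ s @ ds))" and h': "symk (\<lambda>ds. h (y @ map star s @ ds))" for s
    using symk_append[OF g, of "x @ s"] symk_append[OF h, of "y @ map star s"] by simp_all
  have gd: "g (x @ s @ d # ds) = g (d # x @ s @ ds)" and hd: "h (y @ map star s @ d # ds) = h (d # y @ map star s @ ds)" for s ds
    by (rule symkD[OF g], simp, rule symkD[OF h], simp)
  show ?thesis
    unfolding cross_def
    by (simp add: wirt_sum wirt_mult smooth_wick_int smooth.mult wirt_wick_int[OF g' d] wirt_wick_int[OF h' d] gd hd sum.distrib sum_distrib_left mult_ac)
qed

lemma n2_wirt_cross:
  assumes g: "symk g" and h: "symk h" and d: "d \<in> dirs N"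
  shows "n2 (wirt d (cross N i m k g h x y)) \<le> 2 * (real m)\<^sup>2 * n2 (cross N i (m - 1) k g h (d # x) y)
            + 2 * (real k)\<^sup>2 * n2 (cross N i m (k - 1) g h x (d # y))"
proof -
  have "n2 (wirt d (cross N i m k g h x y)) \<le> 2 * n2 (\<lambda>z. of_nat m * cross N i (m - 1) k g h (d # x) y z)
          + 2 * n2 (\<lambda>z. of_nat k * cross N i m (k - 1) g h x (d # y) z)"
    unfolding wirt_cross[OF assms] by (intro n2_add smooth_cmult polyf_smooth[OF polyf_cross])
  then show ?thesis by (simp add: n2_cmult)
qed

lemma EE_cross:
  assumes "symk g" "symk h"
  shows "EE (cross N i m k g h x y) = (if m = k then fact m * (\<Sum>s\<in>dir_lists N (i + m). g (x @ s) * h (y @ map star s)) else 0)"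
proof -
  have h': "symk (\<lambda>ds. h (y @ map star s @ ds))" for s
    using symk_append[OF assms(2), of "y @ map star s"] by simp
  have "EE (cross N i m k g h x y) = (\<Sum>s\<in>dir_lists N i. EE (\<lambda>z. wick_int N m (\<lambda>ds. g (x @ s @ ds)) z * wick_int N k (\<lambda>ds. h (y @ map star s @ ds)) z))"
    unfolding cross_def by (intro EE_sum smooth.mult smooth_wick_int)
  then show ?thesis by (simp add: EE_wick_int_mult[OF h'] sum_dir_lists_add sum_distrib_left)
qed

text \<open>One use of the Poincare inequality. The mean can be nonzero only for
  \<open>m = k\<close>, where it contracts all remaining slots; by the product rule each derivative
  frees one slot of one of the factors.\<close>

lemma cross_sum_step:
  assumes g: "symk g" and h: "symk h"
  shows "cross_sum N m k a b i g h \<le> (if m = k then (fact m)\<^sup>2 * contr_norm N a b (i + m) g h else 0)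
     + 2 * (real m)\<^sup>2 * cross_sum N (m - 1) k (Suc a) b i g h + 2 * (real k)\<^sup>2 * cross_sum N m (k - 1) a (Suc b) i g h"
proof -
  have "cross_sum N m k a b i g h \<le> (\<Sum>x\<in>dir_lists N a. \<Sum>y\<in>dir_lists N b. (cmod (EE (cross N i m k g h x y)))\<^sup>2 +
      (\<Sum>d\<in>dirs N. 2 * (real m)\<^sup>2 * n2 (cross N i (m - 1) k g h (d # x) y) + 2 * (real k)\<^sup>2 * n2 (cross N i m (k - 1) g h x (d # y))))"
    unfolding cross_sum_def
    by (intro sum_mono order_trans[OF poincare[OF polyf_cross]] add_left_mono n2_wirt_cross g h)
  also have "\<dots> = (\<Sum>x\<in>dir_lists N a. \<Sum>y\<in>dir_lists N b. (cmod (EE (cross N i m k g h x y)))\<^sup>2)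
      + 2 * (real m)\<^sup>2 * (\<Sum>x\<in>dir_lists N a. \<Sum>y\<in>dir_lists N b. \<Sum>d\<in>dirs N. n2 (cross N i (m - 1) k g h (d # x) y))
      + 2 * (real k)\<^sup>2 * (\<Sum>x\<in>dir_lists N a. \<Sum>y\<in>dir_lists N b. \<Sum>d\<in>dirs N. n2 (cross N i m (k - 1) g h x (d # y)))"
    by (simp add: sum.distrib sum_distrib_left)
  also have "(\<Sum>x\<in>dir_lists N a. \<Sum>y\<in>dir_lists N b. (cmod (EE (cross N i m k g h x y)))\<^sup>2)
      = (if m = k then (fact m)\<^sup>2 * contr_norm N a b (i + m) g h else 0)"
    by (simp add: EE_cross[OF g h] contr_norm_def norm_mult power_mult_distrib sum_distrib_left[symmetric])
  also have "(\<Sum>x\<in>dir_lists N a. \<Sum>y\<in>dir_lists N b. \<Sum>d\<in>dirs N. n2 (cross N i (m - 1) k g h (d # x) y)) = cross_sum N (m - 1) k (Suc a) b i g h"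
  proof -
    have "(\<Sum>x\<in>dir_lists N a. \<Sum>y\<in>dir_lists N b. \<Sum>d\<in>dirs N. n2 (cross N i (m - 1) k g h (d # x) y))
        = (\<Sum>x\<in>dir_lists N a. \<Sum>d\<in>dirs N. \<Sum>y\<in>dir_lists N b. n2 (cross N i (m - 1) k g h (d # x) y))"
      by (rule sum.cong[OF refl], rule sum.swap)
    also have "\<dots> = cross_sum N (m - 1) k (Suc a) b i g h"
      unfolding cross_sum_def sum_dir_lists_Suc by (rule sum.swap)
    finally show ?thesis .
  qed
  also have "(\<Sum>x\<in>dir_lists N a. \<Sum>y\<in>dir_lists N b. \<Sum>d\<in>dirs N. n2 (cross N i m (k - 1) g h x (d # y))) = cross_sum N m (k - 1) a (Suc b) i g h"
    unfolding cross_sum_def sum_dir_lists_Suc by (rule sum.cong[OF refl], rule sum.swap)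
  finally show ?thesis .
qed

text \<open>The Poincare inequality is iterated until no integrated slot is left. A chain of
  derivatives contributes a mean whenever both factors retain the same number \<open>t\<close> of
  integrated slots; these get contracted while the others are free. The constant depends on the
  orders alone, not on \<open>N\<close> or the kernels.\<close>

lemma cross_sum_bound:
  "\<exists>C\<ge>0. \<forall>N a b i g h. symk g \<longrightarrow> symk h \<longrightarrow>
     cross_sum N m k a b i g h \<le> C * (\<Sum>t\<le>min m k. contr_norm N (a + m - t) (b + k - t) (i + t) g h)"
proof (induction "m + k" arbitrary: m k rule: less_induct)
  case less
  let ?K = "\<lambda>N a b i g h m k. \<Sum>t\<le>min m k. contr_norm N (a + m - t) (b + k - t) (i + t) g h"
  have K0: "?K N a b i g h m' k' \<ge> 0" for N a b i g h m' k'
    by (intro sum_nonneg contr_norm_nonneg)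
  have "\<exists>C\<ge>0. \<forall>N a b i g h. symk g \<longrightarrow> symk h \<longrightarrow>
      (real m)\<^sup>2 * cross_sum N (m - 1) k (Suc a) b i g h \<le> C * ?K N a b i g h m k"
  proof (cases m)
    case 0 then show ?thesis by (intro exI[of _ 0]) simp
  next
    case (Suc m')
    from less[of m' k] Suc obtain C where C: "C \<ge> 0" "\<And>N a b i g h. symk g \<Longrightarrow> symk h \<Longrightarrow>
       cross_sum N m' k a b i g h \<le> C * ?K N a b i g h m' k" by auto
    show ?thesis
    proof (intro exI[of _ "(real m)\<^sup>2 * C"] conjI allI impI)
      fix N a b i and g h :: "dir list \<Rightarrow> complex" assume s: "symk g" "symk h"
      \<comment> \<open>Because \<open>Suc a + m' = a + m\<close>, the summands agree and only the
        range of \<open>t\<close> is shorter.\<close>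
      have "?K N (Suc a) b i g h m' k \<le> ?K N a b i g h m k"
        using Suc by (auto intro!: sum_mono2 contr_norm_nonneg)
      then have "C * ?K N (Suc a) b i g h m' k \<le> C * ?K N a b i g h m k" using C(1) by (rule mult_left_mono)
      with C(2)[OF s, of N "Suc a" b i] have "cross_sum N m' k (Suc a) b i g h \<le> C * ?K N a b i g h m k" by linarith
      then have "(real m)\<^sup>2 * cross_sum N m' k (Suc a) b i g h \<le> (real m)\<^sup>2 * (C * ?K N a b i g h m k)"
        by (rule mult_left_mono) simp
      then show "(real m)\<^sup>2 * cross_sum N (m - 1) k (Suc a) b i g h \<le> (real m)\<^sup>2 * C * ?K N a b i g h m k"
        using Suc by (simp add: mult.assoc)
    qed (use C in auto)
  qed
  then obtain C1 where C1: "C1 \<ge> 0" "\<And>N a b i g h. symk g \<Longrightarrow> symk h \<Longrightarrow>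
      (real m)\<^sup>2 * cross_sum N (m - 1) k (Suc a) b i g h \<le> C1 * ?K N a b i g h m k" by blast
  have "\<exists>C\<ge>0. \<forall>N a b i g h. symk g \<longrightarrow> symk h \<longrightarrow>
      (real k)\<^sup>2 * cross_sum N m (k - 1) a (Suc b) i g h \<le> C * ?K N a b i g h m k"
  proof (cases k)
    case 0 then show ?thesis by (intro exI[of _ 0]) simp
  next
    case (Suc k')
    from less[of m k'] Suc obtain C where C: "C \<ge> 0" "\<And>N a b i g h. symk g \<Longrightarrow> symk h \<Longrightarrow>
       cross_sum N m k' a b i g h \<le> C * ?K N a b i g h m k'" by auto
    show ?thesis
    proof (intro exI[of _ "(real k)\<^sup>2 * C"] conjI allI impI)
      fix N a b i and g h :: "dir list \<Rightarrow> complex" assume s: "symk g" "symk h"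
      have "?K N a (Suc b) i g h m k' \<le> ?K N a b i g h m k"
        using Suc by (auto intro!: sum_mono2 contr_norm_nonneg)
      then have "C * ?K N a (Suc b) i g h m k' \<le> C * ?K N a b i g h m k" using C(1) by (rule mult_left_mono)
      with C(2)[OF s, of N a "Suc b" i] have "cross_sum N m k' a (Suc b) i g h \<le> C * ?K N a b i g h m k" by linarith
      then have "(real k)\<^sup>2 * cross_sum N m k' a (Suc b) i g h \<le> (real k)\<^sup>2 * (C * ?K N a b i g h m k)"
        by (rule mult_left_mono) simp
      then show "(real k)\<^sup>2 * cross_sum N m (k - 1) a (Suc b) i g h \<le> (real k)\<^sup>2 * C * ?K N a b i g h m k"
        using Suc by (simp add: mult.assoc)
    qed (use C in auto)
  qed
  then obtain C2 where C2: "C2 \<ge> 0" "\<And>N a b i g h. symk g \<Longrightarrow> symk h \<Longrightarrow>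
      (real k)\<^sup>2 * cross_sum N m (k - 1) a (Suc b) i g h \<le> C2 * ?K N a b i g h m k" by blast
  show ?case
  proof (intro exI[of _ "(fact m)\<^sup>2 + 2 * C1 + 2 * C2"] conjI allI impI)
    fix N a b i and g h :: "dir list \<Rightarrow> complex" assume s: "symk g" "symk h"
    have "(if m = k then (fact m)\<^sup>2 * contr_norm N a b (i + m) g h else 0) \<le> (fact m)\<^sup>2 * ?K N a b i g h m k"
    proof (cases "m = k")
      case True
      have "contr_norm N (a + m - m) (b + k - m) (i + m) g h \<le> ?K N a b i g h m k"
        using True by (intro member_le_sum[where f="\<lambda>t. contr_norm N (a + m - t) (b + k - t) (i + t) g h"]) (auto intro: contr_norm_nonneg)
      then show ?thesis using True by simp
    next
      case False then show ?thesis using K0 by simp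
    qed
    with cross_sum_step[OF s, of N m k a b i] C1(2)[OF s, of N a b i] C2(2)[OF s, of N a b i]
    show "cross_sum N m k a b i g h \<le> ((fact m)\<^sup>2 + 2 * C1 + 2 * C2) * ?K N a b i g h m k"
      by (simp add: algebra_simps)
  qed (use C1 C2 in auto)
qed

section \<open>Variance of the carre du champ of two chaoses\<close>

definition Gam :: "nat \<Rightarrow> gfun \<Rightarrow> gfun \<Rightarrow> gfun" where
  "Gam N X Y = (\<lambda>z. \<Sum>d\<in>dirs N. wirt d X z * wirt (star d) Y z)"

lemma smooth_Gam: "smooth X \<Longrightarrow> smooth Y \<Longrightarrow> smooth (Gam N X Y)"
  unfolding Gam_def by (intro smooth_sum smooth.mult smooth_wirt)

lemma eig_Gam:
  assumes "eig N m X" "smooth Y"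
  shows "EE (Gam N X Y) = of_nat m * EE (\<lambda>z. X z * Y z)"
  unfolding Gam_def using assms eig_smooth[OF assms(1)]
  by (simp add: eigD EE_sum smooth.mult smooth_wirt)

lemma variance_le:
  assumes "polyf N Y"
  shows "n2 (\<lambda>z. Y z - EE Y) \<le> (\<Sum>d\<in>dirs N. n2 (wirt d Y))"
proof -
  have s: "smooth Y" by (rule polyf_smooth[OF assms])
  have "n2 (\<lambda>z. Y z - EE Y) \<le> (cmod (EE (\<lambda>z. Y z - EE Y)))\<^sup>2 + (\<Sum>d\<in>dirs N. n2 (wirt d (\<lambda>z. Y z - EE Y)))"
    by (intro poincare polyf_diff assms polyf.const)
  then show ?thesis using s by (simp add: EE_diff wirt_diff smooth.const)
qed

text \<open>\<open>Gam\<close> of two integrals is \<open>m * k\<close> times a product with one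
  contracted pair. Subtracting the mean forces at least one differentiation, which frees a slot of
  one factor; this excludes \<open>r = m = k\<close>, the contraction that makes up the mean
  itself.\<close>

lemma Gam_wick_int_variance:
  assumes mk: "m \<ge> 1" "k \<ge> 1"
  shows "\<exists>C\<ge>0. \<forall>N g h. symk g \<longrightarrow> symk h \<longrightarrow>
     n2 (\<lambda>z. Gam N (wick_int N m g) (wick_int N k h) z - EE (Gam N (wick_int N m g) (wick_int N k h)))
       \<le> C * (\<Sum>r\<in>{r. 1 \<le> r \<and> r \<le> m \<and> r \<le> k \<and> (r < m \<or> r < k)}. contr_norm N (m - r) (k - r) r g h)"
proof -
  let ?R = "{r. 1 \<le> r \<and> r \<le> m \<and> r \<le> k \<and> (r < m \<or> r < k)}"
  have finR: "finite ?R" by (rule finite_subset[of _ "{..m}"]) auto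
  obtain C1 where C1: "C1 \<ge> 0" "\<And>N a b i g h. symk g \<Longrightarrow> symk h \<Longrightarrow>
     cross_sum N (m - 2) (k - 1) a b i g h \<le> C1 * (\<Sum>t\<le>min (m - 2) (k - 1). contr_norm N (a + (m - 2) - t) (b + (k - 1) - t) (i + t) g h)"
    using cross_sum_bound[of "m - 2" "k - 1"] by blast
  obtain C2 where C2: "C2 \<ge> 0" "\<And>N a b i g h. symk g \<Longrightarrow> symk h \<Longrightarrow>
     cross_sum N (m - 1) (k - 2) a b i g h \<le> C2 * (\<Sum>t\<le>min (m - 1) (k - 2). contr_norm N (a + (m - 1) - t) (b + (k - 2) - t) (i + t) g h)"
    using cross_sum_bound[of "m - 1" "k - 2"] by blast
  define C where "C = (real m * real k)\<^sup>2 * (2 * (real (m-1))\<^sup>2 * C1 + 2 * (real (k-1))\<^sup>2 * C2)"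
  show ?thesis
  proof (intro exI[of _ C] conjI allI impI)
    show "C \<ge> 0" unfolding C_def using C1 C2 by simp
    fix N and g h :: "dir list \<Rightarrow> complex" assume s: "symk g" "symk h"
    define B where "B = (\<Sum>r\<in>?R. contr_norm N (m - r) (k - r) r g h)"
    have B0: "B \<ge> 0" unfolding B_def by (intro sum_nonneg contr_norm_nonneg)
    let ?U = "cross N 1 (m - 1) (k - 1) g h [] []"
    have L1: "(\<Sum>s\<in>dir_lists N (Suc 0). F s) = (\<Sum>d\<in>dirs N. F [d])" for F :: "dir list \<Rightarrow> complex"
      by (simp add: sum_dir_lists_Suc)
    have G: "Gam N (wick_int N m g) (wick_int N k h) = (\<lambda>z. (of_nat m * of_nat k) * ?U z)"
      unfolding Gam_def cross_def using s
      by (simp add: L1 wirt_wick_int sum_distrib_left mult_ac)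
    have V: "n2 (\<lambda>z. Gam N (wick_int N m g) (wick_int N k h) z - EE (Gam N (wick_int N m g) (wick_int N k h))) = (real m * real k)\<^sup>2 * n2 (\<lambda>z. ?U z - EE ?U)"
    proof -
      have "(\<lambda>z. Gam N (wick_int N m g) (wick_int N k h) z - EE (Gam N (wick_int N m g) (wick_int N k h))) = (\<lambda>z. (of_nat m * of_nat k) * (?U z - EE ?U))"
        unfolding G by (simp only: EE_cmult right_diff_distrib)
      then show ?thesis by (simp only: n2_cmult) (simp add: norm_mult)
    qed
    have "n2 (\<lambda>z. ?U z - EE ?U) \<le> (\<Sum>d\<in>dirs N. n2 (wirt d ?U))"
      by (rule variance_le[OF polyf_cross])
    also have "\<dots> \<le> (\<Sum>d\<in>dirs N. 2 * (real (m-1))\<^sup>2 * n2 (cross N 1 (m - 1 - 1) (k - 1) g h [d] [])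
            + 2 * (real (k-1))\<^sup>2 * n2 (cross N 1 (m - 1) (k - 1 - 1) g h [] [d]))"
      by (intro sum_mono n2_wirt_cross s)
    also have "\<dots> = 2 * (real (m-1))\<^sup>2 * cross_sum N (m - 2) (k - 1) 1 0 1 g h + 2 * (real (k-1))\<^sup>2 * cross_sum N (m - 1) (k - 2) 0 1 1 g h"
      unfolding cross_sum_def One_nat_def sum_dir_lists_Suc
      by (simp add: sum.distrib sum_distrib_left numeral_2_eq_2)
    also have "\<dots> \<le> 2 * (real (m-1))\<^sup>2 * (C1 * B) + 2 * (real (k-1))\<^sup>2 * (C2 * B)"
    proof (intro add_mono)
      show "2 * (real (m-1))\<^sup>2 * cross_sum N (m - 2) (k - 1) 1 0 1 g h \<le> 2 * (real (m-1))\<^sup>2 * (C1 * B)"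
      \<comment> \<open>For \<open>m = 1\<close> both sides are 0 through the factor
        \<open>m - 1\<close>; the truncated difference \<open>m - 2\<close> is then
        harmless.\<close>
      proof (cases "m \<ge> 2")
        case True
        note True = True mk
        have "(\<Sum>t\<le>min (m - 2) (k - 1). contr_norm N (1 + (m - 2) - t) (0 + (k - 1) - t) (1 + t) g h)
            = (\<Sum>r\<in>Suc ` {..min (m - 2) (k - 1)}. contr_norm N (m - r) (k - r) r g h)"
        proof (subst sum.reindex, simp, rule sum.cong[OF refl])
          fix t assume "t \<in> {..min (m - 2) (k - 1)}"
          then have "1 + (m - 2) - t = m - Suc t" "0 + (k - 1) - t = k - Suc t" using True by auto
          then show "contr_norm N (1 + (m - 2) - t) (0 + (k - 1) - t) (1 + t) g h = ((\<lambda>r. contr_norm N (m - r) (k - r) r g h) \<circ> Suc) t"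
            by simp
        qed
        also have "\<dots> \<le> B" unfolding B_def using True
          by (intro sum_mono2 finR contr_norm_nonneg) auto
        finally have "C1 * (\<Sum>t\<le>min (m - 2) (k - 1). contr_norm N (1 + (m - 2) - t) (0 + (k - 1) - t) (1 + t) g h) \<le> C1 * B"
          using C1(1) by (rule mult_left_mono)
        with C1(2)[OF s, of N 1 0 1] have "cross_sum N (m - 2) (k - 1) 1 0 1 g h \<le> C1 * B" by linarith
        then show ?thesis by (intro mult_left_mono) auto
      qed auto
      show "2 * (real (k-1))\<^sup>2 * cross_sum N (m - 1) (k - 2) 0 1 1 g h \<le> 2 * (real (k-1))\<^sup>2 * (C2 * B)"
      proof (cases "k \<ge> 2")
        case True
        note True = True mk
        have "(\<Sum>t\<le>min (m - 1) (k - 2). contr_norm N (0 + (m - 1) - t) (1 + (k - 2) - t) (1 + t) g h)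
            = (\<Sum>r\<in>Suc ` {..min (m - 1) (k - 2)}. contr_norm N (m - r) (k - r) r g h)"
        proof (subst sum.reindex, simp, rule sum.cong[OF refl])
          fix t assume "t \<in> {..min (m - 1) (k - 2)}"
          then have "0 + (m - 1) - t = m - Suc t" "1 + (k - 2) - t = k - Suc t" using True by auto
          then show "contr_norm N (0 + (m - 1) - t) (1 + (k - 2) - t) (1 + t) g h = ((\<lambda>r. contr_norm N (m - r) (k - r) r g h) \<circ> Suc) t"
            by simp
        qed
        also have "\<dots> \<le> B" unfolding B_def using True
          by (intro sum_mono2 finR contr_norm_nonneg) auto
        finally have "C2 * (\<Sum>t\<le>min (m - 1) (k - 2). contr_norm N (0 + (m - 1) - t) (1 + (k - 2) - t) (1 + t) g h) \<le> C2 * B"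
          using C2(1) by (rule mult_left_mono)
        with C2(2)[OF s, of N 0 1 1] have "cross_sum N (m - 1) (k - 2) 0 1 1 g h \<le> C2 * B" by linarith
        then show ?thesis by (intro mult_left_mono) auto
      qed auto
    qed
    finally have "n2 (\<lambda>z. ?U z - EE ?U) \<le> (2 * (real (m-1))\<^sup>2 * C1 + 2 * (real (k-1))\<^sup>2 * C2) * B"
      by (simp add: algebra_simps)
    then have "(real m * real k)\<^sup>2 * n2 (\<lambda>z. ?U z - EE ?U) \<le> C * B"
      unfolding C_def by (simp add: mult.assoc mult_left_mono)
    then show "n2 (\<lambda>z. Gam N (wick_int N m g) (wick_int N k h) z - EE (Gam N (wick_int N m g) (wick_int N k h))) \<le> C * (\<Sum>r\<in>?R. contr_norm N (m - r) (k - r) r g h)"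
      unfolding V B_def .
  qed
qed

text \<open>Squared Hilbert-Schmidt norm of a Gram matrix: \<open>a\<close> slots of
  \<open>g\<close> are contracted with the conjugate kernel, and the \<open>r\<close> slots left
  free on each side index the matrix.\<close>

definition self_contr :: "nat \<Rightarrow> nat \<Rightarrow> nat \<Rightarrow> (dir list \<Rightarrow> complex) \<Rightarrow> real" where
  "self_contr N a r g = (\<Sum>s\<in>dir_lists N r. \<Sum>s'\<in>dir_lists N r. (cmod (\<Sum>x\<in>dir_lists N a. g (x @ s) * cnj (g (x @ s'))))\<^sup>2)"

lemma self_contr_nonneg: "self_contr N a r g \<ge> 0"
  unfolding self_contr_def by (intro sum_nonneg) auto

text \<open>Expanding the square and summing over the free slots leaves the Hilbert-Schmidt pairing
  of two Gram matrices, one for each kernel and both indexed by the contracted slots; Cauchy-Schwarz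
  applies to it. The star in the arguments of \<open>h\<close> is a bijection of the index
  set.\<close>

lemma contr_norm_le:
  "contr_norm N a b r g h \<le> sqrt (self_contr N a r g) * sqrt (self_contr N b r h)"
proof -
  define p where "p = (\<lambda>s s'. \<Sum>x\<in>dir_lists N a. g (x @ s) * cnj (g (x @ s')))"
  define q where "q = (\<lambda>s s'. \<Sum>y\<in>dir_lists N b. h (y @ map star s) * cnj (h (y @ map star s')))"
  have "complex_of_real (contr_norm N a b r g h) = (\<Sum>x\<in>dir_lists N a. \<Sum>y\<in>dir_lists N b. \<Sum>s\<in>dir_lists N r. \<Sum>s'\<in>dir_lists N r.
      (g (x @ s) * cnj (g (x @ s'))) * (h (y @ map star s) * cnj (h (y @ map star s'))))"
    unfolding contr_norm_def of_real_sum complex_norm_square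
    by (simp add: cnj_sum sum_product mult_ac)
  also have "\<dots> = (\<Sum>x\<in>dir_lists N a. \<Sum>s\<in>dir_lists N r. \<Sum>s'\<in>dir_lists N r. \<Sum>y\<in>dir_lists N b. (g (x @ s) * cnj (g (x @ s'))) * (h (y @ map star s) * cnj (h (y @ map star s'))))"
    by (rule sum.cong[OF refl], subst sum.swap, rule sum.cong[OF refl], rule sum.swap)
  also have "\<dots> = (\<Sum>s\<in>dir_lists N r. \<Sum>s'\<in>dir_lists N r. \<Sum>x\<in>dir_lists N a. \<Sum>y\<in>dir_lists N b. (g (x @ s) * cnj (g (x @ s'))) * (h (y @ map star s) * cnj (h (y @ map star s'))))"
    by (subst sum.swap, rule sum.cong[OF refl], rule sum.swap)
  also have "\<dots> = (\<Sum>s\<in>dir_lists N r. \<Sum>s'\<in>dir_lists N r. p s s' * q s s')"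
    unfolding p_def q_def by (simp add: sum_product)
  finally have e: "complex_of_real (contr_norm N a b r g h) = (\<Sum>s\<in>dir_lists N r. \<Sum>s'\<in>dir_lists N r. p s s' * q s s')" .
  have "contr_norm N a b r g h = cmod (\<Sum>s\<in>dir_lists N r. \<Sum>s'\<in>dir_lists N r. p s s' * q s s')"
    unfolding e[symmetric] using contr_norm_nonneg by simp
  also have "\<dots> \<le> (\<Sum>s\<in>dir_lists N r. \<Sum>s'\<in>dir_lists N r. cmod (p s s') * cmod (q s s'))"
    by (intro sum_norm_le) (simp add: norm_mult)
  also have "\<dots> = (\<Sum>t\<in>dir_lists N r \<times> dir_lists N r. \<bar>cmod (p (fst t) (snd t))\<bar> * \<bar>cmod (q (fst t) (snd t))\<bar>)"
    by (simp add: sum.cartesian_product case_prod_beta')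
  also have "\<dots> \<le> L2_set (\<lambda>t. cmod (p (fst t) (snd t))) (dir_lists N r \<times> dir_lists N r) * L2_set (\<lambda>t. cmod (q (fst t) (snd t))) (dir_lists N r \<times> dir_lists N r)"
    by (rule L2_set_mult_ineq)
  also have "L2_set (\<lambda>t. cmod (p (fst t) (snd t))) (dir_lists N r \<times> dir_lists N r) = sqrt (self_contr N a r g)"
    unfolding L2_set_def self_contr_def p_def by (simp add: sum.cartesian_product case_prod_beta')
  also have "L2_set (\<lambda>t. cmod (q (fst t) (snd t))) (dir_lists N r \<times> dir_lists N r) = sqrt (self_contr N b r h)"
  proof -
    have "(\<Sum>t\<in>dir_lists N r \<times> dir_lists N r. (cmod (q (fst t) (snd t)))\<^sup>2) = (\<Sum>s\<in>dir_lists N r. \<Sum>s'\<in>dir_lists N r. (cmod (q s s'))\<^sup>2)"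
      by (simp add: sum.cartesian_product case_prod_beta')
    also have "\<dots> = self_contr N b r h"
      unfolding self_contr_def q_def
      by (subst sum_dir_lists_star[of _ N r, symmetric], rule sum.cong[OF refl], subst sum_dir_lists_star[of _ N r, symmetric], rule refl)
    finally show ?thesis by (simp add: L2_set_def)
  qed
  finally show ?thesis .
qed

section \<open>Characteristic functions of finite chaos sums\<close>

lemma EE_cmod_le:
  assumes F: "smooth F" and E: "smooth E" and b: "\<And>z. cmod (E z) \<le> 1"
  shows "cmod (EE (\<lambda>z. F z * E z)) \<le> sqrt (n2 F)"
proof -
  have i2: "integrable GP (\<lambda>z. (cmod (F z))\<^sup>2)" by (rule smooth_sq_integrable[OF F])
  have i1: "integrable GP (\<lambda>z. cmod (F z))" by (intro integrable_norm smooth_integrable F)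
  have "cmod (EE (\<lambda>z. F z * E z)) \<le> (\<integral>z. cmod (F z * E z) \<partial>GP)"
    unfolding EE_def by (rule integral_norm_bound)
  also have "\<dots> \<le> (\<integral>z. cmod (F z) \<partial>GP)"
    using b by (intro integral_mono i1 integrable_norm smooth_integrable smooth.mult F E)
      (simp add: norm_mult mult_left_le)
  also have "\<dots> \<le> sqrt (n2 F)"
  proof (rule real_le_rsqrt)
    have "0 \<le> GP.variance (\<lambda>z. cmod (F z))" by (rule GP.variance_positive)
    then show "(\<integral>z. cmod (F z) \<partial>GP)\<^sup>2 \<le> n2 F"
      using GP.variance_eq[OF i1 i2] by (simp add: n2_def)
  qed
  finally show ?thesis .
qed

text \<open>The first-order expansion of \<open>iexp\<close> has a remainder of at most half the
  square of \<open>h * R\<close>, so the difference quotient lies within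
  \<open>|h| * n2 R / 2\<close> of the asserted derivative.\<close>

lemma cf_derivative:
  assumes R: "smooth R" and real: "\<And>z. R z \<in> \<real>"
  shows "((\<lambda>s. EE (\<lambda>z. exp (\<i> * (of_real s * R z)))) has_vector_derivative
     \<i> * EE (\<lambda>z. R z * exp (\<i> * (of_real s * R z)))) (at s)"
proof -
  define e where "e = (\<lambda>s::real. \<lambda>z. exp (\<i> * (of_real s * R z)))"
  have sR: "smooth (\<lambda>z. of_real t * R z)" for t by (rule smooth_cmult[OF R])
  have se: "smooth (e t)" for t
    unfolding e_def using real by (intro smooth.exp sR) auto
  have le: "cmod (EE (e (s + h)) - EE (e s) - of_real h * (\<i> * EE (\<lambda>z. R z * e s z))) \<le> h\<^sup>2 * n2 R / 2" for h
  proof -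
    have "EE (e (s + h)) - EE (e s) - of_real h * (\<i> * EE (\<lambda>z. R z * e s z))
        = EE (\<lambda>z. e (s + h) z - e s z - of_real h * (\<i> * (R z * e s z)))"
      using se R by (simp add: EE_diff EE_cmult smooth_diff smooth_cmult smooth.mult)
    also have "cmod \<dots> \<le> (\<integral>z. cmod (e (s + h) z - e s z - of_real h * (\<i> * (R z * e s z))) \<partial>GP)"
      unfolding EE_def by (rule integral_norm_bound)
    also have "\<dots> \<le> (\<integral>z. h\<^sup>2 / 2 * (cmod (R z))\<^sup>2 \<partial>GP)"
    proof (rule integral_mono)
      show "integrable GP (\<lambda>z. cmod (e (s + h) z - e s z - of_real h * (\<i> * (R z * e s z))))"
        using se R by (intro integrable_norm smooth_integrable smooth_diff smooth_cmult smooth.mult) auto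
      show "integrable GP (\<lambda>z. h\<^sup>2 / 2 * (cmod (R z))\<^sup>2)"
        by (intro integrable_mult_right smooth_sq_integrable R)
      fix z
      obtain r where r: "R z = of_real r" using real[of z] by (elim Reals_cases)
      have "e (s + h) z - e s z - of_real h * (\<i> * (R z * e s z)) = exp (\<i> * of_real (s * r)) * (iexp (h * r) - (\<Sum>k\<le>1. (\<i> * of_real (h * r))^k / fact k))"
        unfolding e_def r by (simp add: distrib_right distrib_left exp_add algebra_simps)
      also have "cmod \<dots> = cmod (iexp (h * r) - (\<Sum>k\<le>1. (\<i> * of_real (h * r))^k / fact k))"
        by (simp add: norm_mult)
      also have "\<dots> \<le> \<bar>h * r\<bar>^(Suc 1) / fact (Suc 1)" by (rule iexp_approx1)
      also have "\<dots> = h\<^sup>2 / 2 * (cmod (R z))\<^sup>2"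
        by (simp add: r numeral_2_eq_2[symmetric] power_mult_distrib power2_abs abs_mult fact_numeral)
      finally show "cmod (e (s + h) z - e s z - of_real h * (\<i> * (R z * e s z))) \<le> h\<^sup>2 / 2 * (cmod (R z))\<^sup>2" .
    qed
    also have "\<dots> = h\<^sup>2 * n2 R / 2" by (simp add: n2_def)
    finally show ?thesis .
  qed
  have "((\<lambda>h. norm (EE (e (s + h)) - EE (e s) - h *\<^sub>R (\<i> * EE (\<lambda>z. R z * e s z))) / norm h) \<longlongrightarrow> 0) (at 0)"
  proof (rule Lim_null_comparison)
    show "\<forall>\<^sub>F h in at 0. norm (norm (EE (e (s + h)) - EE (e s) - h *\<^sub>R (\<i> * EE (\<lambda>z. R z * e s z))) / norm h) \<le> \<bar>h\<bar> * n2 R / 2"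
    proof (rule eventually_at_filter[THEN iffD2], rule always_eventually, intro allI impI)
      fix h :: real assume "h \<noteq> 0"
      then show "norm (norm (EE (e (s + h)) - EE (e s) - h *\<^sub>R (\<i> * EE (\<lambda>z. R z * e s z))) / norm h) \<le> \<bar>h\<bar> * n2 R / 2"
        using le[of h] by (simp add: scaleR_conv_of_real divide_le_eq power2_eq_square abs_mult_self_eq mult_ac)
    qed
    show "((\<lambda>h. \<bar>h\<bar> * n2 R / 2) \<longlongrightarrow> 0) (at (0::real))"
      by (auto intro!: tendsto_eq_intros)
  qed
  then show ?thesis
    unfolding has_vector_derivative_def has_derivative_at e_def
    by (auto intro: bounded_linear_scaleR_left)
qed

text \<open>With \<open>v = n2 R\<close> the characteristic function solves
  \<open>\<phi>' = - s (v \<phi> + err)\<close>. The integrating factor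
  \<open>exp (v s^2 / 2)\<close> removes the Gaussian part, and integration over the unit interval
  costs at most \<open>exp (v / 2)\<close> times the bound of \<open>err\<close>; multiplying back
  by \<open>exp (- v / 2)\<close> cancels this factor.\<close>

lemma cf_gaussian_bound:
  assumes Y: "\<And>j. j \<in> J \<Longrightarrow> eig N (m j) (Y j)" and m: "\<And>j. j \<in> J \<Longrightarrow> m j \<ge> 1"
    and real: "\<And>z. (\<Sum>j\<in>J. Y j z) \<in> \<real>"
  defines "R \<equiv> \<lambda>z. \<Sum>j\<in>J. Y j z"
  shows "cmod (EE (\<lambda>z. exp (\<i> * R z)) - of_real (exp (- n2 R / 2)))
     \<le> (\<Sum>j\<in>J. \<Sum>k\<in>J. sqrt (n2 (\<lambda>z. Gam N (Y j) (Y k) z - EE (Gam N (Y j) (Y k)))))"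
proof -
  define V where "V = (\<lambda>j k. n2 (\<lambda>z. Gam N (Y j) (Y k) z - EE (Gam N (Y j) (Y k))))"
  define \<delta> where "\<delta> = (\<Sum>j\<in>J. \<Sum>k\<in>J. sqrt (V j k))"
  define e where "e = (\<lambda>s::real. \<lambda>z. exp (\<i> * (of_real s * R z)))"
  define \<phi> where "\<phi> = (\<lambda>s. EE (e s))"
  define v where "v = n2 R"
  have sY: "smooth (Y j)" if "j \<in> J" for j using Y[OF that] by (rule eig_smooth)
  have sR: "smooth R" unfolding R_def by (intro smooth_sum sY)
  have Rr: "R z \<in> \<real>" for z using real by (simp add: R_def)
  have se: "smooth (e t)" for t
    unfolding e_def using Rr by (intro smooth.exp smooth_cmult sR) auto
  have e1: "cmod (e t z) \<le> 1" for t z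
    using Rr[of z] by (auto simp: e_def elim!: Reals_cases)
  have d0: "\<delta> \<ge> 0" unfolding \<delta>_def V_def by (intro sum_nonneg) auto
  have v: "EE (\<lambda>z. R z * R z) = of_real v"
    unfolding v_def n2_EE[symmetric] using Rr by (simp add: Reals_cnj_iff)
  have \<phi>d: "(\<phi> has_vector_derivative \<i> * EE (\<lambda>z. R z * e s z)) (at s)" for s
    unfolding \<phi>_def e_def by (rule cf_derivative[OF sR Rr])
  \<comment> \<open>The weight \<open>1 / m j\<close> comes from solving the eigenvalue equation for
    \<open>Y j\<close>. \<open>Gam\<close> is centred by its mean, which is \<open>m j\<close> times
    the expectation of \<open>Y j * Y k\<close>; after division these means add up to
    \<open>v\<close>.\<close>
  define err where "err = (\<lambda>s. \<Sum>j\<in>J. \<Sum>k\<in>J. (1 / of_nat (m j)) * EE (\<lambda>z. (Gam N (Y j) (Y k) z - EE (Gam N (Y j) (Y k))) * e s z))"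
  have key: "\<i> * EE (\<lambda>z. R z * e s z) = - of_real s * (err s + of_real v * \<phi> s)" for s
  proof -
    have De: "wirt d (e s) = (\<lambda>z. \<Sum>k\<in>J. (\<i> * of_real s) * (wirt d (Y k) z * e s z))" for d
    proof -
      have "wirt d (e s) = (\<lambda>z. \<i> * (of_real s * wirt d R z * e s z))"
        unfolding e_def wirt_exp[OF smooth_cmult[OF sR]] wirt_cmult[OF sR] ..
      moreover have "wirt d R = (\<lambda>z. \<Sum>k\<in>J. wirt d (Y k) z)"
        unfolding R_def by (intro wirt_sum sY)
      ultimately show ?thesis by (simp add: sum_distrib_left sum_distrib_right mult.assoc)
    qed
    have Yj: "EE (\<lambda>z. Y j z * e s z) = (\<i> * of_real s) * (\<Sum>k\<in>J. (1 / of_nat (m j)) * EE (\<lambda>z. (Gam N (Y j) (Y k) z - EE (Gam N (Y j) (Y k))) * e s z)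
           + EE (\<lambda>z. Y j z * Y k z) * \<phi> s)" if j: "j \<in> J" for j
    proof -
      have sg: "smooth (Gam N (Y j) (Y k))" if "k \<in> J" for k by (intro smooth_Gam sY j that)
      have "of_nat (m j) * EE (\<lambda>z. Y j z * e s z) = (\<Sum>d\<in>dirs N. EE (\<lambda>z. wirt d (Y j) z * wirt (star d) (e s) z))"
        by (rule eigD[OF Y[OF j] se])
      also have "\<dots> = (\<Sum>d\<in>dirs N. EE (\<lambda>z. \<Sum>k\<in>J. (\<i> * of_real s) * (wirt d (Y j) z * wirt (star d) (Y k) z * e s z)))"
        by (simp add: De sum_distrib_left mult_ac)
      also have "\<dots> = (\<Sum>d\<in>dirs N. \<Sum>k\<in>J. (\<i> * of_real s) * EE (\<lambda>z. wirt d (Y j) z * wirt (star d) (Y k) z * e s z))"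
        by (intro sum.cong[OF refl]) (subst EE_sum, auto simp: EE_cmult intro!: smooth_cmult smooth.mult smooth_wirt sY j se)
      also have "\<dots> = (\<Sum>k\<in>J. (\<i> * of_real s) * (\<Sum>d\<in>dirs N. EE (\<lambda>z. wirt d (Y j) z * wirt (star d) (Y k) z * e s z)))"
        by (subst sum.swap) (simp add: sum_distrib_left)
      also have "\<dots> = (\<Sum>k\<in>J. (\<i> * of_real s) * EE (\<lambda>z. Gam N (Y j) (Y k) z * e s z))"
      proof (rule sum.cong[OF refl])
        fix k assume k: "k \<in> J"
        have "EE (\<lambda>z. Gam N (Y j) (Y k) z * e s z) = EE (\<lambda>z. \<Sum>d\<in>dirs N. wirt d (Y j) z * wirt (star d) (Y k) z * e s z)"
          by (simp add: Gam_def sum_distrib_right)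
        also have "\<dots> = (\<Sum>d\<in>dirs N. EE (\<lambda>z. wirt d (Y j) z * wirt (star d) (Y k) z * e s z))"
          by (intro EE_sum smooth.mult smooth_wirt sY j k se)
        finally show "(\<i> * of_real s) * (\<Sum>d\<in>dirs N. EE (\<lambda>z. wirt d (Y j) z * wirt (star d) (Y k) z * e s z)) = (\<i> * of_real s) * EE (\<lambda>z. Gam N (Y j) (Y k) z * e s z)"
          by simp
      qed
      also have "\<dots> = (\<i> * of_real s) * (\<Sum>k\<in>J. EE (\<lambda>z. (Gam N (Y j) (Y k) z - EE (Gam N (Y j) (Y k))) * e s z)
           + of_nat (m j) * EE (\<lambda>z. Y j z * Y k z) * \<phi> s)"
      proof -
        have "EE (\<lambda>z. Gam N (Y j) (Y k) z * e s z) = EE (\<lambda>z. (Gam N (Y j) (Y k) z - EE (Gam N (Y j) (Y k))) * e s z)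
           + of_nat (m j) * EE (\<lambda>z. Y j z * Y k z) * \<phi> s" if k: "k \<in> J" for k
        proof -
          have "EE (\<lambda>z. (Gam N (Y j) (Y k) z - EE (Gam N (Y j) (Y k))) * e s z)
              = EE (\<lambda>z. Gam N (Y j) (Y k) z * e s z - EE (Gam N (Y j) (Y k)) * e s z)"
            by (simp add: left_diff_distrib)
          also have "\<dots> = EE (\<lambda>z. Gam N (Y j) (Y k) z * e s z) - EE (Gam N (Y j) (Y k)) * \<phi> s"
            unfolding \<phi>_def by (subst EE_diff) (auto simp: EE_cmult intro!: smooth.mult smooth_cmult sg k se)
          finally show ?thesis by (simp add: eig_Gam[OF Y[OF j] sY[OF k]])
        qed
        then show ?thesis by (simp add: sum_distrib_left)
      qed
      finally have "EE (\<lambda>z. Y j z * e s z) = (\<i> * of_real s) * (\<Sum>k\<in>J. EE (\<lambda>z. (Gam N (Y j) (Y k) z - EE (Gam N (Y j) (Y k))) * e s z)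
           + of_nat (m j) * EE (\<lambda>z. Y j z * Y k z) * \<phi> s) / of_nat (m j)"
        using m[OF j] by (simp add: field_simps)
      also have "\<dots> = (\<i> * of_real s) * (\<Sum>k\<in>J. (1 / of_nat (m j)) * EE (\<lambda>z. (Gam N (Y j) (Y k) z - EE (Gam N (Y j) (Y k))) * e s z)
           + EE (\<lambda>z. Y j z * Y k z) * \<phi> s)"
        unfolding times_divide_eq_right[symmetric] sum_divide_distrib add_divide_distrib
        using m[OF j] by simp
      finally show ?thesis .
    qed
    have "EE (\<lambda>z. R z * e s z) = (\<Sum>j\<in>J. EE (\<lambda>z. Y j z * e s z))"
      unfolding R_def by (simp add: sum_distrib_right EE_sum smooth.mult sY se)
    also have "\<dots> = (\<i> * of_real s) * (err s + (\<Sum>j\<in>J. \<Sum>k\<in>J. EE (\<lambda>z. Y j z * Y k z)) * \<phi> s)"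
      by (simp add: Yj err_def sum.distrib sum_distrib_left sum_distrib_right distrib_left)
    also have "(\<Sum>j\<in>J. \<Sum>k\<in>J. EE (\<lambda>z. Y j z * Y k z)) = of_real v"
      unfolding v[symmetric] R_def by (simp add: sum_product EE_sum smooth_sum smooth.mult sY)
    finally show ?thesis by (simp add: algebra_simps)
  qed
  have errb: "cmod (err s) \<le> \<delta>" for s
  proof -
    have "cmod (err s) \<le> (\<Sum>j\<in>J. \<Sum>k\<in>J. cmod ((1 / of_nat (m j)) * EE (\<lambda>z. (Gam N (Y j) (Y k) z - EE (Gam N (Y j) (Y k))) * e s z)))"
      unfolding err_def by (rule order_trans[OF norm_sum]) (intro sum_mono norm_sum)
    also have "\<dots> \<le> \<delta>" unfolding \<delta>_def
    proof (intro sum_mono)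
      fix j k assume jk: "j \<in> J" "k \<in> J"
      have "cmod (EE (\<lambda>z. (Gam N (Y j) (Y k) z - EE (Gam N (Y j) (Y k))) * e s z)) \<le> sqrt (V j k)"
        unfolding V_def by (intro EE_cmod_le smooth_diff smooth_Gam sY jk smooth.const se e1)
      moreover have "1 / real (m j) \<le> 1" "0 \<le> 1 / real (m j)" using m[OF jk(1)] by auto
      ultimately have "1 / real (m j) * cmod (EE (\<lambda>z. (Gam N (Y j) (Y k) z - EE (Gam N (Y j) (Y k))) * e s z)) \<le> 1 * sqrt (V j k)"
        by (intro mult_mono) auto
      then show "cmod ((1 / of_nat (m j)) * EE (\<lambda>z. (Gam N (Y j) (Y k) z - EE (Gam N (Y j) (Y k))) * e s z)) \<le> sqrt (V j k)"
        by (simp add: norm_mult norm_divide)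
    qed
    finally show ?thesis .
  qed
  have v0: "v \<ge> 0" by (simp add: v_def)
  define \<psi> where "\<psi> = (\<lambda>s. of_real (exp (v * s\<^sup>2 / 2)) * \<phi> s)"
  have \<psi>d: "(\<psi> has_vector_derivative - of_real (s * exp (v * s\<^sup>2 / 2)) * err s) (at s)" for s
  proof -
    have "((\<lambda>s. exp (v * s\<^sup>2 / 2)) has_real_derivative (v * s * exp (v * s\<^sup>2 / 2))) (at s)"
      by (auto intro!: derivative_eq_intros)
    from has_vector_derivative_mult[OF has_vector_derivative_of_real[OF this] \<phi>d[of s]]
    show ?thesis unfolding \<psi>_def key by (simp add: algebra_simps)
  qed
  have "norm (\<psi> 1 - \<psi> 0) \<le> (exp (v / 2) * \<delta>) * norm (1 - (0::real))"
  proof (rule differentiable_bound[where S="{0..1}" and f'="\<lambda>s h. h *\<^sub>R (- of_real (s * exp (v * s\<^sup>2 / 2)) * err s)"])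
    fix s :: real assume s: "s \<in> {0..1}"
    show "(\<psi> has_derivative (\<lambda>h. h *\<^sub>R (- of_real (s * exp (v * s\<^sup>2 / 2)) * err s))) (at s within {0..1})"
      using \<psi>d[of s] unfolding has_vector_derivative_def by (rule has_derivative_at_withinI)
    have "s\<^sup>2 \<le> 1" using s by (simp add: power_le_one)
    then have "v * s\<^sup>2 \<le> v" using v0 by (simp add: mult_left_le)
    then have "exp (v * s\<^sup>2 / 2) \<le> exp (v / 2)" by simp
    then have "s * exp (v * s\<^sup>2 / 2) \<le> 1 * exp (v / 2)" using s by (intro mult_mono) auto
    then have b: "\<bar>s * exp (v * s\<^sup>2 / 2)\<bar> * cmod (err s) \<le> exp (v / 2) * \<delta>"
      using s d0 errb[of s] by (intro mult_mono) auto
    show "onorm (\<lambda>h. h *\<^sub>R (- of_real (s * exp (v * s\<^sup>2 / 2)) * err s)) \<le> exp (v / 2) * \<delta>"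
    proof (rule onorm_le)
      fix h :: real
      have "norm (h *\<^sub>R (- of_real (s * exp (v * s\<^sup>2 / 2)) * err s)) = (\<bar>s * exp (v * s\<^sup>2 / 2)\<bar> * cmod (err s)) * norm h"
        by (simp only: norm_scaleR norm_mult norm_minus_cancel norm_of_real real_norm_def mult.commute)
      also have "\<dots> \<le> exp (v / 2) * \<delta> * norm h" by (intro mult_right_mono b) auto
      finally show "norm (h *\<^sub>R (- of_real (s * exp (v * s\<^sup>2 / 2)) * err s)) \<le> exp (v / 2) * \<delta> * norm h" .
    qed
  qed auto
  moreover have "\<psi> 0 = 1" by (simp add: \<psi>_def \<phi>_def e_def)
  ultimately have b: "cmod (of_real (exp (v / 2)) * \<phi> 1 - 1) \<le> exp (v / 2) * \<delta>" by (simp add: \<psi>_def)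
  have "\<phi> 1 - of_real (exp (- v / 2)) = of_real (exp (- v / 2)) * (of_real (exp (v / 2)) * \<phi> 1 - 1)"
    by (simp add: right_diff_distrib mult.assoc[symmetric] of_real_mult[symmetric] exp_add[symmetric] del: of_real_mult)
  then have "cmod (\<phi> 1 - of_real (exp (- v / 2))) = exp (- v / 2) * cmod (of_real (exp (v / 2)) * \<phi> 1 - 1)"
    by (simp add: norm_mult)
  also have "\<dots> \<le> exp (- v / 2) * (exp (v / 2) * \<delta>)" using b by (intro mult_left_mono) auto
  also have "\<dots> = \<delta>" by (simp add: mult.assoc[symmetric] exp_add[symmetric])
  finally show ?thesis unfolding \<phi>_def e_def v_def \<delta>_def V_def by simp
qed

section \<open>Complex Hermite polynomials\<close>

text \<open>Ito's normalisation of the complex Hermite polynomials, orthogonal for \<open>E\<bar>z\<bar>\<^sup>2 = 1\<close>.\<close>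

definition itoH :: "nat \<Rightarrow> nat \<Rightarrow> complex \<Rightarrow> complex" where
  "itoH p q z = (\<Sum>k\<le>min p q. (-1) ^ k * of_nat ((p choose k) * (q choose k) * fact k) * z ^ (p - k) * cnj z ^ (q - k))"

text \<open>The binomial coefficients annihilate the additional terms. A common upper limit lets the
  sums in the recurrences be compared term by term.\<close>

lemma itoH_ge:
  assumes "n \<ge> min p q"
  shows "itoH p q z = (\<Sum>k\<le>n. (-1) ^ k * of_nat ((p choose k) * (q choose k) * fact k) * z ^ (p - k) * cnj z ^ (q - k))"
  unfolding itoH_def
proof (rule sum.mono_neutral_left)
  show "\<forall>k\<in>{..n} - {..min p q}. (-1) ^ k * of_nat ((p choose k) * (q choose k) * fact k) * z ^ (p - k) * cnj z ^ (q - k) = 0"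
  proof
    fix k assume "k \<in> {..n} - {..min p q}"
    then have "p < k \<or> q < k" by auto
    then show "(-1) ^ k * of_nat ((p choose k) * (q choose k) * fact k) * z ^ (p - k) * cnj z ^ (q - k) = 0"
      by (auto simp: binomial_eq_0)
  qed
qed (use assms in auto)

lemma itoH_cnj: "cnj (itoH p q z) = itoH q p z"
  unfolding itoH_def by (simp add: cnj_sum min.commute mult_ac)

text \<open>Pascal's rule for \<open>Suc p choose k\<close> splits the sum: one part is
  \<open>z\<close> times the old polynomial, the other becomes, after a shift of the index and
  absorption of \<open>Suc k\<close> into the binomial coefficient, \<open>q\<close> times the
  polynomial with lowered index. Multiplication minus lowering is the action of a creation
  operator.\<close>

lemma itoH_Suc: "itoH (Suc p) q z = z * itoH p q z - of_nat q * itoH p (q - 1) z"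
proof -
  let ?c = "\<lambda>k. (-1) ^ k * of_nat ((p choose k) * (q choose k) * fact k) * z ^ (Suc p - k) * cnj z ^ (q - k)"
  let ?d = "\<lambda>k. (-1) ^ Suc k * of_nat ((p choose k) * (q choose Suc k) * fact (Suc k)) * z ^ (p - k) * cnj z ^ (q - Suc k)"
  have e1: "itoH p q z = (\<Sum>k\<le>Suc (p + q). (-1) ^ k * of_nat ((p choose k) * (q choose k) * fact k) * z ^ (p - k) * cnj z ^ (q - k))"
    by (rule itoH_ge) simp
  have e2: "itoH p (q - 1) z = (\<Sum>k\<le>p + q. (-1) ^ k * of_nat ((p choose k) * (q - 1 choose k) * fact k) * z ^ (p - k) * cnj z ^ (q - 1 - k))"
    by (rule itoH_ge) simp
  have "itoH (Suc p) q z = (\<Sum>k\<le>Suc (p + q). (-1) ^ k * of_nat ((Suc p choose k) * (q choose k) * fact k) * z ^ (Suc p - k) * cnj z ^ (q - k))"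
    by (rule itoH_ge) simp
  also have "\<dots> = z ^ Suc p * cnj z ^ q + (\<Sum>k\<le>p + q. ?c (Suc k) + ?d k)"
    by (subst sum.atMost_Suc_shift) (simp add: algebra_simps)
  also have "\<dots> = (\<Sum>k\<le>Suc (p + q). ?c k) + (\<Sum>k\<le>p + q. ?d k)"
    by (subst sum.atMost_Suc_shift[of ?c]) (simp add: sum.distrib sum_subtractf sum_negf)
  also have "(\<Sum>k\<le>Suc (p + q). ?c k) = z * itoH p q z"
    unfolding e1 sum_distrib_left
  proof (rule sum.cong[OF refl])
    fix k
    show "?c k = z * ((-1) ^ k * of_nat ((p choose k) * (q choose k) * fact k) * z ^ (p - k) * cnj z ^ (q - k))"
      by (cases "k \<le> p") (simp_all add: Suc_diff_le binomial_eq_0)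
  qed
  also have "(\<Sum>k\<le>p + q. ?d k) = - (of_nat q * itoH p (q - 1) z)"
    unfolding e2 sum_distrib_left sum_negf[symmetric]
  proof (rule sum.cong[OF refl])
    fix k
    have "(q choose Suc k) * fact (Suc k) = q * ((q - 1) choose k) * fact k"
    proof -
      have "(q choose Suc k) * fact (Suc k) = (Suc k * (q choose Suc k)) * fact k"
        unfolding fact_Suc of_nat_id by (simp only: mult_ac)
      then show ?thesis unfolding binomial_absorption .
    qed
    then have e: "(p choose k) * (q choose Suc k) * fact (Suc k) = q * ((p choose k) * ((q - 1) choose k) * fact k)"
      by (simp add: mult_ac)
    show "?d k = - (of_nat q * ((-1) ^ k * of_nat ((p choose k) * (q - 1 choose k) * fact k) * z ^ (p - k) * cnj z ^ (q - 1 - k)))"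
      unfolding e by (simp add: mult_ac)
  qed
  finally show ?thesis by simp
qed

lemma itoH_Suc2: "itoH p (Suc q) z = cnj z * itoH p q z - of_nat p * itoH (p - 1) q z"
proof -
  have "cnj (itoH (Suc q) p z) = cnj (z * itoH q p z - of_nat p * itoH q (p - 1) z)"
    by (simp only: itoH_Suc)
  then show ?thesis by (simp add: itoH_cnj)
qed

lemma itoH_0: "itoH 0 q z = cnj z ^ q"
  by (simp add: itoH_def)

lemma itoH_has_derivative:
  "((\<lambda>w. itoH p q w) has_derivative (\<lambda>h. (of_nat p * itoH (p - 1) q w) * h + (of_nat q * itoH p (q - 1) w) * cnj h)) (at w)"
proof (induction p arbitrary: q)
  case 0
  have "((\<lambda>w. cnj w ^ q) has_derivative (\<lambda>h. of_nat q * cnj h * cnj w ^ (q - 1))) (at w)"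
    by (rule has_derivative_power[OF bounded_linear_imp_has_derivative[OF bounded_linear_cnj]])
  then show ?case by (simp add: itoH_0 mult_ac)
next
  case (Suc p)
  have 1: "((\<lambda>w. w * itoH p q w) has_derivative
     (\<lambda>h. w * ((of_nat p * itoH (p - 1) q w) * h + (of_nat q * itoH p (q - 1) w) * cnj h) + h * itoH p q w)) (at w)"
    by (rule has_derivative_mult[OF has_derivative_ident Suc.IH])
  have 2: "((\<lambda>w. of_nat q * itoH p (q - 1) w) has_derivative
     (\<lambda>h. of_nat q * ((of_nat p * itoH (p - 1) (q - 1) w) * h + (of_nat (q - 1) * itoH p (q - 1 - 1) w) * cnj h))) (at w)"
    by (rule has_derivative_mult_right[OF Suc.IH])
  have 3: "of_nat q * itoH (Suc p) (q - 1) w = of_nat q * (w * itoH p (q - 1) w) - of_nat q * (of_nat (q - 1) * itoH p (q - 1 - 1) w)"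
    by (simp only: itoH_Suc right_diff_distrib)
  have 4: "of_nat p * itoH p q w = of_nat p * (w * itoH (p - 1) q w) - of_nat p * (of_nat q * itoH (p - 1) (q - 1) w)"
    by (cases p) (simp_all only: itoH_Suc right_diff_distrib diff_Suc_1 of_nat_0 mult_zero_left diff_self)
  have "(\<lambda>h. (w * ((of_nat p * itoH (p - 1) q w) * h + (of_nat q * itoH p (q - 1) w) * cnj h) + h * itoH p q w)
       - of_nat q * ((of_nat p * itoH (p - 1) (q - 1) w) * h + (of_nat (q - 1) * itoH p (q - 1 - 1) w) * cnj h))
     = (\<lambda>h. (of_nat (Suc p) * itoH (Suc p - 1) q w) * h + (of_nat q * itoH (Suc p) (q - 1) w) * cnj h)"
  proof (rule ext)
    fix h
    have a: "w * (P * a * h + Q * b * ch) + h * x - Q * (P * c * h + Q' * d * ch) = (P + 1) * x * h + Q * e * ch"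
      if "P * x = P * (w * a) - P * (Q * c)" "Q * e = Q * (w * b) - Q * (Q' * d)" for P Q Q' a b c d e x ch :: complex
    proof -
      have "w * (P * a * h + Q * b * ch) + h * x - Q * (P * c * h + Q' * d * ch)
          = (P * (w * a) - P * (Q * c)) * h + x * h + (Q * (w * b) - Q * (Q' * d)) * ch"
        by (simp add: algebra_simps)
      then show ?thesis unfolding that[symmetric] by (simp add: algebra_simps)
    qed
    show "(w * ((of_nat p * itoH (p - 1) q w) * h + (of_nat q * itoH p (q - 1) w) * cnj h) + h * itoH p q w)
       - of_nat q * ((of_nat p * itoH (p - 1) (q - 1) w) * h + (of_nat (q - 1) * itoH p (q - 1 - 1) w) * cnj h)
      = (of_nat (Suc p) * itoH (Suc p - 1) q w) * h + (of_nat q * itoH (Suc p) (q - 1) w) * cnj h"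
      using a[OF 4 3, of "cnj h"] by (simp add: add.commute)
  qed
  with has_derivative_diff[OF 1 2] show ?case by (simp only: itoH_Suc)
qed

text \<open>Scaling the argument by \<open>sqrt 2\<close> yields the power
  \<open>(p + q) / 2 - k\<close> of 2 and the coefficient of \<open>cHermite\<close> the power
  \<open>k\<close>; their product cancels the prefactor for every \<open>k\<close>.\<close>

lemma itoH_cHermite:
  "of_real (2 powr (- real (p + q) / 2)) * cHermite p q (of_real (sqrt 2) * z) = itoH p q z"
  unfolding cHermite_def itoH_def sum_distrib_left
proof (rule sum.cong[OF refl])
  fix k assume "k \<in> {..min p q}"
  then have k: "k \<le> p" "k \<le> q" by auto
  have alg: "creation * B / (c * d * e) = (creation / (e * c)) * (B / (e * d)) * e" if "e \<noteq> 0" for creation B c d e :: real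
    using that by simp
  have b: "(fact p * fact q / (fact (p - k) * fact (q - k) * fact k) :: real) = real ((p choose k) * (q choose k) * fact k)"
    unfolding of_nat_mult binomial_fact[OF k(1)] binomial_fact[OF k(2)] of_nat_fact by (rule alg) simp
  have s: "sqrt 2 ^ n = 2 powr (real n / 2)" for n
  proof -
    have "sqrt 2 ^ n = (2 powr (1/2)) powr real n" by (simp add: powr_realpow powr_half_sqrt)
    then show ?thesis by (simp add: powr_powr)
  qed
  have s2: "2 ^ k = 2 powr real k" by (simp add: powr_realpow)
  have "2 powr (- real (p + q) / 2) * (2 ^ k * sqrt 2 ^ (p - k) * sqrt 2 ^ (q - k))
      = 2 powr (- real (p + q) / 2 + (real k + real (p - k) / 2 + real (q - k) / 2))"
    unfolding s s2 by (simp only: powr_add)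
  also have "- real (p + q) / 2 + (real k + real (p - k) / 2 + real (q - k) / 2) = 0"
    using k by (simp add: of_nat_diff add_divide_distrib diff_divide_distrib)
  finally have "complex_of_real (2 powr (- real (p + q) / 2) * (2 ^ k * sqrt 2 ^ (p - k) * sqrt 2 ^ (q - k))) = of_real 1" by simp
  then have e: "complex_of_real (2 powr (- real (p + q) / 2)) * (2 ^ k * of_real (sqrt 2) ^ (p - k) * of_real (sqrt 2) ^ (q - k)) = 1"
    by (simp only: of_real_mult of_real_power of_real_numeral of_real_1)
  have m: "(-2 :: real) ^ k = (-1) ^ k * 2 ^ k" by (rule power_minus)
  have alg2: "r * (c * (s * t) * (u * v) * (x * y)) = (r * (t * u * x)) * (s * c * v * y)" for r c s t u v x y :: complex
    by (simp only: mult_ac)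
  have "complex_of_real (2 powr (- real (p + q) / 2)) *
      (of_real (fact p * fact q / (fact (p - k) * fact (q - k) * fact k) * (-2) ^ k) * (of_real (sqrt 2) * z) ^ (p - k) * cnj (of_real (sqrt 2) * z) ^ (q - k))
     = (complex_of_real (2 powr (- real (p + q) / 2)) * (2 ^ k * of_real (sqrt 2) ^ (p - k) * of_real (sqrt 2) ^ (q - k)))
       * ((-1) ^ k * of_nat ((p choose k) * (q choose k) * fact k) * z ^ (p - k) * cnj z ^ (q - k))"
    unfolding b m complex_cnj_mult complex_cnj_complex_of_real power_mult_distrib of_real_mult of_real_power of_real_minus of_real_1 of_real_numeral of_real_of_nat_eq
    by (rule alg2)
  also have "\<dots> = (-1) ^ k * of_nat ((p choose k) * (q choose k) * fact k) * z ^ (p - k) * cnj z ^ (q - k)"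
    unfolding e by (rule mult_1)
  finally show "complex_of_real (2 powr (- real (p + q) / 2)) *
      (of_real (fact p * fact q / (fact (p - k) * fact (q - k) * fact k) * (-2) ^ k) * (of_real (sqrt 2) * z) ^ (p - k) * cnj (of_real (sqrt 2) * z) ^ (q - k))
     = (-1) ^ k * of_nat ((p choose k) * (q choose k) * fact k) * z ^ (p - k) * cnj z ^ (q - k)" .
qed

definition hermite_prod :: "nat \<Rightarrow> (nat \<Rightarrow> nat) \<Rightarrow> (nat \<Rightarrow> nat) \<Rightarrow> gfun" where
  "hermite_prod N a b z = (\<Prod>j<N. itoH (a j) (b j) (z j))"

lemma hermite_prod_split:
  assumes "k < N"
  shows "hermite_prod N a b z = itoH (a k) (b k) (z k) * (\<Prod>j\<in>{..<N} - {k}. itoH (a j) (b j) (z j))"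
  unfolding hermite_prod_def using assms by (intro prod.remove) auto

lemma wirt_hermite_prod:
  assumes k: "k < N"
  shows "wirt (k, False) (hermite_prod N a b) z = of_nat (a k) * hermite_prod N (a(k := a k - 1)) b z"
    and "wirt (k, True) (hermite_prod N a b) z = of_nat (b k) * hermite_prod N a (b(k := b k - 1)) z"
proof -
  define P where "P = (\<Prod>j\<in>{..<N} - {k}. itoH (a j) (b j) (z j))"
  have e: "hermite_prod N a' b' (z(k := w)) = itoH (a' k) (b' k) w * P"
    if "\<And>j. j \<noteq> k \<Longrightarrow> a' j = a j" "\<And>j. j \<noteq> k \<Longrightarrow> b' j = b j" for a' b' w
    using that unfolding hermite_prod_split[OF k] P_def by (auto intro!: prod.cong)
  have "((\<lambda>w. itoH (a k) (b k) w * P) has_derivative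
     (\<lambda>h. (of_nat (a k) * itoH (a k - 1) (b k) (z k) * P) * h + (of_nat (b k) * itoH (a k) (b k - 1) (z k) * P) * cnj h)) (at (z k))"
    using has_derivative_mult_left[OF itoH_has_derivative[of "a k" "b k" "z k"], of P]
    by (simp add: algebra_simps)
  then have h: "((\<lambda>w. hermite_prod N a b (z(k := w))) has_derivative
     (\<lambda>h. (of_nat (a k) * itoH (a k - 1) (b k) (z k) * P) * h + (of_nat (b k) * itoH (a k) (b k - 1) (z k) * P) * cnj h)) (at (z k))"
    by (simp add: e[of a b])
  show "wirt (k, False) (hermite_prod N a b) z = of_nat (a k) * hermite_prod N (a(k := a k - 1)) b z"
    using wirt_unique(1)[OF h] e[of "a(k := a k - 1)" b "z k"] by simp
  show "wirt (k, True) (hermite_prod N a b) z = of_nat (b k) * hermite_prod N a (b(k := b k - 1)) z"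
    using wirt_unique(2)[OF h] e[of a "b(k := b k - 1)" "z k"] by simp
qed

lemma creation_hermite_prod:
  assumes k: "k < N"
  shows "creation (k, False) (hermite_prod N a b) = hermite_prod N (a(k := Suc (a k))) b"
    and "creation (k, True) (hermite_prod N a b) = hermite_prod N a (b(k := Suc (b k)))"
proof -
  have pc: "(\<Prod>j\<in>{..<N} - {k}. itoH ((a(k := x)) j) (b j) (z j)) = (\<Prod>j\<in>{..<N} - {k}. itoH (a j) (b j) (z j))"
    "(\<Prod>j\<in>{..<N} - {k}. itoH (a j) ((b(k := x)) j) (z j)) = (\<Prod>j\<in>{..<N} - {k}. itoH (a j) (b j) (z j))" for x z
    by (auto intro!: prod.cong)
  show "creation (k, False) (hermite_prod N a b) = hermite_prod N (a(k := Suc (a k))) b"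
    unfolding creation_def star_def
    by (rule ext) (simp add: wirt_hermite_prod[OF k] zc_def hermite_prod_split[OF k] pc itoH_Suc algebra_simps del: fun_upd_apply, simp add: algebra_simps itoH_Suc)
  show "creation (k, True) (hermite_prod N a b) = hermite_prod N a (b(k := Suc (b k)))"
    unfolding creation_def star_def
    by (rule ext) (simp add: wirt_hermite_prod[OF k] zc_def hermite_prod_split[OF k] pc itoH_Suc2 algebra_simps del: fun_upd_apply, simp add: algebra_simps itoH_Suc2)
qed

lemma wick_hermite_prod:
  "set ds \<subseteq> dirs N \<Longrightarrow> wick ds = hermite_prod N (\<lambda>k. count_list ds (k, False)) (\<lambda>k. count_list ds (k, True))"
proof (induction ds)
  case Nil
  then show ?case by (simp add: fun_eq_iff hermite_prod_def itoH_def)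
next
  case (Cons d ds)
  obtain k b where d: "d = (k, b)" by (cases d)
  then have k: "k < N" using Cons by (auto simp: dirs_def)
  show ?case
  proof (cases b)
    case False
    have "(\<lambda>j. count_list (d # ds) (j, False)) = (\<lambda>j. count_list ds (j, False))(k := Suc (count_list ds (k, False)))"
      "(\<lambda>j. count_list (d # ds) (j, True)) = (\<lambda>j. count_list ds (j, True))"
      using False d by auto
    then show ?thesis using Cons creation_hermite_prod(1)[OF k] False d by simp
  next
    case True
    have "(\<lambda>j. count_list (d # ds) (j, True)) = (\<lambda>j. count_list ds (j, True))(k := Suc (count_list ds (k, True)))"
      "(\<lambda>j. count_list (d # ds) (j, False)) = (\<lambda>j. count_list ds (j, False))"
      using True d by auto
    then show ?thesis using Cons creation_hermite_prod(2)[OF k] True d by simp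
  qed
qed

section \<open>Mixed lists of directions and pairs of index lists\<close>

definition ksf :: "dir list \<Rightarrow> nat list" where "ksf ds = map fst (filter (\<lambda>d. \<not> snd d) ds)"
definition lsf :: "dir list \<Rightarrow> nat list" where "lsf ds = map fst (filter snd ds)"

lemma ksf_simps[simp]: "ksf [] = []" "lsf [] = []"
  "ksf (d # ds) = (if snd d then ksf ds else fst d # ksf ds)"
  "lsf (d # ds) = (if snd d then fst d # lsf ds else lsf ds)"
  "ksf (ds @ es) = ksf ds @ ksf es" "lsf (ds @ es) = lsf ds @ lsf es"
  by (simp_all add: ksf_def lsf_def)

lemma count_ksf: "count_list (ksf ds) k = count_list ds (k, False)" "count_list (lsf ds) k = count_list ds (k, True)"
  by (induction ds) auto

lemma set_ksf: "set (ksf ds) = {k. (k, False) \<in> set ds}" "set (lsf ds) = {k. (k, True) \<in> set ds}"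
  by (auto simp: ksf_def lsf_def image_iff)

lemma length_ksf_lsf: "length (ksf ds) + length (lsf ds) = length ds"
  by (induction ds) auto

text \<open>An index that does not occur contributes the factor \<open>itoH 0 0\<close>, which is 1,
  so the product may run over all \<open>N\<close> coordinates.\<close>

lemma wick_wi_basis:
  assumes "set ds \<subseteq> dirs N"
  shows "wick ds (\<lambda>k. zeta k \<omega>) = wi_basis zeta (ksf ds) (lsf ds) \<omega>"
proof -
  have sub: "set (ksf ds) \<union> set (lsf ds) \<subseteq> {..<N}"
    using assms by (auto simp: set_ksf dirs_def)
  have "wi_basis zeta (ksf ds) (lsf ds) \<omega> = (\<Prod>k\<in>set (ksf ds) \<union> set (lsf ds). itoH (count_list ds (k, False)) (count_list ds (k, True)) (zeta k \<omega>))"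
    unfolding wi_basis_def
    by (intro prod.cong refl) (simp only: itoH_cHermite[symmetric] count_ksf of_nat_add)
  also have "\<dots> = (\<Prod>k<N. itoH (count_list ds (k, False)) (count_list ds (k, True)) (zeta k \<omega>))"
    using sub by (intro prod.mono_neutral_left) (auto simp: set_ksf count_list_0_iff itoH_def)
  finally show ?thesis using wick_hermite_prod[OF assms] by (simp add: hermite_prod_def)
qed

definition nat_lists :: "nat \<Rightarrow> nat \<Rightarrow> nat list set" where
  "nat_lists N p = {ks. length ks = p \<and> set ks \<subseteq> {..<N}}"

lemma finite_nat_lists[simp]: "finite (nat_lists N p)"
  using finite_lists_length_eq[of "{..<N}" p] by (simp add: nat_lists_def conj_commute)

lemma nat_lists_0[simp]: "nat_lists N 0 = {[]}" by (auto simp: nat_lists_def)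

lemma sum_nat_lists_Suc: "(\<Sum>ks\<in>nat_lists N (Suc m). F ks) = (\<Sum>k<N. \<Sum>ks\<in>nat_lists N m. F (k # ks))"
proof -
  have "nat_lists N (Suc m) = (\<lambda>(k, ks). k # ks) ` ({..<N} \<times> nat_lists N m)"
    by (force simp: nat_lists_def length_Suc_conv image_iff)
  moreover have "inj_on (\<lambda>(k, ks). k # ks) ({..<N} \<times> nat_lists N m)" by (auto simp: inj_on_def)
  ultimately have "(\<Sum>ks\<in>nat_lists N (Suc m). F ks) = (\<Sum>p\<in>{..<N} \<times> nat_lists N m. F (fst p # snd p))"
    by (simp add: sum.reindex case_prod_beta' o_def)
  then show ?thesis by (simp add: sum.cartesian_product case_prod_beta')
qed

lemma sum_dirs: "(\<Sum>d\<in>dirs N. F d) = (\<Sum>k<N. F (k, False) + F (k, True))"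
  for F :: "dir \<Rightarrow> 'a :: comm_monoid_add"
proof -
  have "(\<Sum>d\<in>dirs N. F d) = (\<Sum>k<N. \<Sum>b\<in>UNIV. F (k, b))"
    unfolding dirs_def by (simp add: sum.cartesian_product case_prod_beta')
  then show ?thesis by (simp add: UNIV_bool)
qed

text \<open>A pair of index lists of lengths \<open>p\<close> and \<open>m - p\<close> arises from
  \<open>m choose p\<close> mixed lists, one for each interleaving. Splitting off the head direction
  turns the induction into Pascal's rule.\<close>

lemma sum_dir_lists_types:
  fixes F :: "nat list \<Rightarrow> nat list \<Rightarrow> 'a :: semiring_1"
  shows "(\<Sum>ds\<in>dir_lists N m. F (ksf ds) (lsf ds)) = (\<Sum>p\<le>m. of_nat (m choose p) * (\<Sum>ks\<in>nat_lists N p. \<Sum>ls\<in>nat_lists N (m - p). F ks ls))"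
proof (induction m arbitrary: F)
  case 0
  then show ?case by simp
next
  case (Suc m)
  define S where "S = (\<lambda>p q. \<Sum>ks\<in>nat_lists N p. \<Sum>ls\<in>nat_lists N q. F ks ls)"
  have S1: "(\<Sum>k<N. \<Sum>ks\<in>nat_lists N p. \<Sum>ls\<in>nat_lists N q. F (k # ks) ls) = S (Suc p) q" for p q
    unfolding S_def sum_nat_lists_Suc ..
  have S2: "(\<Sum>k<N. \<Sum>ks\<in>nat_lists N p. \<Sum>ls\<in>nat_lists N q. F ks (k # ls)) = S p (Suc q)" for p q
    unfolding S_def sum_nat_lists_Suc by (rule sum.swap)
  have "(\<Sum>ds\<in>dir_lists N (Suc m). F (ksf ds) (lsf ds))
      = (\<Sum>k<N. (\<Sum>ds\<in>dir_lists N m. F (k # ksf ds) (lsf ds)) + (\<Sum>ds\<in>dir_lists N m. F (ksf ds) (k # lsf ds)))"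
    by (simp add: sum_dir_lists_Suc sum_dirs)
  also have "\<dots> = (\<Sum>k<N. (\<Sum>p\<le>m. of_nat (m choose p) * (\<Sum>ks\<in>nat_lists N p. \<Sum>ls\<in>nat_lists N (m - p). F (k # ks) ls))
      + (\<Sum>p\<le>m. of_nat (m choose p) * (\<Sum>ks\<in>nat_lists N p. \<Sum>ls\<in>nat_lists N (m - p). F ks (k # ls))))"
    using Suc.IH[of "\<lambda>ks ls. F (_ # ks) ls"] Suc.IH[of "\<lambda>ks ls. F ks (_ # ls)"] by simp
  also have "\<dots> = (\<Sum>p\<le>m. of_nat (m choose p) * S (Suc p) (m - p)) + (\<Sum>p\<le>m. of_nat (m choose p) * S p (Suc (m - p)))"
    unfolding sum.distrib S1[symmetric] S2[symmetric]
    by (subst (1 4) sum.swap) (simp add: sum_distrib_left)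
  also have "(\<Sum>p\<le>m. of_nat (m choose p) * S p (Suc (m - p))) = S 0 (Suc m) + (\<Sum>p\<le>m. of_nat (m choose Suc p) * S (Suc p) (m - p))"
  proof -
    have "(\<Sum>p\<le>m. of_nat (m choose p) * S p (Suc (m - p))) = (\<Sum>p\<le>Suc m. of_nat (m choose p) * S p (Suc m - p))"
      by (simp add: Suc_diff_le binomial_eq_0)
    also have "\<dots> = S 0 (Suc m) + (\<Sum>p\<le>m. of_nat (m choose Suc p) * S (Suc p) (m - p))"
      by (subst sum.atMost_Suc_shift) simp
    finally show ?thesis .
  qed
  also have "(\<Sum>p\<le>m. of_nat (m choose p) * S (Suc p) (m - p)) + (S 0 (Suc m) + (\<Sum>p\<le>m. of_nat (m choose Suc p) * S (Suc p) (m - p)))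
     = (\<Sum>p\<le>Suc m. of_nat (Suc m choose p) * S p (Suc m - p))"
    by (subst sum.atMost_Suc_shift) (simp add: sum.distrib distrib_right add_ac)
  finally show ?case unfolding S_def .
qed

section \<open>Kernels and their contractions\<close>

lemma cmod_sum_mult_le:
  fixes a b :: "'x \<Rightarrow> complex"
  shows "(cmod (\<Sum>x\<in>X. a x * cnj (b x)))\<^sup>2 \<le> (\<Sum>x\<in>X. (cmod (a x))\<^sup>2) * (\<Sum>x\<in>X. (cmod (b x))\<^sup>2)"
proof -
  have "cmod (\<Sum>x\<in>X. a x * cnj (b x)) \<le> (\<Sum>x\<in>X. \<bar>cmod (a x)\<bar> * \<bar>cmod (b x)\<bar>)"
    by (rule sum_norm_le) (simp add: norm_mult)
  also have "\<dots> \<le> L2_set (\<lambda>x. cmod (a x)) X * L2_set (\<lambda>x. cmod (b x)) X"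
    by (rule L2_set_mult_ineq)
  finally have "(cmod (\<Sum>x\<in>X. a x * cnj (b x)))\<^sup>2 \<le> (L2_set (\<lambda>x. cmod (a x)) X * L2_set (\<lambda>x. cmod (b x)) X)\<^sup>2"
    by (rule power_mono) simp
  then show ?thesis by (simp add: L2_set_def power_mult_distrib sum_nonneg)
qed

text \<open>The two sides are squared Hilbert-Schmidt norms of the Gram matrices of the columns and
  of the rows of the same array, and they expand into the same fourfold sum.\<close>

lemma gram_swap:
  fixes a :: "'x \<Rightarrow> 's \<Rightarrow> complex"
  shows "(\<Sum>s\<in>S. \<Sum>s'\<in>S. (cmod (\<Sum>x\<in>X. a x s * cnj (a x s')))\<^sup>2)
       = (\<Sum>x\<in>X. \<Sum>x'\<in>X. (cmod (\<Sum>s\<in>S. a x s * cnj (a x' s)))\<^sup>2)"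
proof -
  let ?t = "\<lambda>s s' x x'. (a x s * cnj (a x s')) * (cnj (a x' s) * a x' s')"
  have "complex_of_real (\<Sum>s\<in>S. \<Sum>s'\<in>S. (cmod (\<Sum>x\<in>X. a x s * cnj (a x s')))\<^sup>2) = (\<Sum>s\<in>S. \<Sum>s'\<in>S. \<Sum>x\<in>X. \<Sum>x'\<in>X. ?t s s' x x')"
    unfolding of_real_sum complex_norm_square by (simp add: cnj_sum sum_product)
  also have "\<dots> = (\<Sum>s\<in>S. \<Sum>x\<in>X. \<Sum>x'\<in>X. \<Sum>s'\<in>S. ?t s s' x x')"
    by (rule sum.cong[OF refl], subst sum.swap, rule sum.cong[OF refl], rule sum.swap)
  also have "\<dots> = (\<Sum>x\<in>X. \<Sum>x'\<in>X. \<Sum>s\<in>S. \<Sum>s'\<in>S. ?t s s' x x')"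
    by (subst sum.swap, rule sum.cong[OF refl], rule sum.swap)
  also have "\<dots> = (\<Sum>x\<in>X. \<Sum>x'\<in>X. (\<Sum>s\<in>S. a x s * cnj (a x' s)) * cnj (\<Sum>s\<in>S. a x s * cnj (a x' s)))"
    by (simp add: cnj_sum sum_product mult_ac)
  also have "\<dots> = complex_of_real (\<Sum>x\<in>X. \<Sum>x'\<in>X. (cmod (\<Sum>s\<in>S. a x s * cnj (a x' s)))\<^sup>2)"
    unfolding of_real_sum complex_norm_square ..
  finally show ?thesis using of_real_eq_iff by blast
qed

text \<open>By \<open>gram_swap\<close> the Hilbert-Schmidt norm of the Gram matrix grows with both index sets, which
  compares the contractions of truncated kernels with those of the full ones.\<close>

lemma gram_le_infsum:
  fixes a :: "'x \<Rightarrow> 's \<Rightarrow> complex"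
  assumes sm: "(\<lambda>(s, x). (cmod (a x s))\<^sup>2) summable_on S \<times> X"
    and X0: "finite X0" "X0 \<subseteq> X" and S0: "finite S0" "S0 \<subseteq> S"
  shows "(\<Sum>s\<in>S0. \<Sum>s'\<in>S0. (cmod (\<Sum>x\<in>X0. a x s * cnj (a x s')))\<^sup>2)
     \<le> (\<Sum>\<^sub>\<infinity>(s, s')\<in>S \<times> S. (cmod (\<Sum>\<^sub>\<infinity>x\<in>X. a x s * cnj (a x s')))\<^sup>2)"
proof -
  define T where "T = (\<lambda>Y S1. \<Sum>s\<in>S1. \<Sum>s'\<in>S1. (cmod (\<Sum>x\<in>Y. a x s * cnj (a x s')))\<^sup>2)"
  define c where "c = (\<lambda>s s'. \<Sum>\<^sub>\<infinity>x\<in>X. a x s * cnj (a x s'))"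
  define tot where "tot = (\<Sum>\<^sub>\<infinity>(s, x)\<in>S \<times> X. (cmod (a x s))\<^sup>2)"
  have col: "(\<lambda>x. (cmod (a x s))\<^sup>2) summable_on X" if "s \<in> S" for s
    using summable_on_SigmaD1[OF sm that] .
  have csum: "(\<lambda>x. a x s * cnj (a x s')) summable_on X" if "s \<in> S" "s' \<in> S" for s s'
  proof (rule abs_summable_summable, rule abs_summable_product)
    show "(\<lambda>i. norm (a i s * a i s)) summable_on X"
      using col[OF that(1)] by (simp add: norm_mult power2_eq_square)
    show "(\<lambda>i. norm (cnj (a i s') * cnj (a i s'))) summable_on X"
      using col[OF that(2)] by (simp add: norm_mult power2_eq_square)
  qed
  have T': "T Y S1 = (\<Sum>x\<in>Y. \<Sum>x'\<in>Y. (cmod (\<Sum>s\<in>S1. a x s * cnj (a x' s)))\<^sup>2)" for Y S1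
    unfolding T_def by (rule gram_swap)
  \<comment> \<open>With the indices of \<open>Y\<close> moved outside by \<open>gram_swap\<close>,
    enlarging \<open>Y\<close> adds nonnegative terms; in the original form new terms of the inner
    sum could cancel old ones.\<close>
  have mono: "T Y S1 \<le> T Y' S1" if "Y \<subseteq> Y'" "finite Y'" for Y Y' S1
    unfolding T' sum.cartesian_product
    using that by (intro sum_mono2) auto
  have le: "T Y S1 \<le> tot\<^sup>2" if "finite Y" "Y \<subseteq> X" "finite S1" "S1 \<subseteq> S" for Y S1
  proof -
    have "T Y S1 \<le> (\<Sum>s\<in>S1. \<Sum>s'\<in>S1. (\<Sum>x\<in>Y. (cmod (a x s))\<^sup>2) * (\<Sum>x\<in>Y. (cmod (a x s'))\<^sup>2))"
      unfolding T_def by (intro sum_mono cmod_sum_mult_le)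
    also have "\<dots> = (\<Sum>s\<in>S1. \<Sum>x\<in>Y. (cmod (a x s))\<^sup>2)\<^sup>2"
      by (simp add: power2_eq_square sum_product)
    also have "\<dots> \<le> tot\<^sup>2"
    proof (rule power_mono)
      have "(\<Sum>s\<in>S1. \<Sum>x\<in>Y. (cmod (a x s))\<^sup>2) = (\<Sum>(s, x)\<in>S1 \<times> Y. (cmod (a x s))\<^sup>2)"
        by (rule sum.cartesian_product)
      also have "\<dots> \<le> tot" unfolding tot_def
        by (rule finite_sum_le_infsum[OF sm]) (use that in auto)
      finally show "(\<Sum>s\<in>S1. \<Sum>x\<in>Y. (cmod (a x s))\<^sup>2) \<le> tot" .
    qed (intro sum_nonneg, simp)
    finally show ?thesis .
  qed
  have lim: "((\<lambda>Y. T Y S1) \<longlongrightarrow> (\<Sum>s\<in>S1. \<Sum>s'\<in>S1. (cmod (c s s'))\<^sup>2)) (finite_subsets_at_top X)"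
    if "S1 \<subseteq> S" for S1
    unfolding T_def c_def
    by (intro tendsto_sum tendsto_power tendsto_norm infsum_tendsto csum) (use that in auto)
  \<comment> \<open>Summability matters because \<open>infsum\<close> is 0 on families that are not
    summable, and the final comparison would then break down. The bound \<open>tot^2\<close> passes
    from finite inner sums to the infinite ones.\<close>
  have g: "(\<lambda>(s, s'). (cmod (c s s'))\<^sup>2) summable_on S \<times> S"
  proof (rule nonneg_bdd_above_summable_on)
    show "bdd_above (sum (\<lambda>(s, s'). (cmod (c s s'))\<^sup>2) ` {F. F \<subseteq> S \<times> S \<and> finite F})"
    proof (rule bdd_aboveI2)
      fix F assume F: "F \<in> {F. F \<subseteq> S \<times> S \<and> finite F}"
      let ?S1 = "fst ` F \<union> snd ` F"
      have f: "finite ?S1" "?S1 \<subseteq> S" using F by auto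
      have "sum (\<lambda>(s, s'). (cmod (c s s'))\<^sup>2) F \<le> (\<Sum>(s, s')\<in>?S1 \<times> ?S1. (cmod (c s s'))\<^sup>2)"
      proof (rule sum_mono2)
        show "F \<subseteq> ?S1 \<times> ?S1" by (auto intro: rev_image_eqI)
      qed (use f in auto)
      also have "\<dots> = (\<Sum>s\<in>?S1. \<Sum>s'\<in>?S1. (cmod (c s s'))\<^sup>2)"
        by (rule sum.cartesian_product[symmetric])
      also have "\<dots> \<le> tot\<^sup>2"
      proof (rule tendsto_upperbound[OF lim[OF f(2)]])
        show "\<forall>\<^sub>F Y in finite_subsets_at_top X. T Y ?S1 \<le> tot\<^sup>2"
          using le[OF _ _ f] by (auto simp: eventually_finite_subsets_at_top)
      qed simp
      finally show "sum (\<lambda>(s, s'). (cmod (c s s'))\<^sup>2) F \<le> tot\<^sup>2" .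
    qed
  qed auto
  have "T X0 S0 \<le> (\<Sum>s\<in>S0. \<Sum>s'\<in>S0. (cmod (c s s'))\<^sup>2)"
  proof (rule tendsto_lowerbound[OF lim[OF S0(2)]])
    show "\<forall>\<^sub>F Y in finite_subsets_at_top X. T X0 S0 \<le> T Y S0"
      proof -
      have "T X0 S0 \<le> T Y S0" if "finite Y \<and> X0 \<subseteq> Y \<and> Y \<subseteq> X" for Y
        using that by (intro mono) auto
      then show ?thesis unfolding eventually_finite_subsets_at_top using X0 by (intro exI[of _ X0]) auto
    qed
  qed simp
  also have "\<dots> = (\<Sum>(s, s')\<in>S0 \<times> S0. (cmod (c s s'))\<^sup>2)"
    by (rule sum.cartesian_product)
  also have "\<dots> \<le> (\<Sum>\<^sub>\<infinity>(s, s')\<in>S \<times> S. (cmod (c s s'))\<^sup>2)"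
    by (rule finite_sum_le_infsum[OF g]) (use S0 in auto)
  finally show ?thesis unfolding T_def c_def .
qed

text \<open>Embeds a kernel of type \<open>(p, q)\<close> into the kernels over directions,
  supported on lists with \<open>p\<close> plain and \<open>q\<close> conjugated entries. The
  binomial coefficient counts the interleavings of one pair of index lists, so that the integral
  stays the same.\<close>

definition gker :: "nat \<Rightarrow> nat \<Rightarrow> (nat list \<Rightarrow> nat list \<Rightarrow> complex) \<Rightarrow> dir list \<Rightarrow> complex" where
  "gker p q f ds = (if length (ksf ds) = p \<and> length (lsf ds) = q
     then f (ksf ds) (lsf ds) / of_nat ((p + q) choose p) else 0)"

lemma count_list_mset: "mset xs = mset ys \<Longrightarrow> count_list xs x = count_list ys x"
  by (metis count_mset)

lemma sym_tensor_summable: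
  "sym_tensor p q f \<Longrightarrow> (\<lambda>(ks, ls). (cmod (f ks ls))\<^sup>2) summable_on idx_lists p q"
  unfolding sym_tensor_def by (rule conjunct1)

lemma sym_tensorD:
  assumes "sym_tensor p q f" "length ks = p" "length ls = q"
    and "\<And>k. count_list ks k = count_list ks' k" "\<And>k. count_list ls k = count_list ls' k"
  shows "f ks ls = f ks' ls'"
  by (rule assms(1)[unfolded sym_tensor_def, THEN conjunct2, rule_format]; fact assms)

lemma symk_gker:
  assumes "sym_tensor p q f"
  shows "symk (gker p q f)"
proof (rule symkI)
  fix ds ds' :: "dir list" assume m: "mset ds = mset ds'"
  have k: "mset (ksf ds) = mset (ksf ds')" "mset (lsf ds) = mset (lsf ds')"
    unfolding ksf_def lsf_def using m by (simp_all add: mset_filter)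
  have l: "length (ksf ds) = length (ksf ds')" "length (lsf ds) = length (lsf ds')"
    using k mset_eq_length by blast+
  show "gker p q f ds = gker p q f ds'"
  proof (cases "length (ksf ds) = p \<and> length (lsf ds) = q")
    case True
    then have "f (ksf ds) (lsf ds) = f (ksf ds') (lsf ds')"
      by (intro sym_tensorD[OF assms] count_list_mset k) auto
    then show ?thesis by (simp add: gker_def l)
  next
    case False
    then show ?thesis by (auto simp: gker_def l)
  qed
qed

lemma sum_dir_lists_type:
  fixes F :: "nat list \<Rightarrow> nat list \<Rightarrow> 'a :: semiring_1"
  shows "(\<Sum>ds\<in>dir_lists N m. if length (ksf ds) = p \<and> length (lsf ds) = q then F (ksf ds) (lsf ds) else 0)
     = (if m = p + q then of_nat (m choose p) * (\<Sum>ks\<in>nat_lists N p. \<Sum>ls\<in>nat_lists N q. F ks ls) else 0)"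
proof -
  have "(\<Sum>ds\<in>dir_lists N m. if length (ksf ds) = p \<and> length (lsf ds) = q then F (ksf ds) (lsf ds) else 0)
    = (\<Sum>p'\<le>m. of_nat (m choose p') * (\<Sum>ks\<in>nat_lists N p'. \<Sum>ls\<in>nat_lists N (m - p'). if length ks = p \<and> length ls = q then F ks ls else 0))"
    by (rule sum_dir_lists_types)
  also have "\<dots> = (\<Sum>p'\<le>m. if p' = p then (if m = p + q then of_nat (m choose p) * (\<Sum>ks\<in>nat_lists N p. \<Sum>ls\<in>nat_lists N q. F ks ls) else 0) else 0)"
  proof (rule sum.cong[OF refl])
    fix p' assume p': "p' \<in> {..m}"
    have "(\<Sum>ks\<in>nat_lists N p'. \<Sum>ls\<in>nat_lists N (m - p'). if length ks = p \<and> length ls = q then F ks ls else 0)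
        = (if p' = p \<and> m - p' = q then (\<Sum>ks\<in>nat_lists N p'. \<Sum>ls\<in>nat_lists N (m - p'). F ks ls) else 0)"
      by (auto simp: nat_lists_def intro!: sum.cong sum.neutral)
    then show "of_nat (m choose p') * (\<Sum>ks\<in>nat_lists N p'. \<Sum>ls\<in>nat_lists N (m - p'). if length ks = p \<and> length ls = q then F ks ls else 0)
       = (if p' = p then (if m = p + q then of_nat (m choose p) * (\<Sum>ks\<in>nat_lists N p. \<Sum>ls\<in>nat_lists N q. F ks ls) else 0) else 0)"
      using p' by auto
  qed
  also have "\<dots> = (if m = p + q then of_nat (m choose p) * (\<Sum>ks\<in>nat_lists N p. \<Sum>ls\<in>nat_lists N q. F ks ls) else 0)"
    by auto
  finally show ?thesis .
qed

lemma wi_trunc_wick_int: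
  "wi_trunc zeta p q f N \<omega> = wick_int N (p + q) (gker p q f) (\<lambda>k. zeta k \<omega>)"
proof -
  have "wick_int N (p + q) (gker p q f) (\<lambda>k. zeta k \<omega>) = (\<Sum>ds\<in>dir_lists N (p + q). if length (ksf ds) = p \<and> length (lsf ds) = q
       then f (ksf ds) (lsf ds) / of_nat ((p + q) choose p) * wi_basis zeta (ksf ds) (lsf ds) \<omega> else 0)"
    unfolding wick_int_def by (rule sum.cong[OF refl]) (simp add: gker_def dir_lists_def wick_wi_basis[where N=N])
  also have "\<dots> = of_nat ((p + q) choose p) * (\<Sum>ks\<in>nat_lists N p. \<Sum>ls\<in>nat_lists N q. f ks ls / of_nat ((p + q) choose p) * wi_basis zeta ks ls \<omega>)"
    by (subst sum_dir_lists_type) simp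
  also have "\<dots> = (\<Sum>ks\<in>nat_lists N p. \<Sum>ls\<in>nat_lists N q. f ks ls * wi_basis zeta ks ls \<omega>)"
    by (simp add: sum_distrib_left)
  also have "\<dots> = wi_trunc zeta p q f N \<omega>"
  proof -
    have "{(ks, ls) \<in> idx_lists p q. set ks \<subseteq> {..<N} \<and> set ls \<subseteq> {..<N}} = nat_lists N p \<times> nat_lists N q"
      by (auto simp: idx_lists_def nat_lists_def)
    then show ?thesis unfolding wi_trunc_def by (simp add: sum.cartesian_product)
  qed
  finally show ?thesis ..
qed

section \<open>Norms and self-contractions of truncated kernels\<close>

definition fin_norm2 :: "nat \<Rightarrow> nat \<Rightarrow> nat \<Rightarrow> (nat list \<Rightarrow> nat list \<Rightarrow> complex) \<Rightarrow> real" where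
  "fin_norm2 N p q f = (\<Sum>ks\<in>nat_lists N p. \<Sum>ls\<in>nat_lists N q. (cmod (f ks ls))\<^sup>2)"

lemma creation_cnj: "smooth G \<Longrightarrow> cnj (creation d G z) = creation (star d) (\<lambda>z. cnj (G z)) z"
  by (simp add: creation_def wirt_cnj zc_star)

lemma wick_cnj: "cnj (wick ds z) = wick (map star ds) z"
proof (induction ds arbitrary: z)
  case (Cons d ds)
  then have "(\<lambda>z. cnj (wick ds z)) = wick (map star ds)" by auto
  then show ?case by (simp add: creation_cnj smooth_wick)
qed simp

lemma wick_int_cnj: "cnj (wick_int N m g z) = wick_int N m (\<lambda>ds. cnj (g (map star ds))) z"
proof -
  have "wick_int N m (\<lambda>ds. cnj (g (map star ds))) z = (\<Sum>ds\<in>dir_lists N m. cnj (g (map star (map star ds))) * wick (map star ds) z)"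
    unfolding wick_int_def by (rule sum_dir_lists_star[symmetric])
  also have "\<dots> = cnj (wick_int N m g z)" by (simp add: wick_int_def cnj_sum wick_cnj o_def)
  finally show ?thesis ..
qed

lemma symk_cnj: "symk g \<Longrightarrow> symk (\<lambda>ds. cnj (g (map star ds)))"
  by (rule symkI) (metis mset_map symkD)

lemma EE_wick_int_cnj:
  assumes "symk h"
  shows "EE (\<lambda>z. wick_int N m g z * cnj (wick_int N k h z)) = (if m = k then fact m * (\<Sum>ds\<in>dir_lists N m. g ds * cnj (h ds)) else 0)"
  unfolding wick_int_cnj using EE_wick_int_mult[OF symk_cnj[OF assms]] by (simp add: o_def)

text \<open>The squared kernel carries the binomial coefficient twice in its denominator and the
  interleavings return it once; the remaining one turns \<open>fact (p + q)\<close> into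
  \<open>fact p * fact q\<close>.\<close>

lemma n2_wick_int_gker:
  assumes "sym_tensor p q f"
  shows "n2 (wick_int N (p + q) (gker p q f)) = fact p * fact q * fin_norm2 N p q f"
proof -
  let ?b = "real ((p + q) choose p)"
  have "complex_of_real (n2 (wick_int N (p + q) (gker p q f))) = fact (p + q) * (\<Sum>ds\<in>dir_lists N (p + q). gker p q f ds * cnj (gker p q f ds))"
    unfolding n2_EE[symmetric] by (simp add: EE_wick_int_cnj[OF symk_gker[OF assms]])
  also have "\<dots> = complex_of_real (fact (p + q) * (\<Sum>ds\<in>dir_lists N (p + q). (cmod (gker p q f ds))\<^sup>2))"
    unfolding complex_norm_square[symmetric] by simp
  finally have "n2 (wick_int N (p + q) (gker p q f)) = fact (p + q) * (\<Sum>ds\<in>dir_lists N (p + q). (cmod (gker p q f ds))\<^sup>2)"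
    using of_real_eq_iff by blast
  also have "(\<Sum>ds\<in>dir_lists N (p + q). (cmod (gker p q f ds))\<^sup>2) = (\<Sum>ds\<in>dir_lists N (p + q). if length (ksf ds) = p \<and> length (lsf ds) = q
      then (cmod (f (ksf ds) (lsf ds)) / ?b)\<^sup>2 else 0)"
    by (rule sum.cong[OF refl]) (simp add: gker_def norm_divide)
  also have "\<dots> = ?b * (\<Sum>ks\<in>nat_lists N p. \<Sum>ls\<in>nat_lists N q. (cmod (f ks ls) / ?b)\<^sup>2)"
    by (subst sum_dir_lists_type[where F="\<lambda>ks ls. (cmod (f ks ls) / ?b)\<^sup>2"]) simp
  also have "\<dots> = fin_norm2 N p q f / ?b"
    by (simp add: fin_norm2_def power_divide sum_divide_distrib[symmetric] power2_eq_square)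
  also have "fact (p + q) * (fin_norm2 N p q f / ?b) = fact p * fact q * fin_norm2 N p q f"
    by (simp add: binomial_fact)
  finally show ?thesis .
qed

text \<open>Integrals of different orders are orthogonal; for equal orders and different types the
  two kernels have disjoint supports.\<close>

lemma EE_gker_orth:
  assumes "sym_tensor p' q' f'" "(p, q) \<noteq> (p', q')"
  shows "EE (\<lambda>z. wick_int N (p + q) (gker p q f) z * cnj (wick_int N (p' + q') (gker p' q' f') z)) = 0"
proof -
  have "gker p q f ds * cnj (gker p' q' f' ds) = 0" for ds
    using assms(2) by (auto simp: gker_def)
  then have "(\<Sum>ds\<in>dir_lists N (p + q). gker p q f ds * cnj (gker p' q' f' ds)) = 0"
    by (intro sum.neutral) blast
  then show ?thesis by (auto simp add: EE_wick_int_cnj[OF symk_gker[OF assms(1)]])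
qed

text \<open>Here \<open>i\<close> and \<open>j\<close> count the slots left free, so this is the
  squared norm of the self-contraction over the complementary numbers \<open>p - i\<close> and
  \<open>q - j\<close>.\<close>

definition fin_contr :: "nat \<Rightarrow> nat \<Rightarrow> nat \<Rightarrow> nat \<Rightarrow> nat \<Rightarrow> (nat list \<Rightarrow> nat list \<Rightarrow> complex) \<Rightarrow> real" where
  "fin_contr N p q i j f = (\<Sum>us\<in>nat_lists N i. \<Sum>vs\<in>nat_lists N j. \<Sum>us'\<in>nat_lists N i. \<Sum>vs'\<in>nat_lists N j.
     (cmod (\<Sum>ks\<in>nat_lists N (p - i). \<Sum>ls\<in>nat_lists N (q - j). f (ks @ us) (ls @ vs) * cnj (f (ks @ us') (ls @ vs'))))\<^sup>2)"

text \<open>The free tuples are sorted by the number \<open>i\<close> of plain directions among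
  their \<open>r\<close> entries; only tuples of equal type can be completed by the same
  \<open>x\<close>. Interleavings give \<open>r choose i\<close> for each of the two free tuples and
  \<open>(p + q - r) choose (p - i)\<close> for the contracted one, the latter under the square
  together with the normalisation of \<open>gker\<close>.\<close>

lemma self_contr_gker:
  assumes r: "r \<le> p + q"
  shows "self_contr N (p + q - r) r (gker p q f) = (\<Sum>i\<le>r. if i \<le> p \<and> r - i \<le> q then
     (real (r choose i) * real ((p + q - r) choose (p - i)) / (real ((p + q) choose p))\<^sup>2)\<^sup>2 * fin_contr N p q i (r - i) f else 0)"
proof -
  let ?m = "p + q" let ?b = "(p + q) choose p"
  define H where "H = (\<lambda>us vs us' vs'. \<Sum>ks\<in>nat_lists N (p - length us). \<Sum>ls\<in>nat_lists N (q - length vs). f (ks @ us) (ls @ vs) * cnj (f (ks @ us') (ls @ vs')))"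
  define c where "c = (\<lambda>i. real ((p + q - r) choose (p - i)) / (real ?b)\<^sup>2)"
  define h where "h = (\<lambda>us vs us' vs'. if length us \<le> p \<and> length vs \<le> q \<and> length us' = length us \<and> length vs' = length vs
      then (c (length us))\<^sup>2 * (cmod (H us vs us' vs'))\<^sup>2 else 0)"
  have inner: "(cmod (\<Sum>x\<in>dir_lists N (?m - r). gker p q f (x @ s) * cnj (gker p q f (x @ s'))))\<^sup>2 = h (ksf s) (lsf s) (ksf s') (lsf s')"
    if s: "s \<in> dir_lists N r" "s' \<in> dir_lists N r" for s s'
  proof -
    have ls: "length (ksf s) + length (lsf s) = r" "length (ksf s') + length (lsf s') = r"
      using s length_ksf_lsf by (auto simp: dir_lists_def)
    show ?thesis
    proof (cases "length (ksf s) \<le> p \<and> length (lsf s) \<le> q \<and> length (ksf s') = length (ksf s) \<and> length (lsf s') = length (lsf s)")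
      case True
      have "(\<Sum>x\<in>dir_lists N (?m - r). gker p q f (x @ s) * cnj (gker p q f (x @ s')))
         = (\<Sum>x\<in>dir_lists N (?m - r). if length (ksf x) = p - length (ksf s) \<and> length (lsf x) = q - length (lsf s)
             then (f (ksf x @ ksf s) (lsf x @ lsf s) * cnj (f (ksf x @ ksf s') (lsf x @ lsf s'))) / (of_nat ?b)\<^sup>2 else 0)"
        using True by (intro sum.cong refl) (auto simp: gker_def power2_eq_square)
      also have "\<dots> = of_nat ((?m - r) choose (p - length (ksf s))) * (\<Sum>ks\<in>nat_lists N (p - length (ksf s)). \<Sum>ls\<in>nat_lists N (q - length (lsf s)).
             (f (ks @ ksf s) (ls @ lsf s) * cnj (f (ks @ ksf s') (ls @ lsf s'))) / (of_nat ?b)\<^sup>2)"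
        by (subst sum_dir_lists_type[where F="\<lambda>ks ls. (f (ks @ ksf s) (ls @ lsf s) * cnj (f (ks @ ksf s') (ls @ lsf s'))) / (of_nat ?b)\<^sup>2"]) (use True ls in auto)
      also have "\<dots> = of_real (c (length (ksf s))) * H (ksf s) (lsf s) (ksf s') (lsf s')"
        unfolding c_def H_def sum_divide_distrib[symmetric] by simp
      finally show ?thesis using True by (simp add: h_def norm_mult power_mult_distrib)
    next
      case False
      have "gker p q f (x @ s) * cnj (gker p q f (x @ s')) = 0" for x
        using False by (auto simp: gker_def)
      then have "(\<Sum>x\<in>dir_lists N (?m - r). gker p q f (x @ s) * cnj (gker p q f (x @ s'))) = 0"
        by (intro sum.neutral) blast
      moreover have "h (ksf s) (lsf s) (ksf s') (lsf s') = 0"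
        using False unfolding h_def by (rule if_not_P)
      ultimately show ?thesis by simp
    qed
  qed
  have "self_contr N (?m - r) r (gker p q f) = (\<Sum>s\<in>dir_lists N r. \<Sum>s'\<in>dir_lists N r. h (ksf s) (lsf s) (ksf s') (lsf s'))"
    unfolding self_contr_def by (intro sum.cong refl inner)
  also have "\<dots> = (\<Sum>s\<in>dir_lists N r. real (r choose length (ksf s)) * (\<Sum>us'\<in>nat_lists N (length (ksf s)). \<Sum>vs'\<in>nat_lists N (length (lsf s)). h (ksf s) (lsf s) us' vs'))"
  proof (rule sum.cong[OF refl])
    fix s assume "s \<in> dir_lists N r"
    then have ls: "r = length (ksf s) + length (lsf s)"
      using length_ksf_lsf[of s] by (auto simp: dir_lists_def)
    have "(\<Sum>s'\<in>dir_lists N r. h (ksf s) (lsf s) (ksf s') (lsf s')) = (\<Sum>s'\<in>dir_lists N r. if length (ksf s') = length (ksf s) \<and> length (lsf s') = length (lsf s)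
        then h (ksf s) (lsf s) (ksf s') (lsf s') else 0)"
      by (intro sum.cong refl) (auto simp: h_def)
    also have "\<dots> = real (r choose length (ksf s)) * (\<Sum>us'\<in>nat_lists N (length (ksf s)). \<Sum>vs'\<in>nat_lists N (length (lsf s)). h (ksf s) (lsf s) us' vs')"
      by (subst sum_dir_lists_type[where F="\<lambda>us' vs'. h (ksf s) (lsf s) us' vs'"]) (use ls in auto)
    finally show "(\<Sum>s'\<in>dir_lists N r. h (ksf s) (lsf s) (ksf s') (lsf s')) = real (r choose length (ksf s)) * (\<Sum>us'\<in>nat_lists N (length (ksf s)). \<Sum>vs'\<in>nat_lists N (length (lsf s)). h (ksf s) (lsf s) us' vs')" .
  qed
  also have "\<dots> = (\<Sum>i\<le>r. real (r choose i) * (\<Sum>us\<in>nat_lists N i. \<Sum>vs\<in>nat_lists N (r - i). real (r choose length us) *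
      (\<Sum>us'\<in>nat_lists N (length us). \<Sum>vs'\<in>nat_lists N (length vs). h us vs us' vs')))"
    by (subst sum_dir_lists_types[where F="\<lambda>us vs. real (r choose length us) * (\<Sum>us'\<in>nat_lists N (length us). \<Sum>vs'\<in>nat_lists N (length vs). h us vs us' vs')"]) simp
  also have "\<dots> = (\<Sum>i\<le>r. if i \<le> p \<and> r - i \<le> q then (real (r choose i) * c i)\<^sup>2 * fin_contr N p q i (r - i) f else 0)"
  proof (rule sum.cong[OF refl])
    fix i assume i: "i \<in> {..r}"
    have "(\<Sum>us\<in>nat_lists N i. \<Sum>vs\<in>nat_lists N (r - i). real (r choose length us) * (\<Sum>us'\<in>nat_lists N (length us). \<Sum>vs'\<in>nat_lists N (length vs). h us vs us' vs'))
        = (\<Sum>us\<in>nat_lists N i. \<Sum>vs\<in>nat_lists N (r - i). real (r choose i) * (\<Sum>us'\<in>nat_lists N i. \<Sum>vs'\<in>nat_lists N (r - i).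
            if i \<le> p \<and> r - i \<le> q then (c i)\<^sup>2 * (cmod (\<Sum>ks\<in>nat_lists N (p - i). \<Sum>ls\<in>nat_lists N (q - (r - i)). f (ks @ us) (ls @ vs) * cnj (f (ks @ us') (ls @ vs'))))\<^sup>2 else 0))"
      by (intro sum.cong refl arg_cong2[where f="(*)"]) (auto simp: nat_lists_def h_def H_def intro!: sum.cong)
    also have "real (r choose i) * \<dots> = (if i \<le> p \<and> r - i \<le> q then (real (r choose i) * c i)\<^sup>2 * fin_contr N p q i (r - i) f else 0)"
      by (cases "i \<le> p \<and> r - i \<le> q") (auto simp add: fin_contr_def sum_distrib_left power2_eq_square mult_ac)
    finally show "real (r choose i) * (\<Sum>us\<in>nat_lists N i. \<Sum>vs\<in>nat_lists N (r - i). real (r choose length us) * (\<Sum>us'\<in>nat_lists N (length us). \<Sum>vs'\<in>nat_lists N (length vs). h us vs us' vs'))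
       = (if i \<le> p \<and> r - i \<le> q then (real (r choose i) * c i)\<^sup>2 * fin_contr N p q i (r - i) f else 0)" by simp
  qed
  finally show ?thesis unfolding c_def times_divide_eq_right .
qed

lemma sum_Times: "(\<Sum>t\<in>X \<times> Y. F t) = (\<Sum>x\<in>X. \<Sum>y\<in>Y. F (x, y))"
  by (simp add: sum.cartesian_product case_prod_beta')

lemma bij_append_lists:
  assumes "i \<le> p" "j \<le> q"
  shows "bij_betw (\<lambda>((us, vs), (ks, ls)). (ks @ us, ls @ vs)) (idx_lists i j \<times> idx_lists (p - i) (q - j)) (idx_lists p q)"
proof (rule bij_betwI[where g="\<lambda>(xs, ys). ((drop (p - i) xs, drop (q - j) ys), (take (p - i) xs, take (q - j) ys))"])
qed (use assms in \<open>auto simp: idx_lists_def\<close>)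

lemma fin_norm2_le:
  assumes "sym_tensor p q f"
  shows "fin_norm2 N p q f \<le> tnorm2 p q f"
proof -
  have "fin_norm2 N p q f = (\<Sum>(ks, ls)\<in>nat_lists N p \<times> nat_lists N q. (cmod (f ks ls))\<^sup>2)"
    unfolding fin_norm2_def by (rule sum.cartesian_product)
  also have "\<dots> \<le> tnorm2 p q f"
    unfolding tnorm2_def
    by (intro finite_sum_le_infsum sym_tensor_summable[OF assms]) (simp, (force simp: idx_lists_def nat_lists_def)[1], auto)
  finally show ?thesis .
qed

lemma fin_norm2_tendsto:
  assumes "sym_tensor p q f"
  shows "(\<lambda>N. fin_norm2 N p q f) \<longlonglongrightarrow> tnorm2 p q f"
proof -
  have "filterlim (\<lambda>N. nat_lists N p \<times> nat_lists N q) (finite_subsets_at_top (idx_lists p q)) sequentially"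
    unfolding filterlim_finite_subsets_at_top
  proof (intro allI impI)
    fix X assume X: "finite X \<and> X \<subseteq> idx_lists p q"
    have "finite (\<Union>t\<in>X. set (fst t) \<union> set (snd t))" using X by auto
    then obtain n where n: "(\<Union>t\<in>X. set (fst t) \<union> set (snd t)) \<subseteq> {..<n}"
      by (auto simp: finite_nat_set_iff_bounded)
    show "\<forall>\<^sub>F N in sequentially. finite (nat_lists N p \<times> nat_lists N q) \<and> X \<subseteq> nat_lists N p \<times> nat_lists N q \<and> nat_lists N p \<times> nat_lists N q \<subseteq> idx_lists p q"
      using eventually_ge_at_top[of n]
    proof eventually_elim
      case (elim N)
      have "t \<in> nat_lists N p \<times> nat_lists N q" if t: "t \<in> X" for t
      proof -
        have "set (fst t) \<union> set (snd t) \<subseteq> {..<n}" using n by (rule UN_subset_iff[THEN iffD1, THEN bspec, OF _ t])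
        moreover have "{..<n} \<subseteq> {..<N}" using elim by auto
        ultimately have "set (fst t) \<subseteq> {..<N}" "set (snd t) \<subseteq> {..<N}" by auto
        moreover have "length (fst t) = p" "length (snd t) = q"
          using X t by (auto simp: idx_lists_def)
        ultimately show ?thesis by (simp add: nat_lists_def mem_Times_iff)
      qed
      moreover have "nat_lists N p \<times> nat_lists N q \<subseteq> idx_lists p q" by (auto simp: idx_lists_def nat_lists_def)
      ultimately show ?case by (auto intro: finite_cartesian_product)
    qed
  qed
  note fl = this
  have "((\<lambda>F. sum (\<lambda>(ks, ls). (cmod (f ks ls))\<^sup>2) F) \<longlongrightarrow> tnorm2 p q f) (finite_subsets_at_top (idx_lists p q))"
    unfolding tnorm2_def by (intro infsum_tendsto sym_tensor_summable[OF assms])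
  from filterlim_compose[OF this fl] show ?thesis by (simp add: fin_norm2_def sum.cartesian_product)
qed

text \<open>With every slot free the inner sums are over empty lists, and the Gram matrix is the
  rank-one product of \<open>f\<close> and its conjugate.\<close>

lemma fin_contr_full: "fin_contr N p q p q f = (fin_norm2 N p q f)\<^sup>2"
proof -
  have "fin_contr N p q p q f = (\<Sum>us\<in>nat_lists N p. \<Sum>vs\<in>nat_lists N q. \<Sum>us'\<in>nat_lists N p. \<Sum>vs'\<in>nat_lists N q. (cmod (f us vs))\<^sup>2 * (cmod (f us' vs'))\<^sup>2)"
    by (simp add: fin_contr_def norm_mult power_mult_distrib)
  also have "\<dots> = (fin_norm2 N p q f)\<^sup>2"
    unfolding fin_norm2_def power2_eq_square[of "sum _ _"] sum_distrib_right sum_distrib_left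
    by (simp only: mult.commute)
  finally show ?thesis .
qed

text \<open>\<open>gram_le_infsum\<close> applies with the free slots as matrix index and the
  contracted ones as summation index. Reverse conjugation exchanges plain and conjugated slots of
  the second factor, so the free slots regroup as \<open>us @ vs'\<close> and
  \<open>vs @ us'\<close>.\<close>

lemma fin_contr_le:
  assumes f: "sym_tensor p q f" and ij: "i \<le> p" "j \<le> q"
  shows "fin_contr N p q i j f \<le> tnorm2 (i + j) (j + i) (contr p q (p - i) (q - j) f (rev_cnj f))"
proof -
  define a where "a = (\<lambda>(ks, ls) (us, vs). f (ks @ us) (ls @ vs))"
  let ?S = "idx_lists i j" let ?X = "idx_lists (p - i) (q - j)"
  have sm: "(\<lambda>(s, x). (cmod (a x s))\<^sup>2) summable_on ?S \<times> ?X"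
  proof -
    have "(\<lambda>y. (\<lambda>(ks, ls). (cmod (f ks ls))\<^sup>2) ((\<lambda>((us, vs), (ks, ls)). (ks @ us, ls @ vs)) y)) summable_on ?S \<times> ?X"
      by (subst summable_on_reindex_bij_betw[OF bij_append_lists[OF ij]]) (rule sym_tensor_summable[OF f])
    then show ?thesis by (simp add: a_def case_prod_beta')
  qed
  have "fin_contr N p q i j f = (\<Sum>s\<in>nat_lists N i \<times> nat_lists N j. \<Sum>s'\<in>nat_lists N i \<times> nat_lists N j. (cmod (\<Sum>x\<in>nat_lists N (p - i) \<times> nat_lists N (q - j). a x s * cnj (a x s')))\<^sup>2)"
    unfolding sum_Times fin_contr_def a_def by simp
  also have "\<dots> \<le> (\<Sum>\<^sub>\<infinity>(s, s')\<in>?S \<times> ?S. (cmod (\<Sum>\<^sub>\<infinity>x\<in>?X. a x s * cnj (a x s')))\<^sup>2)"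
    by (rule gram_le_infsum[OF sm]) (simp, (force simp: nat_lists_def idx_lists_def)[1], simp, (force simp: nat_lists_def idx_lists_def)[1])
  also have "\<dots> = (\<Sum>\<^sub>\<infinity>t\<in>?S \<times> ?S. (\<lambda>(xs, ys). (cmod (contr p q (p - i) (q - j) f (rev_cnj f) xs ys))\<^sup>2)
       ((\<lambda>((us, vs), (us', vs')). (us @ vs', vs @ us')) t))"
  proof (rule infsum_cong)
    fix t assume t: "t \<in> ?S \<times> ?S"
    obtain us vs us' vs' where e: "t = ((us, vs), (us', vs'))" by (metis surj_pair)
    have l: "length us = i" "length vs = j" "length us' = i" "length vs' = j" using t e by (auto simp: idx_lists_def)
    have "(\<Sum>\<^sub>\<infinity>x\<in>?X. a x (us, vs) * cnj (a x (us', vs'))) = contr p q (p - i) (q - j) f (rev_cnj f) (us @ vs') (vs @ us')"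
      unfolding contr_def
    proof (rule infsum_cong)
      fix x assume x: "x \<in> ?X"
      obtain ks ls where xe: "x = (ks, ls)" by (cases x)
      have lx: "length ks = p - i" "length ls = q - j" using x xe by (auto simp: idx_lists_def)
      \<comment> \<open>\<open>contr\<close> puts the contracted slots last,
        \<open>fin_contr\<close> puts them in front; the symmetry of \<open>f\<close> reconciles the
        two conventions.\<close>
      have 1: "f (ks @ us) (ls @ vs) = f (us @ ks) (vs @ ls)" and 2: "f (ks @ us') (ls @ vs') = f (us' @ ks) (vs' @ ls)"
        by (rule sym_tensorD[OF f]; use l lx ij in simp)+
      show "a x (us, vs) * cnj (a x (us', vs')) = (case x of (ks, ls) \<Rightarrow>
          f (take (p - (p - i)) (us @ vs') @ ks) (take (q - (q - j)) (vs @ us') @ ls) *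
          rev_cnj f (drop (p - (p - i)) (us @ vs') @ ls) (drop (q - (q - j)) (vs @ us') @ ks))"
        using ij l by (simp add: xe a_def 1 2 rev_cnj_def)
    qed
    then show "(case t of (s, s') \<Rightarrow> (cmod (\<Sum>\<^sub>\<infinity>x\<in>?X. a x s * cnj (a x s')))\<^sup>2) =
       (\<lambda>(xs, ys). (cmod (contr p q (p - i) (q - j) f (rev_cnj f) xs ys))\<^sup>2) ((\<lambda>((us, vs), (us', vs')). (us @ vs', vs @ us')) t)"
      by (simp add: e)
  qed
  also have "\<dots> = (\<Sum>\<^sub>\<infinity>(xs, ys)\<in>idx_lists (i + j) (j + i). (cmod (contr p q (p - i) (q - j) f (rev_cnj f) xs ys))\<^sup>2)"
  proof (rule infsum_reindex_bij_betw)
    show "bij_betw (\<lambda>((us, vs), (us', vs')). (us @ vs', vs @ us')) (?S \<times> ?S) (idx_lists (i + j) (j + i))"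
      by (rule bij_betwI[where g="\<lambda>(xs, ys). ((take i xs, take j ys), (drop j ys, drop i xs))"]) (auto simp: idx_lists_def)
  qed
  finally show ?thesis unfolding tnorm2_def .
qed

lemma self_contr_cmult: "self_contr N a r (\<lambda>ds. c * g ds) = (cmod c)^4 * self_contr N a r g"
proof -
  have "(\<Sum>x\<in>dir_lists N a. (c * g (x @ s)) * cnj (c * g (x @ s'))) = (c * cnj c) * (\<Sum>x\<in>dir_lists N a. g (x @ s) * cnj (g (x @ s')))" for s s'
    by (simp add: sum_distrib_left mult_ac)
  then have "(cmod (\<Sum>x\<in>dir_lists N a. (c * g (x @ s)) * cnj (c * g (x @ s'))))\<^sup>2
      = (cmod c)^4 * (cmod (\<Sum>x\<in>dir_lists N a. g (x @ s) * cnj (g (x @ s'))))\<^sup>2" for s s'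
    by (simp only: norm_mult complex_mod_cnj power_mult_distrib) (simp only: power_add[symmetric] numeral_plus_numeral add_num_simps)
  then show ?thesis
    unfolding self_contr_def by (simp only: sum_distrib_left)
qed

lemma self_contr_cnj: "self_contr N a r (\<lambda>ds. cnj (g (map star ds))) = self_contr N a r g"
proof -
  have "(\<Sum>x\<in>dir_lists N a. cnj (g (map star (x @ s))) * cnj (cnj (g (map star (x @ s')))))
      = cnj (\<Sum>x\<in>dir_lists N a. g (x @ map star s) * cnj (g (x @ map star s')))" for s s'
    unfolding cnj_sum by (subst sum_dir_lists_star[symmetric]) simp
  then have "self_contr N a r (\<lambda>ds. cnj (g (map star ds))) =
     (\<Sum>s\<in>dir_lists N r. \<Sum>s'\<in>dir_lists N r. (cmod (\<Sum>x\<in>dir_lists N a. g (x @ map star s) * cnj (g (x @ map star s'))))\<^sup>2)"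
    unfolding self_contr_def by (simp only: complex_mod_cnj)
  also have "\<dots> = self_contr N a r g"
    unfolding self_contr_def
    by (subst sum_dir_lists_star[of _ N r, symmetric], rule sum.cong[OF refl], subst sum_dir_lists_star[of _ N r, symmetric], rule refl)
  finally show ?thesis .
qed

text \<open>A bound for the self-contractions of \<open>gker\<close> that no longer involves the
  truncation. For \<open>r = p + q\<close> nothing is contracted and the square of
  \<open>tnorm2\<close> stands in; for \<open>0 < r < p + q\<close> the entries are the norms that
  occur in \<open>contr_lim\<close>.\<close>

definition contr_bound :: "nat \<Rightarrow> nat \<Rightarrow> (nat list \<Rightarrow> nat list \<Rightarrow> complex) \<Rightarrow> nat \<Rightarrow> real" where
  "contr_bound p q f r = (\<Sum>i\<le>r. if i \<le> p \<and> r - i \<le> q then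
     (real (r choose i) * real ((p + q - r) choose (p - i)) / (real ((p + q) choose p))\<^sup>2)\<^sup>2 *
     (if r = p + q then (tnorm2 p q f)\<^sup>2 else tnorm2 r r (contr p q (p - i) (q - (r - i)) f (rev_cnj f))) else 0)"

lemma fin_norm2_nonneg: "fin_norm2 N p q f \<ge> 0"
  unfolding fin_norm2_def by (intro sum_nonneg) simp

lemma self_contr_gker_le:
  assumes f: "sym_tensor p q f" and r: "r \<le> p + q"
  shows "self_contr N (p + q - r) r (gker p q f) \<le> contr_bound p q f r"
  unfolding self_contr_gker[OF r] contr_bound_def
proof (rule sum_mono)
  fix i assume i: "i \<in> {..r}"
  have "fin_contr N p q i (r - i) f \<le> (if r = p + q then (tnorm2 p q f)\<^sup>2 else tnorm2 r r (contr p q (p - i) (q - (r - i)) f (rev_cnj f)))"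
    if ij: "i \<le> p" "r - i \<le> q"
  proof (cases "r = p + q")
    case True
    then have "i = p" "r - i = q" using ij i by auto
    then show ?thesis using True fin_contr_full[of N p q f] power_mono[OF fin_norm2_le[OF f] fin_norm2_nonneg, of N 2] by simp
  next
    case False
    then show ?thesis using fin_contr_le[OF f ij, of N] i by simp
  qed
  then show "(if i \<le> p \<and> r - i \<le> q then
       (real (r choose i) * real ((p + q - r) choose (p - i)) / (real ((p + q) choose p))\<^sup>2)\<^sup>2 * fin_contr N p q i (r - i) f else 0)
     \<le> (if i \<le> p \<and> r - i \<le> q then
     (real (r choose i) * real ((p + q - r) choose (p - i)) / (real ((p + q) choose p))\<^sup>2)\<^sup>2 *
     (if r = p + q then (tnorm2 p q f)\<^sup>2 else tnorm2 r r (contr p q (p - i) (q - (r - i)) f (rev_cnj f))) else 0)"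
    by (auto intro!: mult_left_mono)
qed

section \<open>Characteristic functions of truncated chaos sums\<close>

definition chaos_sum :: "nat \<Rightarrow> (nat \<times> nat) set \<Rightarrow> (nat \<Rightarrow> nat \<Rightarrow> nat list \<Rightarrow> nat list \<Rightarrow> complex) \<Rightarrow> gfun" where
  "chaos_sum N Q f = (\<lambda>z. \<Sum>(p, q)\<in>Q. wick_int N (p + q) (gker p q (f p q)) z)"

lemma smooth_chaos_sum: "smooth (chaos_sum N Q f)"
  unfolding chaos_sum_def case_prod_beta' by (intro smooth_sum smooth_wick_int)

lemma n2_chaos_sum:
  assumes fin: "finite Q" and f: "\<And>p q. (p, q) \<in> Q \<Longrightarrow> sym_tensor p q (f p q)"
  shows "n2 (chaos_sum N Q f) = (\<Sum>(p, q)\<in>Q. fact p * fact q * fin_norm2 N p q (f p q))"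
proof -
  define X where "X = (\<lambda>t. wick_int N (fst t + snd t) (gker (fst t) (snd t) (f (fst t) (snd t))))"
  have sX: "smooth (X t)" for t unfolding X_def by (rule smooth_wick_int)
  have o: "EE (\<lambda>z. X s z * cnj (X t z)) = (if s = t then of_real (n2 (X t)) else 0)" if "t \<in> Q" for s t
    using EE_gker_orth[OF f, of "fst t" "snd t" "fst s" "snd s" N "f (fst s) (snd s)"] that
    by (auto simp: n2_EE X_def prod_eq_iff)
  have "complex_of_real (n2 (chaos_sum N Q f)) = EE (\<lambda>z. \<Sum>s\<in>Q. \<Sum>t\<in>Q. X s z * cnj (X t z))"
    unfolding n2_EE[symmetric] chaos_sum_def X_def by (simp add: sum_product case_prod_beta')
  also have "\<dots> = (\<Sum>s\<in>Q. \<Sum>t\<in>Q. EE (\<lambda>z. X s z * cnj (X t z)))"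
    by (simp add: EE_sum smooth_sum smooth.mult smooth_cnj sX)
  also have "\<dots> = (\<Sum>s\<in>Q. \<Sum>t\<in>Q. if s = t then of_real (n2 (X t)) else 0)"
    by (intro sum.cong refl o)
  also have "\<dots> = of_real (\<Sum>t\<in>Q. n2 (X t))" using fin by simp
  finally have "n2 (chaos_sum N Q f) = (\<Sum>t\<in>Q. n2 (X t))" using of_real_eq_iff by blast
  also have "\<dots> = (\<Sum>(p, q)\<in>Q. fact p * fact q * fin_norm2 N p q (f p q))"
    unfolding case_prod_beta' X_def by (intro sum.cong refl n2_wick_int_gker f) auto
  finally show ?thesis .
qed

text \<open>The real part of \<open>cnj u * X\<close> is half of it plus half of its conjugate, and
  both halves are integrals of the same order. The flag selects the conjugated half, whose kernel is
  read at starred directions.\<close>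

definition clt_kernel :: "complex \<Rightarrow> (nat \<Rightarrow> nat \<Rightarrow> nat list \<Rightarrow> nat list \<Rightarrow> complex) \<Rightarrow> (nat \<times> nat) \<times> bool \<Rightarrow> dir list \<Rightarrow> complex" where
  "clt_kernel u f = (\<lambda>((p, q), b) ds. if b then u / 2 * cnj (gker p q (f p q) (map star ds)) else cnj u / 2 * gker p q (f p q) ds)"

text \<open>The constant of \<open>Gam_wick_int_variance\<close>, fixed by choice so that the
  variance bound becomes one function of the kernels along which limits in \<open>n\<close> can be
  taken.\<close>

definition gam_const :: "nat \<Rightarrow> nat \<Rightarrow> real" where
  "gam_const m k = (SOME C. C \<ge> 0 \<and> (\<forall>N g h. symk g \<longrightarrow> symk h \<longrightarrow>
     n2 (\<lambda>z. Gam N (wick_int N m g) (wick_int N k h) z - EE (Gam N (wick_int N m g) (wick_int N k h)))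
       \<le> C * (\<Sum>r\<in>{r. 1 \<le> r \<and> r \<le> m \<and> r \<le> k \<and> (r < m \<or> r < k)}. contr_norm N (m - r) (k - r) r g h)))"

lemma gam_const:
  assumes "m \<ge> 1" "k \<ge> 1"
  shows "gam_const m k \<ge> 0"
    and "symk g \<Longrightarrow> symk h \<Longrightarrow> n2 (\<lambda>z. Gam N (wick_int N m g) (wick_int N k h) z - EE (Gam N (wick_int N m g) (wick_int N k h)))
       \<le> gam_const m k * (\<Sum>r\<in>{r. 1 \<le> r \<and> r \<le> m \<and> r \<le> k \<and> (r < m \<or> r < k)}. contr_norm N (m - r) (k - r) r g h)"
  using someI_ex[OF Gam_wick_int_variance[OF assms]] unfolding gam_const_def by blast+

definition pair_bound :: "complex \<Rightarrow> (nat \<Rightarrow> nat \<Rightarrow> nat list \<Rightarrow> nat list \<Rightarrow> complex) \<Rightarrow> nat \<times> nat \<Rightarrow> nat \<times> nat \<Rightarrow> real" where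
  "pair_bound u f = (\<lambda>(p, q) (p', q'). gam_const (p + q) (p' + q') *
     (\<Sum>r\<in>{r. 1 \<le> r \<and> r \<le> p + q \<and> r \<le> p' + q' \<and> (r < p + q \<or> r < p' + q')}.
        sqrt ((cmod u / 2)^4 * contr_bound p q (f p q) r) * sqrt ((cmod u / 2)^4 * contr_bound p' q' (f p' q') r)))"

text \<open>The two halves of every chaos enter \<open>cf_gaussian_bound\<close> as separate
  eigenvectors, indexed by a type and a flag. The right-hand side does not depend on
  \<open>N\<close>, so it survives the removal of the truncation.\<close>

lemma chaos_cf_bound:
  fixes N :: nat and u :: complex
  assumes fin: "finite Q" and Q: "\<And>p q. (p, q) \<in> Q \<Longrightarrow> 1 \<le> p + q"
    and f: "\<And>p q. (p, q) \<in> Q \<Longrightarrow> sym_tensor p q (f p q)"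
  defines "R \<equiv> \<lambda>z. of_real (Re (cnj u * chaos_sum N Q f z))"
  shows "cmod (EE (\<lambda>z. exp (\<i> * R z)) - of_real (exp (- n2 R / 2)))
     \<le> (\<Sum>j\<in>Q \<times> (UNIV::bool set). \<Sum>k\<in>Q \<times> (UNIV::bool set). sqrt (pair_bound u f (fst j) (fst k)))"
proof -
  let ?J = "Q \<times> (UNIV :: bool set)"
  define g where "g = clt_kernel u f"
  define m where "m j = fst (fst j) + snd (fst j)" for j :: "(nat \<times> nat) \<times> bool"
  define Y where "Y = (\<lambda>j. wick_int N (m j) (g j))"
  have sg: "symk (g j)" if "j \<in> ?J" for j
  proof -
    obtain p q b where j: "j = ((p, q), b)" by (metis surj_pair)
    have s: "symk (gker p q (f p q))" using that j f by (intro symk_gker) auto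
    show ?thesis
    proof (rule symkI)
      fix ds ds' :: "dir list" assume m: "mset ds = mset ds'"
      have "gker p q (f p q) ds = gker p q (f p q) ds'" by (rule symkD[OF s m])
      moreover have "cnj (gker p q (f p q) (map star ds)) = cnj (gker p q (f p q) (map star ds'))"
        by (rule symkD[OF symk_cnj[OF s] m])
      ultimately show "g j ds = g j ds'" by (simp add: g_def clt_kernel_def j)
    qed
  qed
  have m1: "m j \<ge> 1" if "j \<in> ?J" for j using Q that by (auto simp: m_def)
  have Rsum: "R z = (\<Sum>j\<in>?J. Y j z)" for z
  proof -
    have Yt: "Y ((p, q), True) z = cnj (cnj u / 2 * wick_int N (p + q) (gker p q (f p q)) z)" for p q
    proof -
      have "Y ((p, q), True) z = wick_int N (p + q) (\<lambda>ds. u / 2 * cnj (gker p q (f p q) (map star ds))) z"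
        by (simp only: Y_def g_def m_def clt_kernel_def prod.case fst_conv snd_conv if_True)
      then show ?thesis by (simp only: wick_int_cmult) (simp add: wick_int_cnj)
    qed
    have Yf: "Y ((p, q), False) z = cnj u / 2 * wick_int N (p + q) (gker p q (f p q)) z" for p q
    proof -
      have "Y ((p, q), False) z = wick_int N (p + q) (\<lambda>ds. cnj u / 2 * gker p q (f p q) ds) z"
        by (simp only: Y_def g_def m_def clt_kernel_def prod.case fst_conv snd_conv if_False)
      then show ?thesis by (simp only: wick_int_cmult)
    qed
    have "(\<Sum>j\<in>?J. Y j z) = (\<Sum>t\<in>Q. Y (t, False) z + Y (t, True) z)"
      unfolding sum_Times by (simp add: UNIV_bool)
    also have "\<dots> = (\<Sum>t\<in>Q. of_real (2 * Re (cnj u / 2 * wick_int N (fst t + snd t) (gker (fst t) (snd t) (f (fst t) (snd t))) z)))"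
    proof (rule sum.cong[OF refl])
      fix t assume "t \<in> Q"
      obtain p q where t: "t = (p, q)" by (cases t)
      show "Y (t, False) z + Y (t, True) z = of_real (2 * Re (cnj u / 2 * wick_int N (fst t + snd t) (gker (fst t) (snd t) (f (fst t) (snd t))) z))"
        unfolding t Yt Yf complex_add_cnj fst_conv snd_conv ..
    qed
    also have "\<dots> = R z"
    proof -
      have "2 * Re (cnj u / 2 * X) = Re (cnj u * X)" for X by (simp add: field_simps)
      then show ?thesis
        unfolding R_def chaos_sum_def case_prod_beta' sum_distrib_left Re_sum of_real_sum by (simp only:)
    qed
    finally show ?thesis by simp
  qed
  have "cmod (EE (\<lambda>z. exp (\<i> * (\<Sum>j\<in>?J. Y j z))) - of_real (exp (- n2 (\<lambda>z. \<Sum>j\<in>?J. Y j z) / 2)))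
     \<le> (\<Sum>j\<in>?J. \<Sum>k\<in>?J. sqrt (n2 (\<lambda>z. Gam N (Y j) (Y k) z - EE (Gam N (Y j) (Y k)))))"
  proof (rule cf_gaussian_bound[where m=m])
    show "eig N (m j) (Y j)" for j unfolding Y_def by (rule eig_wick_int)
    show "(\<Sum>j\<in>?J. Y j z) \<in> \<real>" for z unfolding Rsum[symmetric] R_def by simp
  qed (rule m1)
  also have "\<dots> \<le> (\<Sum>j\<in>?J. \<Sum>k\<in>?J. sqrt (pair_bound u f (fst j) (fst k)))"
  proof (intro sum_mono real_sqrt_le_mono)
    fix j k assume jk: "j \<in> ?J" "k \<in> ?J"
    have sc: "self_contr N (m j - r) r (g j) \<le> (cmod u / 2)^4 * contr_bound (fst (fst j)) (snd (fst j)) (f (fst (fst j)) (snd (fst j))) r"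
      if "j \<in> ?J" "r \<le> m j" for j r
    proof -
      obtain p q b where j: "j = ((p, q), b)" by (metis surj_pair)
      have "self_contr N (p + q - r) r (g j) = (cmod u / 2)^4 * self_contr N (p + q - r) r (gker p q (f p q))"
        unfolding g_def clt_kernel_def j
        using self_contr_cmult[of N "p + q - r" r "u / 2" "\<lambda>ds. cnj (gker p q (f p q) (map star ds))"]
          self_contr_cmult[of N "p + q - r" r "cnj u / 2" "gker p q (f p q)"] self_contr_cnj[of N "p + q - r" r "gker p q (f p q)"]
        by (cases b) (simp_all add: norm_divide)
      also have "\<dots> \<le> (cmod u / 2)^4 * contr_bound p q (f p q) r"
        using that j f by (intro mult_left_mono self_contr_gker_le) (auto simp: m_def)
      finally show ?thesis by (simp add: j m_def)
    qed
    have "n2 (\<lambda>z. Gam N (Y j) (Y k) z - EE (Gam N (Y j) (Y k))) \<le> gam_const (m j) (m k) *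
        (\<Sum>r\<in>{r. 1 \<le> r \<and> r \<le> m j \<and> r \<le> m k \<and> (r < m j \<or> r < m k)}. contr_norm N (m j - r) (m k - r) r (g j) (g k))"
      unfolding Y_def by (intro gam_const(2) m1 sg jk)
    also have "\<dots> \<le> pair_bound u f (fst j) (fst k)"
      unfolding pair_bound_def case_prod_beta' m_def[symmetric]
    proof (intro mult_left_mono gam_const(1) m1 jk sum_mono)
      fix r assume r: "r \<in> {r. 1 \<le> r \<and> r \<le> m j \<and> r \<le> m k \<and> (r < m j \<or> r < m k)}"
      have "contr_norm N (m j - r) (m k - r) r (g j) (g k) \<le> sqrt (self_contr N (m j - r) r (g j)) * sqrt (self_contr N (m k - r) r (g k))"
        by (rule contr_norm_le)
      also have "\<dots> \<le> sqrt ((cmod u / 2)^4 * contr_bound (fst (fst j)) (snd (fst j)) (f (fst (fst j)) (snd (fst j))) r) *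
          sqrt ((cmod u / 2)^4 * contr_bound (fst (fst k)) (snd (fst k)) (f (fst (fst k)) (snd (fst k))) r)"
        using r self_contr_nonneg by (intro mult_mono real_sqrt_le_mono sc jk) (auto simp: contr_norm_nonneg self_contr_nonneg intro: order_trans[OF self_contr_nonneg sc[OF jk(1)]])
      finally show "contr_norm N (m j - r) (m k - r) r (g j) (g k) \<le>
         sqrt ((cmod u / 2)^4 * contr_bound (fst (fst j)) (snd (fst j)) (f (fst (fst j)) (snd (fst j))) r) *
          sqrt ((cmod u / 2)^4 * contr_bound (fst (fst k)) (snd (fst k)) (f (fst (fst k)) (snd (fst k))) r)" .
    qed
    finally show "n2 (\<lambda>z. Gam N (Y j) (Y k) z - EE (Gam N (Y j) (Y k))) \<le> pair_bound u f (fst j) (fst k)" .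
  qed
  finally show ?thesis unfolding Rsum[abs_def] .
qed

text \<open>From \<open>(Re w)^2 = (|w|^2 + Re (w^2)) / 2\<close>. The expectation of
  \<open>V^2\<close> is isolated because the hypothesis \<open>orth\<close> makes it vanish in the
  limit; the variance then depends on \<open>c\<close> through its modulus alone, which is
  circularity.\<close>

lemma n2_Re:
  assumes V: "smooth V"
  shows "n2 (\<lambda>z. of_real (Re (c * V z))) = ((cmod c)\<^sup>2 * n2 V + Re (c\<^sup>2 * EE (\<lambda>z. V z * V z))) / 2"
proof -
  have e: "(Re w)\<^sup>2 = ((cmod w)\<^sup>2 + Re (w * w)) / 2" for w
  proof -
    have "(cmod w)\<^sup>2 = (Re w)\<^sup>2 + (Im w)\<^sup>2" by (rule cmod_power2)
    moreover have "Re (w * w) = (Re w)\<^sup>2 - (Im w)\<^sup>2" by (simp add: power2_eq_square)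
    ultimately show ?thesis by simp
  qed
  have "n2 (\<lambda>z. of_real (Re (c * V z))) = (\<integral>z. ((cmod (c * V z))\<^sup>2 + Re ((c * V z) * (c * V z))) / 2 \<partial>GP)"
  proof -
    have "(cmod (complex_of_real (Re (c * V z))))\<^sup>2 = ((cmod (c * V z))\<^sup>2 + Re ((c * V z) * (c * V z))) / 2" for z
      using e[of "c * V z"] by (simp only: norm_of_real power2_abs)
    then show ?thesis unfolding n2_def by (simp only:)
  qed
  also have "\<dots> = ((\<integral>z. (cmod (c * V z))\<^sup>2 \<partial>GP) + (\<integral>z. Re ((c * V z) * (c * V z)) \<partial>GP)) / 2"
    using V by (subst Bochner_Integration.integral_divide_zero, subst Bochner_Integration.integral_add)
      (auto intro!: smooth_sq_integrable smooth_cmult integrable_Re smooth_integrable smooth.mult simp del: times_complex.sel)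
  also have "(\<integral>z. (cmod (c * V z))\<^sup>2 \<partial>GP) = (cmod c)\<^sup>2 * n2 V"
    using n2_cmult[of c V] by (simp add: n2_def)
  also have "(\<integral>z. Re ((c * V z) * (c * V z)) \<partial>GP) = Re (EE (\<lambda>z. (c * V z) * (c * V z)))"
    unfolding EE_def using V by (intro integral_Re smooth_integrable smooth.mult smooth_cmult)
  also have "EE (\<lambda>z. (c * V z) * (c * V z)) = c\<^sup>2 * EE (\<lambda>z. V z * V z)"
    using EE_cmult[of "c\<^sup>2" "\<lambda>z. V z * V z"] by (simp add: power2_eq_square mult_ac)
  finally show ?thesis .
qed

text \<open>A limit is asserted for \<open>r = p + q\<close> as well, where it need not be 0: in
  \<open>pair_bound\<close> such a factor always stands next to a vanishing one and only has to stay
  bounded.\<close>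

lemma contr_bound_tendsto:
  assumes pq: "1 \<le> p + q"
    and t: "(\<lambda>n. tnorm2 p q (f n)) \<longlonglongrightarrow> l"
    and c: "\<And>i j. 2 \<le> p + q \<Longrightarrow> i \<le> p \<Longrightarrow> j \<le> q \<Longrightarrow> 0 < i + j \<Longrightarrow> i + j < p + q \<Longrightarrow>
       (\<lambda>n. tnorm2 (p + q - i - j) (q + p - i - j) (contr p q i j (f n) (rev_cnj (f n)))) \<longlonglongrightarrow> 0"
    and r: "1 \<le> r" "r \<le> p + q"
  shows "\<exists>b. (\<lambda>n. contr_bound p q (f n) r) \<longlonglongrightarrow> b \<and> (r < p + q \<longrightarrow> b = 0)"
proof (cases "r = p + q")
  case True
  have "(\<lambda>n. contr_bound p q (f n) r) \<longlonglongrightarrow> (\<Sum>i\<le>r. if i \<le> p \<and> r - i \<le> q then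
     (real (r choose i) * real ((p + q - r) choose (p - i)) / (real ((p + q) choose p))\<^sup>2)\<^sup>2 * l\<^sup>2 else 0)"
    unfolding contr_bound_def if_P[OF True]
  proof (rule tendsto_sum)
    fix i
    show "(\<lambda>n. if i \<le> p \<and> r - i \<le> q then
        (real (r choose i) * real ((p + q - r) choose (p - i)) / (real ((p + q) choose p))\<^sup>2)\<^sup>2 * (tnorm2 p q (f n))\<^sup>2 else 0)
      \<longlonglongrightarrow> (if i \<le> p \<and> r - i \<le> q then
        (real (r choose i) * real ((p + q - r) choose (p - i)) / (real ((p + q) choose p))\<^sup>2)\<^sup>2 * l\<^sup>2 else 0)"
    proof (cases "i \<le> p \<and> r - i \<le> q")
      case True
      show ?thesis unfolding if_P[OF True] by (intro tendsto_intros t)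
    next
      case False
      show ?thesis unfolding if_not_P[OF False] by (rule tendsto_const)
    qed
  qed
  then show ?thesis using True by blast
next
  case False
  have "(\<lambda>n. contr_bound p q (f n) r) \<longlonglongrightarrow> (\<Sum>i\<le>r. 0)"
    unfolding contr_bound_def if_not_P[OF False]
  proof (rule tendsto_sum)
    fix i assume i: "i \<in> {..r}"
    show "(\<lambda>n. if i \<le> p \<and> r - i \<le> q then
       (real (r choose i) * real ((p + q - r) choose (p - i)) / (real ((p + q) choose p))\<^sup>2)\<^sup>2 *
       tnorm2 r r (contr p q (p - i) (q - (r - i)) (f n) (rev_cnj (f n))) else 0) \<longlonglongrightarrow> 0"
    proof (cases "i \<le> p \<and> r - i \<le> q")
      case True
      have e: "p + q - (p - i) - (q - (r - i)) = r" "q + p - (p - i) - (q - (r - i)) = r" using True i by auto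
      have "(\<lambda>n. tnorm2 r r (contr p q (p - i) (q - (r - i)) (f n) (rev_cnj (f n)))) \<longlonglongrightarrow> 0"
        using c[of "p - i" "q - (r - i)"] True i r False unfolding e by auto
      then show ?thesis using True by (auto intro: tendsto_mult_right_zero)
    qed auto
  qed
  then show ?thesis by (auto intro!: exI[of _ 0])
qed

lemma chaos_cf_tendsto:
  assumes fin: "finite Q" and Q: "\<And>p q. (p, q) \<in> Q \<Longrightarrow> 1 \<le> p + q"
    and f: "\<And>n p q. (p, q) \<in> Q \<Longrightarrow> sym_tensor p q (f n p q)"
    and t: "\<And>p q. (p, q) \<in> Q \<Longrightarrow> (\<lambda>n. tnorm2 p q (f n p q)) \<longlonglongrightarrow> l p q"
    and c: "\<And>p q i j. (p, q) \<in> Q \<Longrightarrow> 2 \<le> p + q \<Longrightarrow> i \<le> p \<Longrightarrow> j \<le> q \<Longrightarrow> 0 < i + j \<Longrightarrow> i + j < p + q \<Longrightarrow>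
       (\<lambda>n. tnorm2 (p + q - i - j) (q + p - i - j) (contr p q i j (f n p q) (rev_cnj (f n p q)))) \<longlonglongrightarrow> 0"
  shows "(\<lambda>n. \<Sum>j\<in>Q \<times> (UNIV::bool set). \<Sum>k\<in>Q \<times> (UNIV::bool set). sqrt (pair_bound u (f n) (fst j) (fst k))) \<longlonglongrightarrow> 0"
proof -
  have pb: "(\<lambda>n. pair_bound u (f n) s t) \<longlonglongrightarrow> 0" if st: "s \<in> Q" "t \<in> Q" for s t
  proof -
    obtain p q p' q' where e: "s = (p, q)" "t = (p', q')" by (metis surj_pair)
    have "(\<lambda>n. pair_bound u (f n) s t) \<longlonglongrightarrow> gam_const (p + q) (p' + q') *
      (\<Sum>r\<in>{r. 1 \<le> r \<and> r \<le> p + q \<and> r \<le> p' + q' \<and> (r < p + q \<or> r < p' + q')}. 0)"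
      unfolding pair_bound_def e prod.case
    proof (intro tendsto_mult tendsto_const tendsto_sum)
      fix r assume r: "r \<in> {r. 1 \<le> r \<and> r \<le> p + q \<and> r \<le> p' + q' \<and> (r < p + q \<or> r < p' + q')}"
      obtain b where b: "(\<lambda>n. contr_bound p q (f n p q) r) \<longlonglongrightarrow> b" "r < p + q \<Longrightarrow> b = 0"
        using contr_bound_tendsto[of p q "\<lambda>n. f n p q" "l p q" r] Q t c st e r by blast
      obtain b' where b': "(\<lambda>n. contr_bound p' q' (f n p' q') r) \<longlonglongrightarrow> b'" "r < p' + q' \<Longrightarrow> b' = 0"
        using contr_bound_tendsto[of p' q' "\<lambda>n. f n p' q'" "l p' q'" r] Q t c st e r by blast
      have "(\<lambda>n. sqrt ((cmod u / 2)^4 * contr_bound p q (f n p q) r) * sqrt ((cmod u / 2)^4 * contr_bound p' q' (f n p' q') r))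
         \<longlonglongrightarrow> sqrt ((cmod u / 2)^4 * b) * sqrt ((cmod u / 2)^4 * b')"
        by (intro tendsto_intros b(1) b'(1))
      \<comment> \<open>The index \<open>r\<close> lies strictly below at least one of the two
        orders, and the self-contraction of that kernel vanishes in the limit.\<close>
      moreover have "b = 0 \<or> b' = 0" using b(2) b'(2) r by auto
      ultimately show "(\<lambda>n. sqrt ((cmod u / 2)^4 * contr_bound p q (f n p q) r) * sqrt ((cmod u / 2)^4 * contr_bound p' q' (f n p' q') r)) \<longlonglongrightarrow> 0"
        by auto
    qed
    then show ?thesis by simp
  qed
  have "(\<lambda>n. \<Sum>j\<in>Q \<times> (UNIV::bool set). \<Sum>k\<in>Q \<times> (UNIV::bool set). sqrt (pair_bound u (f n) (fst j) (fst k))) \<longlonglongrightarrow> (\<Sum>j\<in>Q \<times> (UNIV::bool set). \<Sum>k\<in>Q \<times> (UNIV::bool set). sqrt 0)"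
    by (intro tendsto_sum tendsto_real_sqrt pb) auto
  then show ?thesis by simp
qed

text \<open>Restricting to \<open>K\<close> coordinates multiplies the kernel by the indicator of
  the lists in \<open>dirs K\<close>, an orthogonal projection, and the identity is Pythagoras. The
  indicator is symmetric, so the isometry applies to the cut-off kernel and to the
  difference.\<close>

lemma wick_int_diff_n2:
  assumes g: "symk g" and KN: "K \<le> N"
  shows "n2 (\<lambda>z. wick_int N m g z - wick_int K m g z) = n2 (wick_int N m g) - n2 (wick_int K m g)"
proof -
  define h where "h = (\<lambda>ds. if set ds \<subseteq> dirs K then g ds else 0)"
  have sub: "dir_lists K m \<subseteq> dir_lists N m" using KN by (auto simp: dir_lists_def dirs_def)
  have h: "symk h"
  proof (rule symkI)
    fix ds ds' :: "dir list" assume m: "mset ds = mset ds'"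
    then have "set ds = set ds'" by (rule mset_eq_setD)
    then show "h ds = h ds'" using symkD[OF g m] by (simp add: h_def)
  qed
  have K: "wick_int K m g z = wick_int N m h z" for z
  proof -
    have "wick_int N m h z = (\<Sum>ds\<in>dir_lists K m. h ds * wick ds z)"
      unfolding wick_int_def
    proof (rule sum.mono_neutral_right[OF finite_dir_lists sub])
      show "\<forall>ds\<in>dir_lists N m - dir_lists K m. h ds * wick ds z = 0" by (auto simp: h_def dir_lists_def)
    qed
    then show ?thesis by (simp add: wick_int_def h_def dir_lists_def)
  qed
  have n: "complex_of_real (n2 (wick_int N m k)) = fact m * (\<Sum>ds\<in>dir_lists N m. k ds * cnj (k ds))" if "symk k" for k
    unfolding n2_EE[symmetric] by (simp add: EE_wick_int_cnj[OF that])
  have gh: "symk (\<lambda>ds. g ds - h ds)"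
    by (rule symkI) (metis symkD g h)
  have "(\<lambda>z. wick_int N m g z - wick_int K m g z) = wick_int N m (\<lambda>ds. g ds - h ds)"
    unfolding K by (simp add: wick_int_def fun_eq_iff sum_subtractf left_diff_distrib)
  then have "complex_of_real (n2 (\<lambda>z. wick_int N m g z - wick_int K m g z)) = fact m * (\<Sum>ds\<in>dir_lists N m. (g ds - h ds) * cnj (g ds - h ds))"
    using n[OF gh] by simp
  also have "\<dots> = fact m * (\<Sum>ds\<in>dir_lists N m. g ds * cnj (g ds) - h ds * cnj (h ds))"
    by (intro arg_cong2[where f="(*)"] sum.cong refl) (auto simp: h_def)
  also have "\<dots> = complex_of_real (n2 (wick_int N m g) - n2 (wick_int N m h))"
    using n[OF g] n[OF h] by (simp add: sum_subtractf right_diff_distrib)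
  finally have "n2 (\<lambda>z. wick_int N m g z - wick_int K m g z) = n2 (wick_int N m g) - n2 (wick_int N m h)" using of_real_eq_iff by blast
  moreover have "wick_int K m g = wick_int N m h" using K by auto
  ultimately show ?thesis by simp
qed

section \<open>Square integrable random variables\<close>

context prob_space
begin

definition l2 :: "('a \<Rightarrow> complex) \<Rightarrow> bool" where
  "l2 X \<longleftrightarrow> X \<in> borel_measurable M \<and> integrable M (\<lambda>\<omega>. (cmod (X \<omega>))\<^sup>2)"

definition l2n :: "('a \<Rightarrow> complex) \<Rightarrow> real" where
  "l2n X = (\<integral>\<omega>. (cmod (X \<omega>))\<^sup>2 \<partial>M)"

definition l2lim :: "(nat \<Rightarrow> 'a \<Rightarrow> complex) \<Rightarrow> ('a \<Rightarrow> complex) \<Rightarrow> bool" where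
  "l2lim XN X \<longleftrightarrow> (\<forall>N. l2 (XN N)) \<and> l2 X \<and> (\<lambda>N. l2n (\<lambda>\<omega>. XN N \<omega> - X \<omega>)) \<longlonglongrightarrow> 0"

lemma l2_measurable: "l2 X \<Longrightarrow> X \<in> borel_measurable M"
  by (simp add: l2_def)

lemma l2n_nonneg: "l2n X \<ge> 0"
  by (simp add: l2n_def)

lemma l2_add:
  assumes "l2 X" "l2 Y"
  shows "l2 (\<lambda>\<omega>. X \<omega> + Y \<omega>)" "l2n (\<lambda>\<omega>. X \<omega> + Y \<omega>) \<le> 2 * l2n X + 2 * l2n Y"
proof -
  have m: "X \<in> borel_measurable M" "Y \<in> borel_measurable M" using assms by (auto simp: l2_def)
  have i: "integrable M (\<lambda>\<omega>. 2 * (cmod (X \<omega>))\<^sup>2 + 2 * (cmod (Y \<omega>))\<^sup>2)"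
    using assms by (auto simp: l2_def)
  have i2: "integrable M (\<lambda>\<omega>. (cmod (X \<omega> + Y \<omega>))\<^sup>2)"
    by (rule Bochner_Integration.integrable_bound[OF i]) (use m cmod_add_sq_le in \<open>auto intro!: AE_I2\<close>)
  then show "l2 (\<lambda>\<omega>. X \<omega> + Y \<omega>)" using m by (simp add: l2_def)
  have "l2n (\<lambda>\<omega>. X \<omega> + Y \<omega>) \<le> (\<integral>\<omega>. 2 * (cmod (X \<omega>))\<^sup>2 + 2 * (cmod (Y \<omega>))\<^sup>2 \<partial>M)"
    unfolding l2n_def by (rule integral_mono[OF i2 i]) (rule cmod_add_sq_le)
  also have "\<dots> = 2 * l2n X + 2 * l2n Y"
    unfolding l2n_def using assms by (simp add: l2_def)
  finally show "l2n (\<lambda>\<omega>. X \<omega> + Y \<omega>) \<le> 2 * l2n X + 2 * l2n Y" .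
qed

lemma l2_cmult:
  assumes "l2 X"
  shows "l2 (\<lambda>\<omega>. c * X \<omega>)" "l2n (\<lambda>\<omega>. c * X \<omega>) = (cmod c)\<^sup>2 * l2n X"
  using assms by (auto simp: l2_def l2n_def norm_mult power_mult_distrib)

lemma l2_diff:
  assumes "l2 X" "l2 Y"
  shows "l2 (\<lambda>\<omega>. X \<omega> - Y \<omega>)"
  using l2_add(1)[OF assms(1) l2_cmult(1)[OF assms(2), of "-1"]] by simp

lemma l2_cnj: "l2 X \<Longrightarrow> l2 (\<lambda>\<omega>. cnj (X \<omega>))"
  unfolding l2_def by (auto intro: measurable_compose[OF _ borel_measurable_continuous_onI[OF continuous_on_cnj[OF continuous_on_id]]])

lemma l2_zero: "l2 (\<lambda>_. 0)" by (simp add: l2_def)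

lemma l2_mult_integrable:
  assumes "l2 X" "l2 Y"
  shows "integrable M (\<lambda>\<omega>. X \<omega> * Y \<omega>)"
proof (rule Bochner_Integration.integrable_bound)
  show "integrable M (\<lambda>\<omega>. (cmod (X \<omega>))\<^sup>2 + (cmod (Y \<omega>))\<^sup>2)" using assms by (auto simp: l2_def)
  show "AE \<omega> in M. norm (X \<omega> * Y \<omega>) \<le> norm ((cmod (X \<omega>))\<^sup>2 + (cmod (Y \<omega>))\<^sup>2)"
  proof (rule AE_I2)
    fix \<omega>
    have "2 * (cmod (X \<omega>) * cmod (Y \<omega>)) \<le> (cmod (X \<omega>))\<^sup>2 + (cmod (Y \<omega>))\<^sup>2"
      using sum_squares_bound[of "cmod (X \<omega>)" "cmod (Y \<omega>)"] by simp
    moreover have "0 \<le> cmod (X \<omega>) * cmod (Y \<omega>)" by simp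
    ultimately have "cmod (X \<omega>) * cmod (Y \<omega>) \<le> (cmod (X \<omega>))\<^sup>2 + (cmod (Y \<omega>))\<^sup>2" by linarith
    then show "norm (X \<omega> * Y \<omega>) \<le> norm ((cmod (X \<omega>))\<^sup>2 + (cmod (Y \<omega>))\<^sup>2)" by (simp add: norm_mult)
  qed
qed (use assms in \<open>auto simp: l2_def\<close>)

lemma l2_cauchy_schwarz:
  assumes X: "l2 X" and Y: "l2 Y"
  shows "(\<integral>\<omega>. cmod (X \<omega>) * cmod (Y \<omega>) \<partial>M) \<le> sqrt (l2n X) * sqrt (l2n Y)"
proof -
  define a b c where "a = l2n X" and "b = l2n Y" and "c = (\<integral>\<omega>. cmod (X \<omega>) * cmod (Y \<omega>) \<partial>M)"
  have iXY: "integrable M (\<lambda>\<omega>. cmod (X \<omega>) * cmod (Y \<omega>))"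
    using integrable_norm[OF l2_mult_integrable[OF X Y]] by (simp add: norm_mult)
  have i: "integrable M (\<lambda>\<omega>. (cmod (X \<omega>))\<^sup>2)" "integrable M (\<lambda>\<omega>. (cmod (Y \<omega>))\<^sup>2)" using X Y by (auto simp: l2_def)
  have c0: "c \<ge> 0" unfolding c_def by simp
  have q: "0 \<le> t\<^sup>2 * a - 2 * t * c + b" for t
  proof -
    have "0 \<le> (\<integral>\<omega>. (t * cmod (X \<omega>) - cmod (Y \<omega>))\<^sup>2 \<partial>M)" by simp
    also have "\<dots> = (\<integral>\<omega>. t\<^sup>2 * (cmod (X \<omega>))\<^sup>2 - 2 * t * (cmod (X \<omega>) * cmod (Y \<omega>)) + (cmod (Y \<omega>))\<^sup>2 \<partial>M)"
      by (simp add: power2_diff power_mult_distrib algebra_simps)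
    also have "\<dots> = t\<^sup>2 * a - 2 * t * c + b"
      unfolding a_def b_def c_def l2n_def using i iXY by simp
    finally show ?thesis .
  qed
  have "c\<^sup>2 \<le> a * b"
  proof (cases "a = 0")
    case True
    \<comment> \<open>For \<open>a = 0\<close> the quadratic form in \<open>t\<close> is affine, and
      its nonnegativity for all \<open>t\<close> forces the slope to vanish.\<close>
    have "c = 0"
    proof (rule ccontr)
      assume "c \<noteq> 0"
      then have "2 * ((b + 1) / (2 * c)) * c = b + 1" by simp
      then show False using q[of "(b + 1) / (2 * c)"] True by simp
    qed
    then show ?thesis using True by simp
  next
    case False
    then have a: "a > 0" using l2n_nonneg[of X] by (simp add: a_def)
    have "0 \<le> a * ((c / a)\<^sup>2 * a - 2 * (c / a) * c + b)" using q[of "c / a"] a by (intro mult_nonneg_nonneg) auto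
    also have "\<dots> = a * b - c\<^sup>2" using a by (simp add: field_simps power2_eq_square)
    finally show ?thesis by simp
  qed
  then have "c \<le> sqrt (a * b)" by (rule real_le_rsqrt)
  then show ?thesis unfolding a_def b_def c_def by (simp add: real_sqrt_mult)
qed

lemma l2_norm_mult_le:
  assumes X: "l2 X" and Y: "l2 Y"
  shows "cmod (\<integral>\<omega>. X \<omega> * Y \<omega> \<partial>M) \<le> sqrt (l2n X) * sqrt (l2n Y)"
  using order_trans[OF integral_norm_bound[of M "\<lambda>\<omega>. X \<omega> * Y \<omega>"] l2_cauchy_schwarz[OF X Y, folded norm_mult]] .

lemma l2_one: "l2 (\<lambda>_. 1)" "l2n (\<lambda>_. 1) = 1"
  by (simp_all add: l2_def l2n_def prob_space)

lemma l2_L1_le: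
  assumes X: "l2 X"
  shows "integrable M X" "(\<integral>\<omega>. cmod (X \<omega>) \<partial>M) \<le> sqrt (l2n X)"
  using l2_mult_integrable[OF X l2_one(1)] l2_cauchy_schwarz[OF X l2_one(1)] by (simp_all add: l2_one)

lemma l2limD: "l2lim XN X \<Longrightarrow> l2 (XN N)" "l2lim XN X \<Longrightarrow> l2 X"
  by (auto simp: l2lim_def)

lemma l2lim_bounded:
  assumes "l2lim XN X"
  shows "(\<lambda>N. sqrt (l2n (\<lambda>\<omega>. XN N \<omega> - X \<omega>))) \<longlonglongrightarrow> 0"
  using tendsto_real_sqrt[of _ 0] assms by (auto simp: l2lim_def)

lemma l2lim_mult:
  assumes X: "l2lim XN X" and Y: "l2lim YN Y"
  shows "(\<lambda>N. \<integral>\<omega>. XN N \<omega> * YN N \<omega> \<partial>M) \<longlonglongrightarrow> (\<integral>\<omega>. X \<omega> * Y \<omega> \<partial>M)"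
proof -
  define DX where "DX = (\<lambda>N \<omega>. XN N \<omega> - X \<omega>)"
  define DY where "DY = (\<lambda>N \<omega>. YN N \<omega> - Y \<omega>)"
  have l: "l2 (DX N)" "l2 (DY N)" "l2 X" "l2 Y" for N
    unfolding DX_def DY_def using X Y by (auto intro: l2_diff l2limD)
  have i: "integrable M (\<lambda>\<omega>. DX N \<omega> * DY N \<omega>)" "integrable M (\<lambda>\<omega>. DX N \<omega> * Y \<omega>)"
    "integrable M (\<lambda>\<omega>. X \<omega> * DY N \<omega>)" "integrable M (\<lambda>\<omega>. X \<omega> * Y \<omega>)" for N
    by (intro l2_mult_integrable l)+
  have e: "(\<integral>\<omega>. XN N \<omega> * YN N \<omega> \<partial>M) = (\<integral>\<omega>. DX N \<omega> * DY N \<omega> \<partial>M) + (\<integral>\<omega>. DX N \<omega> * Y \<omega> \<partial>M) + (\<integral>\<omega>. X \<omega> * DY N \<omega> \<partial>M) + (\<integral>\<omega>. X \<omega> * Y \<omega> \<partial>M)" for N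
  proof -
    have "(\<lambda>\<omega>. XN N \<omega> * YN N \<omega>) = (\<lambda>\<omega>. DX N \<omega> * DY N \<omega> + DX N \<omega> * Y \<omega> + X \<omega> * DY N \<omega> + X \<omega> * Y \<omega>)"
      by (simp add: DX_def DY_def fun_eq_iff algebra_simps)
    then show ?thesis using i by simp
  qed
  have z: "(\<lambda>N. sqrt (l2n (DX N))) \<longlonglongrightarrow> 0" "(\<lambda>N. sqrt (l2n (DY N))) \<longlonglongrightarrow> 0"
    unfolding DX_def DY_def using X Y by (auto intro: l2lim_bounded)
  have "(\<lambda>N. \<integral>\<omega>. DX N \<omega> * DY N \<omega> \<partial>M) \<longlonglongrightarrow> 0"
    by (rule Lim_null_comparison[OF always_eventually[OF allI[OF l2_norm_mult_le[OF l(1) l(2)]]]])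
       (use tendsto_mult[OF z] in simp)
  moreover have "(\<lambda>N. \<integral>\<omega>. DX N \<omega> * Y \<omega> \<partial>M) \<longlonglongrightarrow> 0"
    by (rule Lim_null_comparison[OF always_eventually[OF allI[OF l2_norm_mult_le[OF l(1) l(4)]]]])
       (use tendsto_mult_left_zero[OF z(1)] in simp)
  moreover have "(\<lambda>N. \<integral>\<omega>. X \<omega> * DY N \<omega> \<partial>M) \<longlonglongrightarrow> 0"
    by (rule Lim_null_comparison[OF always_eventually[OF allI[OF l2_norm_mult_le[OF l(3) l(2)]]]])
       (use tendsto_mult_right_zero[OF z(2)] in simp)
  ultimately have "(\<lambda>N. \<integral>\<omega>. XN N \<omega> * YN N \<omega> \<partial>M) \<longlonglongrightarrow> 0 + 0 + 0 + (\<integral>\<omega>. X \<omega> * Y \<omega> \<partial>M)"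
    unfolding e by (intro tendsto_add tendsto_const)
  then show ?thesis by simp
qed

lemma l2lim_cnj:
  assumes "l2lim XN X"
  shows "l2lim (\<lambda>N \<omega>. cnj (XN N \<omega>)) (\<lambda>\<omega>. cnj (X \<omega>))"
proof -
  have "l2n (\<lambda>\<omega>. cnj (XN N \<omega>) - cnj (X \<omega>)) = l2n (\<lambda>\<omega>. XN N \<omega> - X \<omega>)" for N
    unfolding l2n_def complex_cnj_diff[symmetric] complex_mod_cnj ..
  then show ?thesis using assms by (auto simp: l2lim_def intro: l2_cnj)
qed

lemma l2n_complex: "(\<integral>\<omega>. X \<omega> * cnj (X \<omega>) \<partial>M) = of_real (l2n X)"
  unfolding l2n_def by (simp add: complex_norm_square[symmetric] del: of_real_power)

lemma l2lim_norm:
  assumes "l2lim XN X"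
  shows "(\<lambda>N. l2n (XN N)) \<longlonglongrightarrow> l2n X"
  using l2lim_mult[OF assms l2lim_cnj[OF assms]] unfolding l2n_complex tendsto_of_real_iff .

lemma l2lim_add:
  assumes X: "l2lim XN X" and Y: "l2lim YN Y"
  shows "l2lim (\<lambda>N \<omega>. XN N \<omega> + YN N \<omega>) (\<lambda>\<omega>. X \<omega> + Y \<omega>)"
  unfolding l2lim_def
proof (intro conjI allI l2_add)
  have e: "l2n (\<lambda>\<omega>. XN N \<omega> + YN N \<omega> - (X \<omega> + Y \<omega>)) \<le> 2 * l2n (\<lambda>\<omega>. XN N \<omega> - X \<omega>) + 2 * l2n (\<lambda>\<omega>. YN N \<omega> - Y \<omega>)" for N
    using l2_add(2)[of "\<lambda>\<omega>. XN N \<omega> - X \<omega>" "\<lambda>\<omega>. YN N \<omega> - Y \<omega>"] X Y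
    by (simp add: l2lim_def l2_diff add_diff_add)
  have z: "(\<lambda>N. 2 * l2n (\<lambda>\<omega>. XN N \<omega> - X \<omega>) + 2 * l2n (\<lambda>\<omega>. YN N \<omega> - Y \<omega>)) \<longlonglongrightarrow> 0"
    using X Y by (auto simp: l2lim_def intro!: tendsto_eq_intros)
  show "(\<lambda>N. l2n (\<lambda>\<omega>. XN N \<omega> + YN N \<omega> - (X \<omega> + Y \<omega>))) \<longlonglongrightarrow> 0"
    by (rule Lim_null_comparison[OF _ z]) (use e l2n_nonneg in \<open>auto intro!: always_eventually\<close>)
qed (use X Y in \<open>auto intro: l2limD\<close>)

lemma l2lim_sum:
  assumes "\<And>t. t \<in> Q \<Longrightarrow> l2lim (XN t) (X t)"
  shows "l2lim (\<lambda>N \<omega>. \<Sum>t\<in>Q. XN t N \<omega>) (\<lambda>\<omega>. \<Sum>t\<in>Q. X t \<omega>)"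
  using assms
proof (induction Q rule: infinite_finite_induct)
  case (insert t Q)
  then show ?case using l2lim_add[of "XN t" "X t"] by simp
qed (auto simp: l2lim_def l2_zero l2n_def)

text \<open>Entry point for limits phrased with nonnegative integrals, which do not presuppose
  integrability. A single finite distance already makes \<open>X\<close> square integrable.\<close>

lemma l2limI_nn:
  assumes XN: "\<And>N. l2 (XN N)" and X[measurable]: "X \<in> borel_measurable M"
    and z: "(\<lambda>N. \<integral>\<^sup>+ \<omega>. ennreal ((cmod (X \<omega> - XN N \<omega>))\<^sup>2) \<partial>M) \<longlonglongrightarrow> 0"
  shows "l2lim XN X"
proof -
  have [measurable]: "XN N \<in> borel_measurable M" for N using XN by (rule l2_measurable)
  have "\<forall>\<^sub>F N in sequentially. (\<integral>\<^sup>+ \<omega>. ennreal ((cmod (X \<omega> - XN N \<omega>))\<^sup>2) \<partial>M) < 1"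
    using order_tendstoD(2)[OF z, of 1] by simp
  then obtain N0 where N0: "(\<integral>\<^sup>+ \<omega>. ennreal ((cmod (X \<omega> - XN N0 \<omega>))\<^sup>2) \<partial>M) < 1"
    by (auto simp: eventually_sequentially)
  have "l2 (\<lambda>\<omega>. X \<omega> - XN N0 \<omega>)"
    unfolding l2_def
  proof (intro conjI integrableI_bounded)
    show "(\<integral>\<^sup>+ \<omega>. ennreal (norm ((cmod (X \<omega> - XN N0 \<omega>))\<^sup>2)) \<partial>M) < \<infinity>"
      using N0 by (simp add: less_trans[OF _ ennreal_one_less_top])
  qed measurable
  from l2_add(1)[OF this XN[of N0]] have lX: "l2 X" by simp
  have "(\<integral>\<^sup>+ \<omega>. ennreal ((cmod (X \<omega> - XN N \<omega>))\<^sup>2) \<partial>M) = ennreal (l2n (\<lambda>\<omega>. XN N \<omega> - X \<omega>))" for N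
    unfolding l2n_def using l2_diff[OF XN[of N] lX]
    by (subst nn_integral_eq_integral[symmetric]) (auto simp: l2_def norm_minus_commute)
  with z have "(\<lambda>N. ennreal (l2n (\<lambda>\<omega>. XN N \<omega> - X \<omega>))) \<longlonglongrightarrow> ennreal 0" by simp
  then have "(\<lambda>N. l2n (\<lambda>\<omega>. XN N \<omega> - X \<omega>)) \<longlonglongrightarrow> 0"
    by (subst (asm) tendsto_ennreal_iff) (auto simp: l2n_nonneg)
  then show ?thesis using XN lX by (simp add: l2lim_def)
qed

lemma iexp_diff_le: "cmod (iexp a - iexp b) \<le> \<bar>a - b\<bar>"
proof -
  have "iexp a - iexp b = iexp b * (iexp (a - b) - (\<Sum>k\<le>0. (\<i> * of_real (a - b))^k / fact k))"
    by (simp add: right_diff_distrib mult_exp_exp algebra_simps)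
  then have "cmod (iexp a - iexp b) = cmod (iexp (a - b) - (\<Sum>k\<le>0. (\<i> * of_real (a - b))^k / fact k))"
    by (simp add: norm_mult)
  also have "\<dots> \<le> \<bar>a - b\<bar>^(Suc 0) / fact (Suc 0)" by (rule iexp_approx1)
  finally show ?thesis by simp
qed

text \<open>Since \<open>iexp\<close> is 1-Lipschitz, characteristic functions are Lipschitz in the
  L2 distance. Both passages to the limit rest on this, in the truncation and in the order of the
  chaos.\<close>

lemma cf_l2_diff:
  assumes X: "l2 X" and Y: "l2 Y"
  shows "cmod ((\<integral>\<omega>. iexp (Re (c * X \<omega>)) \<partial>M) - (\<integral>\<omega>. iexp (Re (c * Y \<omega>)) \<partial>M)) \<le> cmod c * sqrt (l2n (\<lambda>\<omega>. X \<omega> - Y \<omega>))"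
proof -
  have [measurable]: "X \<in> borel_measurable M" "Y \<in> borel_measurable M" using X Y by (auto simp: l2_def)
  have m: "(\<lambda>w. iexp (Re (c * w))) \<in> borel_measurable borel"
    by (intro borel_measurable_continuous_onI continuous_intros)
  have i: "integrable M (\<lambda>\<omega>. iexp (Re (c * Z \<omega>)))" if [measurable]: "Z \<in> borel_measurable M" for Z
    by (rule integrable_const_bound[where B=1]) (use measurable_compose[OF that m] in \<open>auto simp del: times_complex.sel\<close>)
  have wirt: "l2 (\<lambda>\<omega>. X \<omega> - Y \<omega>)" by (rule l2_diff[OF X Y])
  have "(\<integral>\<omega>. iexp (Re (c * X \<omega>)) \<partial>M) - (\<integral>\<omega>. iexp (Re (c * Y \<omega>)) \<partial>M) = (\<integral>\<omega>. iexp (Re (c * X \<omega>)) - iexp (Re (c * Y \<omega>)) \<partial>M)"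
    by (rule Bochner_Integration.integral_diff[symmetric]) (intro i; measurable)+
  also have "cmod \<dots> \<le> (\<integral>\<omega>. cmod (iexp (Re (c * X \<omega>)) - iexp (Re (c * Y \<omega>))) \<partial>M)"
    by (rule integral_norm_bound)
  also have "\<dots> \<le> (\<integral>\<omega>. cmod c * cmod (X \<omega> - Y \<omega>) \<partial>M)"
  proof (rule integral_mono)
    show "integrable M (\<lambda>\<omega>. cmod (iexp (Re (c * X \<omega>)) - iexp (Re (c * Y \<omega>))))"
      by (intro integrable_norm Bochner_Integration.integrable_diff i) measurable
    show "integrable M (\<lambda>\<omega>. cmod c * cmod (X \<omega> - Y \<omega>))"
      by (intro integrable_mult_right integrable_norm l2_L1_le(1)[OF wirt])
    fix \<omega>
    have "cmod (iexp (Re (c * X \<omega>)) - iexp (Re (c * Y \<omega>))) \<le> \<bar>Re (c * X \<omega>) - Re (c * Y \<omega>)\<bar>"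
      by (rule iexp_diff_le)
    also have "\<dots> = \<bar>Re (c * (X \<omega> - Y \<omega>))\<bar>" by (simp add: algebra_simps)
    also have "\<dots> \<le> cmod (c * (X \<omega> - Y \<omega>))" by (rule abs_Re_le_cmod)
    finally show "cmod (iexp (Re (c * X \<omega>)) - iexp (Re (c * Y \<omega>))) \<le> cmod c * cmod (X \<omega> - Y \<omega>)"
      by (simp only: norm_mult)
  qed
  also have "\<dots> \<le> cmod c * sqrt (l2n (\<lambda>\<omega>. X \<omega> - Y \<omega>))"
    using l2_L1_le(2)[OF wirt] by (simp add: mult_left_mono)
  finally show ?thesis .
qed

end

section \<open>Wiener-Ito integrals as limits\<close>

locale complex_gaussian_family = prob_space M for M :: "'w measure" +
  fixes zeta :: "nat \<Rightarrow> 'w \<Rightarrow> complex"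
  assumes indep: "indep_vars (\<lambda>_. borel) zeta UNIV"
    and gauss: "\<And>k. distr M borel (\<lambda>\<omega>. (Re (zeta k \<omega>), Im (zeta k \<omega>))) = cnormal 1"
begin

lemma zeta_measurable: "zeta k \<in> borel_measurable M"
  using indep by (auto simp: indep_vars_def)

lemma distr_zeta: "distr M borel (zeta k) = cgauss"
proof -
  note [measurable] = zeta_measurable[of k]
  have "cgauss = distr (distr M borel (\<lambda>\<omega>. (Re (zeta k \<omega>), Im (zeta k \<omega>)))) borel (\<lambda>(x, y). Complex x y)"
    by (simp add: cgauss_def gauss)
  also have "\<dots> = distr M borel ((\<lambda>(x, y). Complex x y) \<circ> (\<lambda>\<omega>. (Re (zeta k \<omega>), Im (zeta k \<omega>))))"
    by (rule distr_distr) measurable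
  also have "(\<lambda>(x, y). Complex x y) \<circ> (\<lambda>\<omega>. (Re (zeta k \<omega>), Im (zeta k \<omega>))) = zeta k"
    by (simp add: fun_eq_iff)
  finally show ?thesis ..
qed

definition sample_path :: "'w \<Rightarrow> nat \<Rightarrow> complex" where
  "sample_path \<omega> = (\<lambda>k. zeta k \<omega>)"

lemma path_measurable: "sample_path \<in> measurable M GP"
proof -
  have "sample_path \<in> measurable M (\<Pi>\<^sub>M k\<in>UNIV. borel)"
    unfolding sample_path_def by (rule measurable_PiM_single') (auto simp: zeta_measurable)
  then show ?thesis using measurable_cong_sets[OF refl sets_GP] by blast
qed

text \<open>Independence makes the joint law the product of the marginals, so that identities for
  \<open>GP\<close> hold for the given sequence \<open>zeta\<close>.\<close>

lemma distr_path: "distr M GP sample_path = GP"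
proof -
  have "distr M (\<Pi>\<^sub>M k\<in>UNIV. borel) (\<lambda>\<omega>. \<lambda>k\<in>UNIV. zeta k \<omega>) = (\<Pi>\<^sub>M k\<in>UNIV. distr M borel (zeta k))"
    using indep by (subst (asm) indep_vars_iff_distr_eq_PiM) (auto simp: zeta_measurable)
  then have "distr M (\<Pi>\<^sub>M k\<in>UNIV. borel) sample_path = GP"
    by (simp add: distr_zeta GP_def sample_path_def[abs_def] restrict_UNIV)
  then show ?thesis
    using distr_cong[OF refl sets_GP, of M sample_path sample_path] by simp
qed

lemma integral_path:
  fixes H :: "(nat \<Rightarrow> complex) \<Rightarrow> 'b :: {banach, second_countable_topology}"
  assumes "H \<in> borel_measurable GP"
  shows "(\<integral>\<omega>. H (sample_path \<omega>) \<partial>M) = (\<integral>z. H z \<partial>GP)" "integrable M (\<lambda>\<omega>. H (sample_path \<omega>)) \<longleftrightarrow> integrable GP H"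
  using integral_distr[OF path_measurable assms] integrable_distr_eq[OF path_measurable assms]
  by (simp_all add: distr_path)

lemma smooth_path:
  assumes "smooth H"
  shows "l2 (\<lambda>\<omega>. H (sample_path \<omega>))" "l2n (\<lambda>\<omega>. H (sample_path \<omega>)) = n2 H" "(\<integral>\<omega>. H (sample_path \<omega>) \<partial>M) = EE H"
proof -
  note m = smooth_measurable[OF assms]
  have m2: "(\<lambda>z. (cmod (H z))\<^sup>2) \<in> borel_measurable GP" using m by measurable
  show "l2 (\<lambda>\<omega>. H (sample_path \<omega>))"
    unfolding l2_def using integral_path(2)[OF m2] smooth_sq_integrable[OF assms] measurable_compose[OF path_measurable m] by simp
  show "l2n (\<lambda>\<omega>. H (sample_path \<omega>)) = n2 H"
    unfolding l2n_def n2_def by (rule integral_path(1)[OF m2])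
  show "(\<integral>\<omega>. H (sample_path \<omega>) \<partial>M) = EE H"
    unfolding EE_def by (rule integral_path(1)[OF m])
qed

lemma wi_trunc_path: "wi_trunc zeta p q f N = (\<lambda>\<omega>. wick_int N (p + q) (gker p q f) (sample_path \<omega>))"
  by (rule ext) (simp add: wi_trunc_wick_int sample_path_def)

lemma wi_trunc_l2: "l2 (wi_trunc zeta p q f N)"
  unfolding wi_trunc_path by (rule smooth_path(1)[OF smooth_wick_int])

lemma wi_trunc_diff:
  assumes f: "sym_tensor p q f" and KN: "K \<le> N"
  shows "l2n (\<lambda>\<omega>. wi_trunc zeta p q f N \<omega> - wi_trunc zeta p q f K \<omega>) = fact p * fact q * (fin_norm2 N p q f - fin_norm2 K p q f)"
proof -
  have "l2n (\<lambda>\<omega>. wi_trunc zeta p q f N \<omega> - wi_trunc zeta p q f K \<omega>) = n2 (\<lambda>z. wick_int N (p + q) (gker p q f) z - wick_int K (p + q) (gker p q f) z)"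
    unfolding wi_trunc_path by (rule smooth_path(2)) (intro smooth_diff smooth_wick_int)
  then show ?thesis
    unfolding wick_int_diff_n2[OF symk_gker[OF f] KN] n2_wick_int_gker[OF f] by (simp add: algebra_simps)
qed

text \<open>\<open>wi\<close> is defined by choice, so a limit of the truncations has to be
  exhibited. By the isometry the truncations are Cauchy in L2, and an almost surely convergent
  subsequence supplies the limit.\<close>

lemma wi_exists:
  assumes f: "sym_tensor p q f"
  shows "\<exists>X. X \<in> borel_measurable M \<and>
     (\<lambda>N. \<integral>\<^sup>+ \<omega>. ennreal ((cmod (X \<omega> - wi_trunc zeta p q f N \<omega>))\<^sup>2) \<partial>M) \<longlonglongrightarrow> 0"
proof -
  define T where "T = wi_trunc zeta p q f"
  define c :: real where "c = fact p * fact q"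
  have c: "c \<ge> 0" by (simp add: c_def)
  have lT: "l2 (T N)" for N unfolding T_def by (rule wi_trunc_l2)
  have Tm[measurable]: "T N \<in> borel_measurable M" for N using lT by (rule l2_measurable)
  have d: "l2n (\<lambda>\<omega>. T N \<omega> - T K \<omega>) \<le> c * (tnorm2 p q f - fin_norm2 K p q f)" if "K \<le> N" for K N
    unfolding T_def wi_trunc_diff[OF f that] c_def[symmetric]
    using c fin_norm2_le[OF f, of N] by (intro mult_left_mono) auto
  have lim0: "(\<lambda>K. c * (tnorm2 p q f - fin_norm2 K p q f)) \<longlonglongrightarrow> 0"
    using fin_norm2_tendsto[OF f] by (auto intro!: tendsto_eq_intros)
  have sym: "l2n (\<lambda>\<omega>. T N \<omega> - T K \<omega>) = l2n (\<lambda>\<omega>. T K \<omega> - T N \<omega>)" for N K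
    unfolding l2n_def by (simp add: norm_minus_commute)
  obtain r where r: "strict_mono r" "AE \<omega> in M. Cauchy (\<lambda>i. T (r i) \<omega>)"
  proof (rule cauchy_L1_AE_cauchy_subseq[of M T])
    show "integrable M (T n)" for n by (rule l2_L1_le(1)[OF lT])
    fix e :: real assume e: "e > 0"
    have "\<forall>\<^sub>F K in sequentially. c * (tnorm2 p q f - fin_norm2 K p q f) < e\<^sup>2"
      using order_tendstoD(2)[OF lim0, of "e\<^sup>2"] e by simp
    then obtain N where N: "\<And>K. K \<ge> N \<Longrightarrow> c * (tnorm2 p q f - fin_norm2 K p q f) < e\<^sup>2"
      by (auto simp: eventually_sequentially)
    show "\<exists>N. \<forall>i\<ge>N. \<forall>j\<ge>N. (\<integral>\<omega>. norm (T i \<omega> - T j \<omega>) \<partial>M) < e"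
    proof (intro exI[of _ N] allI impI)
      fix i j assume ij: "N \<le> i" "N \<le> j"
      have "l2n (\<lambda>\<omega>. T i \<omega> - T j \<omega>) < e\<^sup>2"
      proof (cases "j \<le> i")
        case True then show ?thesis using d[OF True] N[OF ij(2)] by linarith
      next
        case False then show ?thesis using d[of i j] N[OF ij(1)] sym[of i j] by linarith
      qed
      then have "sqrt (l2n (\<lambda>\<omega>. T i \<omega> - T j \<omega>)) < e" using e by (intro real_less_lsqrt) (auto simp: l2n_nonneg)
      with l2_L1_le(2)[OF l2_diff[OF lT[of i] lT[of j]]]
      show "(\<integral>\<omega>. norm (T i \<omega> - T j \<omega>) \<partial>M) < e" by linarith
    qed
  qed
  define X where "X = (\<lambda>\<omega>. lim (\<lambda>i. T (r i) \<omega>))"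
  have Xm[measurable]: "X \<in> borel_measurable M"
    unfolding X_def by (rule borel_measurable_lim_metric) measurable
  have XT: "AE \<omega> in M. (\<lambda>i. T (r i) \<omega>) \<longlonglongrightarrow> X \<omega>"
    using r(2) by eventually_elim (simp add: X_def Cauchy_convergent_iff convergent_LIMSEQ_iff)
  have le: "(\<integral>\<^sup>+ \<omega>. ennreal ((cmod (X \<omega> - T N \<omega>))\<^sup>2) \<partial>M) \<le> ennreal (c * (tnorm2 p q f - fin_norm2 N p q f))" for N
  proof -
    have "(\<integral>\<^sup>+ \<omega>. ennreal ((cmod (X \<omega> - T N \<omega>))\<^sup>2) \<partial>M) = (\<integral>\<^sup>+ \<omega>. liminf (\<lambda>i. ennreal ((cmod (T (r i) \<omega> - T N \<omega>))\<^sup>2)) \<partial>M)"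
    proof (rule nn_integral_cong_AE)
      show "AE \<omega> in M. ennreal ((cmod (X \<omega> - T N \<omega>))\<^sup>2) = liminf (\<lambda>i. ennreal ((cmod (T (r i) \<omega> - T N \<omega>))\<^sup>2))"
        using XT
      proof eventually_elim
        case (elim \<omega>)
        have "(\<lambda>i. ennreal ((cmod (T (r i) \<omega> - T N \<omega>))\<^sup>2)) \<longlonglongrightarrow> ennreal ((cmod (X \<omega> - T N \<omega>))\<^sup>2)"
          by (intro tendsto_ennrealI tendsto_power tendsto_norm tendsto_diff elim tendsto_const)
        then show ?case by (rule lim_imp_Liminf[OF trivial_limit_sequentially, symmetric])
      qed
    qed
    \<comment> \<open>Fatou's lemma turns the Cauchy estimate into a bound for the distance between
      \<open>T N\<close> and \<open>X\<close>, for every \<open>N\<close> and not just along the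
      subsequence.\<close>
    also have "\<dots> \<le> liminf (\<lambda>i. \<integral>\<^sup>+ \<omega>. ennreal ((cmod (T (r i) \<omega> - T N \<omega>))\<^sup>2) \<partial>M)"
      by (rule nn_integral_liminf) measurable
    also have "\<dots> \<le> limsup (\<lambda>i. \<integral>\<^sup>+ \<omega>. ennreal ((cmod (T (r i) \<omega> - T N \<omega>))\<^sup>2) \<partial>M)"
      by (rule Liminf_le_Limsup) simp
    also have "\<dots> \<le> ennreal (c * (tnorm2 p q f - fin_norm2 N p q f))"
    proof (rule Limsup_bounded)
      show "\<forall>\<^sub>F i in sequentially. (\<integral>\<^sup>+ \<omega>. ennreal ((cmod (T (r i) \<omega> - T N \<omega>))\<^sup>2) \<partial>M) \<le> ennreal (c * (tnorm2 p q f - fin_norm2 N p q f))"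
        using eventually_ge_at_top[of N]
      proof eventually_elim
        case (elim i)
        have "N \<le> r i" using elim seq_suble[OF r(1), of i] by linarith
        moreover have "(\<integral>\<^sup>+ \<omega>. ennreal ((cmod (T (r i) \<omega> - T N \<omega>))\<^sup>2) \<partial>M) = ennreal (l2n (\<lambda>\<omega>. T (r i) \<omega> - T N \<omega>))"
          unfolding l2n_def using l2_diff[OF lT lT] by (intro nn_integral_eq_integral) (auto simp: l2_def)
        ultimately show ?case using d by (simp add: ennreal_leI)
      qed
    qed
    finally show ?thesis .
  qed
  have "(\<lambda>N. ennreal (c * (tnorm2 p q f - fin_norm2 N p q f))) \<longlonglongrightarrow> 0"
    using tendsto_ennrealI[OF lim0] by simp
  then have "(\<lambda>N. \<integral>\<^sup>+ \<omega>. ennreal ((cmod (X \<omega> - T N \<omega>))\<^sup>2) \<partial>M) \<longlonglongrightarrow> 0"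
    by (rule tendsto_sandwich[OF _ _ tendsto_const, rotated 2]) (auto intro: always_eventually le)
  then show ?thesis using Xm unfolding T_def by blast
qed

lemma wi_l2lim:
  assumes f: "sym_tensor p q f"
  shows "l2lim (wi_trunc zeta p q f) (wi M zeta p q f)"
proof -
  have "wi M zeta p q f \<in> borel_measurable M \<and>
     (\<lambda>N. \<integral>\<^sup>+ \<omega>. ennreal ((cmod (wi M zeta p q f \<omega> - wi_trunc zeta p q f N \<omega>))\<^sup>2) \<partial>M) \<longlonglongrightarrow> 0"
    unfolding wi_def by (rule someI_ex[OF wi_exists[OF f]])
  then show ?thesis by (intro l2limI_nn wi_trunc_l2) auto
qed

definition wi_sum :: "(nat \<times> nat) set \<Rightarrow> (nat \<Rightarrow> nat \<Rightarrow> nat list \<Rightarrow> nat list \<Rightarrow> complex) \<Rightarrow> 'w \<Rightarrow> complex" where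
  "wi_sum Q f \<omega> = (\<Sum>(p, q)\<in>Q. wi M zeta p q (f p q) \<omega>)"

lemma wi_sum_l2lim:
  assumes f: "\<And>p q. (p, q) \<in> Q \<Longrightarrow> sym_tensor p q (f p q)"
  shows "l2lim (\<lambda>N \<omega>. chaos_sum N Q f (sample_path \<omega>)) (wi_sum Q f)"
proof -
  have "l2lim (\<lambda>N \<omega>. \<Sum>t\<in>Q. wi_trunc zeta (fst t) (snd t) (f (fst t) (snd t)) N \<omega>) (\<lambda>\<omega>. \<Sum>t\<in>Q. wi M zeta (fst t) (snd t) (f (fst t) (snd t)) \<omega>)"
    by (intro l2lim_sum wi_l2lim f) simp
  then show ?thesis
    unfolding chaos_sum_def wi_sum_def[abs_def] case_prod_beta' wi_trunc_path .
qed

lemma wi_sum_norm: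
  assumes fin: "finite Q" and f: "\<And>p q. (p, q) \<in> Q \<Longrightarrow> sym_tensor p q (f p q)"
  shows "l2n (wi_sum Q f) = (\<Sum>(p, q)\<in>Q. fact p * fact q * tnorm2 p q (f p q))"
proof (rule LIMSEQ_unique)
  show "(\<lambda>N. l2n (\<lambda>\<omega>. chaos_sum N Q f (sample_path \<omega>))) \<longlonglongrightarrow> l2n (wi_sum Q f)"
    by (rule l2lim_norm[OF wi_sum_l2lim[OF f]])
  have "(\<lambda>N. \<Sum>(p, q)\<in>Q. fact p * fact q * fin_norm2 N p q (f p q)) \<longlonglongrightarrow> (\<Sum>(p, q)\<in>Q. fact p * fact q * tnorm2 p q (f p q))"
    unfolding case_prod_beta' by (intro tendsto_sum tendsto_mult tendsto_const fin_norm2_tendsto f) simp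
  then show "(\<lambda>N. l2n (\<lambda>\<omega>. chaos_sum N Q f (sample_path \<omega>))) \<longlonglongrightarrow> (\<Sum>(p, q)\<in>Q. fact p * fact q * tnorm2 p q (f p q))"
    by (simp add: smooth_path(2)[OF smooth_chaos_sum] n2_chaos_sum[OF fin f])
qed

text \<open>\<open>chaos_cf_bound\<close> in the limit over truncations. The expectation of the
  squared truncated sum tends to that of the squared \<open>wi_sum\<close>, which is 0; the tested
  real part therefore has variance \<open>|u|^2 / 2\<close> times the squared norm, and the Gaussian
  exponent supplies another factor 1/2.\<close>

lemma wi_sum_cf:
  assumes fin: "finite Q" and Q: "\<And>p q. (p, q) \<in> Q \<Longrightarrow> 1 \<le> p + q"
    and f: "\<And>p q. (p, q) \<in> Q \<Longrightarrow> sym_tensor p q (f p q)"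
    and orth: "(\<integral>\<omega>. wi_sum Q f \<omega> * wi_sum Q f \<omega> \<partial>M) = 0"
  shows "cmod ((\<integral>\<omega>. iexp (Re (cnj u * wi_sum Q f \<omega>)) \<partial>M)
      - of_real (exp (- (cmod u)\<^sup>2 * l2n (wi_sum Q f) / 4)))
     \<le> (\<Sum>j\<in>Q \<times> (UNIV::bool set). \<Sum>k\<in>Q \<times> (UNIV::bool set). sqrt (pair_bound u f (fst j) (fst k)))"
    (is "_ \<le> ?B")
proof -
  define V where "V = (\<lambda>N \<omega>. chaos_sum N Q f (sample_path \<omega>))"
  define R where "R = (\<lambda>N z. complex_of_real (Re (cnj u * chaos_sum N Q f z)))"
  have lim: "l2lim V (wi_sum Q f)" unfolding V_def by (rule wi_sum_l2lim[OF f])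
  have s: "smooth (chaos_sum N Q f)" for N by (rule smooth_chaos_sum)
  have lV: "l2 (V N)" for N by (rule l2limD(1)[OF lim])
  have cf: "(\<lambda>N. \<integral>\<omega>. iexp (Re (cnj u * V N \<omega>)) \<partial>M) \<longlonglongrightarrow> (\<integral>\<omega>. iexp (Re (cnj u * wi_sum Q f \<omega>)) \<partial>M)"
  proof (rule LIM_zero_cancel, rule Lim_null_comparison[OF always_eventually[OF allI]])
    show "cmod ((\<integral>\<omega>. iexp (Re (cnj u * V N \<omega>)) \<partial>M) - (\<integral>\<omega>. iexp (Re (cnj u * wi_sum Q f \<omega>)) \<partial>M)) \<le> cmod (cnj u) * sqrt (l2n (\<lambda>\<omega>. V N \<omega> - wi_sum Q f \<omega>))" for N
      by (rule cf_l2_diff[OF lV l2limD(2)[OF lim]])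
    show "(\<lambda>N. cmod (cnj u) * sqrt (l2n (\<lambda>\<omega>. V N \<omega> - wi_sum Q f \<omega>))) \<longlonglongrightarrow> 0"
      by (rule tendsto_mult_right_zero[OF l2lim_bounded[OF lim]])
  qed
  have cfE: "(\<integral>\<omega>. iexp (Re (cnj u * V N \<omega>)) \<partial>M) = EE (\<lambda>z. exp (\<i> * R N z))" for N
  proof -
    have "(\<lambda>w. iexp (Re (cnj u * w))) \<in> borel_measurable borel"
      by (intro borel_measurable_continuous_onI continuous_intros)
    from measurable_compose[OF smooth_measurable[OF s] this]
    have "(\<lambda>z. iexp (Re (cnj u * chaos_sum N Q f z))) \<in> borel_measurable GP" .
    from integral_path(1)[OF this] show ?thesis unfolding V_def R_def EE_def .
  qed
  have n2R: "n2 (R N) = ((cmod u)\<^sup>2 * n2 (chaos_sum N Q f) + Re ((cnj u)\<^sup>2 * EE (\<lambda>z. chaos_sum N Q f z * chaos_sum N Q f z))) / 2" for N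
    unfolding R_def using n2_Re[OF s, of "cnj u"] by simp
  have "(\<lambda>N. l2n (V N)) \<longlonglongrightarrow> l2n (wi_sum Q f)" by (rule l2lim_norm[OF lim])
  then have 1: "(\<lambda>N. n2 (chaos_sum N Q f)) \<longlonglongrightarrow> l2n (wi_sum Q f)"
    unfolding V_def smooth_path(2)[OF s] .
  have "(\<lambda>N. \<integral>\<omega>. V N \<omega> * V N \<omega> \<partial>M) \<longlonglongrightarrow> 0"
    using l2lim_mult[OF lim lim] orth by simp
  then have 2: "(\<lambda>N. EE (\<lambda>z. chaos_sum N Q f z * chaos_sum N Q f z)) \<longlonglongrightarrow> 0"
    unfolding V_def smooth_path(3)[OF smooth.mult[OF s s]] .
  have "(\<lambda>N. n2 (R N)) \<longlonglongrightarrow> ((cmod u)\<^sup>2 * l2n (wi_sum Q f) + Re ((cnj u)\<^sup>2 * 0)) / 2"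
    unfolding n2R by (intro tendsto_intros 1 2) simp
  then have "(\<lambda>N. exp (- n2 (R N) / 2)) \<longlonglongrightarrow> exp (- (((cmod u)\<^sup>2 * l2n (wi_sum Q f) + Re ((cnj u)\<^sup>2 * 0)) / 2) / 2)"
    by (intro tendsto_intros) simp_all
  then have "(\<lambda>N. exp (- n2 (R N) / 2)) \<longlonglongrightarrow> exp (- (cmod u)\<^sup>2 * l2n (wi_sum Q f) / 4)" by simp
  note e = this
  have "(\<lambda>N. cmod ((\<integral>\<omega>. iexp (Re (cnj u * V N \<omega>)) \<partial>M) - of_real (exp (- n2 (R N) / 2)))) \<longlonglongrightarrow>
     cmod ((\<integral>\<omega>. iexp (Re (cnj u * wi_sum Q f \<omega>)) \<partial>M) - of_real (exp (- (cmod u)\<^sup>2 * l2n (wi_sum Q f) / 4)))"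
    by (intro tendsto_norm tendsto_diff tendsto_of_real cf e)
  then show ?thesis
  proof (rule tendsto_upperbound)
    show "\<forall>\<^sub>F N in sequentially. cmod ((\<integral>\<omega>. iexp (Re (cnj u * V N \<omega>)) \<partial>M) - of_real (exp (- n2 (R N) / 2))) \<le> ?B"
      unfolding cfE R_def by (intro always_eventually allI chaos_cf_bound[OF fin Q f])
  qed simp
qed

end

section \<open>The central limit theorem\<close>

definition types_upto :: "nat \<Rightarrow> (nat \<times> nat) set" where
  "types_upto m = {(p, q). 1 \<le> p + q \<and> p + q \<le> m}"

lemma finite_types_upto[simp]: "finite (types_upto m)"
  by (rule finite_subset[of _ "{..m} \<times> {..m}"]) (auto simp: types_upto_def)

lemma types_uptoD: "(p, q) \<in> types_upto m \<Longrightarrow> 1 \<le> p + q"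
  by (simp add: types_upto_def)

lemma types_upto_mono: "m \<le> m' \<Longrightarrow> types_upto m \<subseteq> types_upto m'"
  by (auto simp: types_upto_def)

text \<open>The types up to a given order eventually contain every finite set of types; this
  identifies unordered infinite sums over types with limits over the order.\<close>

lemma filterlim_types_upto:
  "filterlim types_upto (finite_subsets_at_top {(p, q). 1 \<le> p + q}) sequentially"
  unfolding filterlim_finite_subsets_at_top
proof (intro allI impI)
  fix X :: "(nat \<times> nat) set" assume X: "finite X \<and> X \<subseteq> {(p, q). 1 \<le> p + q}"
  have "finite ((\<lambda>t. fst t + snd t) ` X)" using X by simp
  then obtain m0 where m0: "(\<lambda>t. fst t + snd t) ` X \<subseteq> {..m0}" by (auto simp: finite_nat_set_iff_bounded_le)
  show "\<forall>\<^sub>F m in sequentially. finite (types_upto m) \<and> X \<subseteq> types_upto m \<and> types_upto m \<subseteq> {(p, q). 1 \<le> p + q}"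
    using eventually_ge_at_top[of m0]
  proof eventually_elim
    case (elim m)
    have "t \<in> types_upto m" if t: "t \<in> X" for t
    proof -
      have "fst t + snd t \<in> {..m0}" using m0 t by blast
      moreover have "1 \<le> fst t + snd t" using X t by auto
      ultimately show ?thesis using elim by (auto simp: types_upto_def case_prod_beta')
    qed
    moreover have "types_upto m \<subseteq> {(p, q). 1 \<le> p + q}" by (auto simp: types_upto_def)
    ultimately show ?case by auto
  qed
qed

lemma tnorm2_nonneg: "tnorm2 p q f \<ge> 0"
  unfolding tnorm2_def by (intro infsum_nonneg) auto

context complex_gaussian_family
begin

lemma wi_sum_diff_norm:
  assumes f: "\<And>p q. 1 \<le> p + q \<Longrightarrow> sym_tensor p q (f p q)" and m: "m \<le> m'"
  shows "l2n (\<lambda>\<omega>. wi_sum (types_upto m') f \<omega> - wi_sum (types_upto m) f \<omega>)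
     = (\<Sum>(p, q)\<in>types_upto m' - types_upto m. fact p * fact q * tnorm2 p q (f p q))"
proof -
  have "(\<lambda>\<omega>. wi_sum (types_upto m') f \<omega> - wi_sum (types_upto m) f \<omega>) = wi_sum (types_upto m' - types_upto m) f"
    unfolding wi_sum_def by (rule ext) (simp add: sum_diff types_upto_mono[OF m])
  then show ?thesis
    by (subst wi_sum_norm[symmetric]) (auto intro: f types_uptoD)
qed

text \<open>By the isometry the distance between two partial sums is a finite part of the tail sum,
  and the larger order is sent to infinity.\<close>

lemma chaos_tail_bound:
  assumes f: "\<And>p q. 1 \<le> p + q \<Longrightarrow> sym_tensor p q (f p q)"
    and F: "l2lim (\<lambda>m. wi_sum (types_upto m) f) F"
  shows "l2n (\<lambda>\<omega>. wi_sum (types_upto m) f \<omega> - F \<omega>) \<le> (\<Sum>\<^sub>\<infinity>(p, q) \<in> {(p, q). m < p + q}. fact p * fact q * tnorm2 p q (f p q))"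
proof -
  define w where "w = (\<lambda>(p, q). fact p * fact q * tnorm2 p q (f p q))"
  define V where "V = (\<lambda>m. wi_sum (types_upto m) f)"
  have w0: "w t \<ge> 0" for t by (simp add: w_def tnorm2_nonneg case_prod_beta')
  have lV: "l2 (V m)" for m unfolding V_def by (rule l2limD(1)[OF F])
  have Vn: "l2n (V m) = sum w (types_upto m)" for m
    unfolding V_def w_def by (rule wi_sum_norm[OF finite_types_upto f[OF types_uptoD]])
  have mono: "l2n (V m) \<le> l2n (V m')" if "m \<le> m'" for m m'
    unfolding Vn by (intro sum_mono2 types_upto_mono that) (auto simp: w0)
  have lim: "(\<lambda>m. l2n (V m)) \<longlonglongrightarrow> l2n F" using l2lim_norm[OF F] by (simp add: V_def)
  have Vle: "l2n (V m) \<le> l2n F" for m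
    by (rule tendsto_lowerbound[OF lim]) (auto intro: eventually_sequentiallyI[of m] mono)
  \<comment> \<open>Since \<open>infsum\<close> is 0 on families that are not summable, summability
    is derived from \<open>F\<close>: the norms of the partial sums increase to that of
    \<open>F\<close>, which bounds every finite sum.\<close>
  have sm: "w summable_on {(p, q). 1 \<le> p + q}"
  proof (rule nonneg_bdd_above_summable_on)
    show "bdd_above (sum w ` {X. X \<subseteq> {(p :: nat, q). 1 \<le> p + q} \<and> finite X})"
    proof (rule bdd_aboveI2)
      fix X :: "(nat \<times> nat) set" assume X: "X \<in> {X. X \<subseteq> {(p, q). 1 \<le> p + q} \<and> finite X}"
      then have "\<forall>\<^sub>F m in sequentially. X \<subseteq> types_upto m"
        using filterlim_types_upto unfolding filterlim_finite_subsets_at_top by (auto elim!: allE[of _ X] eventually_mono)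
      then obtain m where m: "X \<subseteq> types_upto m" by (auto simp: eventually_sequentially)
      have "sum w X \<le> sum w (types_upto m)" by (intro sum_mono2 m) (auto simp: w0)
      also have "\<dots> \<le> l2n F" using Vle[of m] by (simp add: Vn)
      finally show "sum w X \<le> l2n F" .
    qed
  qed (rule w0)
  have smt: "w summable_on {(p, q). m < p + q}"
    by (rule summable_on_subset_banach[OF sm]) auto
  have "l2lim (\<lambda>m' \<omega>. V m \<omega> - V m' \<omega>) (\<lambda>\<omega>. V m \<omega> - F \<omega>)"
  proof -
    have "l2n (\<lambda>\<omega>. V m \<omega> - V m' \<omega> - (V m \<omega> - F \<omega>)) = l2n (\<lambda>\<omega>. V m' \<omega> - F \<omega>)" for m'
      unfolding l2n_def by (simp add: norm_minus_commute)
    then show ?thesis using F lV l2limD(2)[OF F] by (auto simp: l2lim_def V_def intro: l2_diff)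
  qed
  from l2lim_norm[OF this]
  have "(\<lambda>m'. l2n (\<lambda>\<omega>. V m \<omega> - V m' \<omega>)) \<longlonglongrightarrow> l2n (\<lambda>\<omega>. V m \<omega> - F \<omega>)" .
  then have "l2n (\<lambda>\<omega>. V m \<omega> - F \<omega>) \<le> infsum w {(p, q). m < p + q}"
  proof (rule tendsto_upperbound)
    show "\<forall>\<^sub>F m' in sequentially. l2n (\<lambda>\<omega>. V m \<omega> - V m' \<omega>) \<le> infsum w {(p, q). m < p + q}"
      using eventually_ge_at_top[of m]
    proof eventually_elim
      case (elim m')
      have "l2n (\<lambda>\<omega>. V m \<omega> - V m' \<omega>) = l2n (\<lambda>\<omega>. V m' \<omega> - V m \<omega>)"
        unfolding l2n_def by (simp add: norm_minus_commute)
      also have "\<dots> = sum w (types_upto m' - types_upto m)"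
        unfolding V_def w_def by (rule wi_sum_diff_norm[OF f elim])
      also have "\<dots> \<le> infsum w {(p, q). m < p + q}"
      proof (rule finite_sum_le_infsum[OF smt])
        show "types_upto m' - types_upto m \<subseteq> {(p, q). m < p + q}" by (auto simp: types_upto_def)
      qed (simp_all add: w0)
      finally show ?case .
    qed
  qed simp
  then show ?thesis by (simp add: V_def w_def)
qed

text \<open>The order \<open>m\<close> is fixed before \<open>n\<close>. The tail hypothesis makes
  the partial sum of order \<open>m\<close> close to \<open>F n\<close> uniformly in
  \<open>n\<close>, and the same \<open>m\<close> brings the partial variances near
  \<open>s2\<close>. Finitely many chaoses remain, for which \<open>n\<close> may tend to
  infinity.\<close>

lemma chaos_cf_limit:
  fixes F :: "nat \<Rightarrow> 'w \<Rightarrow> complex" and f :: "nat \<Rightarrow> nat \<Rightarrow> nat \<Rightarrow> nat list \<Rightarrow> nat list \<Rightarrow> complex"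
  assumes f: "\<And>n p q. 1 \<le> p + q \<Longrightarrow> sym_tensor p q (f n p q)"
    and F: "\<And>n. l2lim (\<lambda>m. wi_sum (types_upto m) (f n)) (F n)"
    and orth: "\<And>n m. (\<integral>\<omega>. wi_sum (types_upto m) (f n) \<omega> * wi_sum (types_upto m) (f n) \<omega> \<partial>M) = 0"
    and lim_var: "\<And>p q. 1 \<le> p + q \<Longrightarrow> (\<lambda>n. fact p * fact q * tnorm2 p q (f n p q)) \<longlonglongrightarrow> sigma2 p q"
    and s2: "(\<lambda>m. \<Sum>(p, q)\<in>types_upto m. sigma2 p q) \<longlonglongrightarrow> s2"
    and contr_lim: "\<And>p q i j. 2 \<le> p + q \<Longrightarrow> i \<le> p \<Longrightarrow> j \<le> q \<Longrightarrow> 0 < i + j \<Longrightarrow> i + j < p + q \<Longrightarrow>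
       (\<lambda>n. tnorm2 (p + q - i - j) (q + p - i - j) (contr p q i j (f n p q) (rev_cnj (f n p q)))) \<longlonglongrightarrow> 0"
    and tail: "\<forall>\<epsilon>>0. \<exists>M0. \<forall>m\<ge>M0. \<forall>n.
       (\<Sum>\<^sub>\<infinity>(p, q) \<in> {(p, q). m < p + q}. fact p * fact q * tnorm2 p q (f n p q)) \<le> \<epsilon>"
  shows "(\<lambda>n. \<integral>\<omega>. iexp (Re (cnj u * F n \<omega>)) \<partial>M) \<longlonglongrightarrow> of_real (exp (- (cmod u)\<^sup>2 * s2 / 4))"
    and "\<exists>C. \<forall>n. l2n (F n) \<le> C"
proof -
  define V where "V = (\<lambda>n m. wi_sum (types_upto m) (f n))"
  define v where "v = (\<lambda>m. \<Sum>(p, q)\<in>types_upto m. sigma2 p q)"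
  have lV: "l2 (V n m)" and lF: "l2 (F n)" for n m using F[of n] by (auto simp: V_def l2lim_def)
  have nV: "l2n (V n m) = (\<Sum>(p, q)\<in>types_upto m. fact p * fact q * tnorm2 p q (f n p q))" for n m
    unfolding V_def by (rule wi_sum_norm[OF finite_types_upto f[OF types_uptoD]])
  have nVlim: "(\<lambda>n. l2n (V n m)) \<longlonglongrightarrow> v m" for m
    unfolding nV v_def case_prod_beta' by (intro tendsto_sum lim_var) (auto simp: types_upto_def)
  have tl: "l2n (\<lambda>\<omega>. V n m \<omega> - F n \<omega>) \<le> (\<Sum>\<^sub>\<infinity>(p, q) \<in> {(p, q). m < p + q}. fact p * fact q * tnorm2 p q (f n p q))" for n m
    unfolding V_def by (rule chaos_tail_bound[OF f F])
  show "\<exists>C. \<forall>n. l2n (F n) \<le> C"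
  proof -
    \<comment> \<open>An order whose tails are at most 1 for all \<open>n\<close> reduces the L2
      bound to one convergent, hence bounded, sequence of norms.\<close>
    obtain m where m: "\<And>n. (\<Sum>\<^sub>\<infinity>(p, q) \<in> {(p, q). m < p + q}. fact p * fact q * tnorm2 p q (f n p q)) \<le> 1"
      using tail[rule_format, of 1] by auto
    have "Bseq (\<lambda>n. l2n (V n m))" using nVlim by (intro convergent_imp_Bseq convergentI)
    then obtain C where C: "\<And>n. l2n (V n m) \<le> C" by (auto simp: Bseq_def abs_le_iff)
    have "l2n (F n) \<le> 2 * C + 2" for n
    proof -
      have "l2n (\<lambda>\<omega>. V n m \<omega> + (- 1) * (V n m \<omega> - F n \<omega>)) \<le> 2 * l2n (V n m) + 2 * l2n (\<lambda>\<omega>. (- 1) * (V n m \<omega> - F n \<omega>))"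
        by (intro l2_add(2) lV l2_cmult(1) l2_diff lF)
      also have "l2n (\<lambda>\<omega>. (- 1) * (V n m \<omega> - F n \<omega>)) = l2n (\<lambda>\<omega>. V n m \<omega> - F n \<omega>)"
        by (subst l2_cmult(2)) (auto intro: l2_diff lV lF)
      finally show ?thesis using C[of n] m[of n] tl[of n m] by simp
    qed
    then show ?thesis by blast
  qed
  define B where "B = (\<lambda>n m. \<Sum>j\<in>types_upto m \<times> (UNIV::bool set). \<Sum>k\<in>types_upto m \<times> (UNIV::bool set). sqrt (pair_bound u (f n) (fst j) (fst k)))"
  have B0: "(\<lambda>n. B n m) \<longlonglongrightarrow> 0" for m
    unfolding B_def
  proof (rule chaos_cf_tendsto[where l="\<lambda>p q. sigma2 p q / (fact p * fact q)"])
    fix p q assume "(p, q) \<in> types_upto m"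
    then have pq: "1 \<le> p + q" by (auto simp: types_upto_def)
    show "1 \<le> p + q" by (rule pq)
    show "sym_tensor p q (f n p q)" for n by (rule f[OF pq])
    have "(\<lambda>n. (fact p * fact q * tnorm2 p q (f n p q)) / (fact p * fact q)) \<longlonglongrightarrow> sigma2 p q / (fact p * fact q)"
      by (intro tendsto_divide lim_var[OF pq] tendsto_const) simp
    then show "(\<lambda>n. tnorm2 p q (f n p q)) \<longlonglongrightarrow> sigma2 p q / (fact p * fact q)" by simp
  qed (rule finite_types_upto, rule contr_lim)
  have cfV: "cmod ((\<integral>\<omega>. iexp (Re (cnj u * V n m \<omega>)) \<partial>M) - of_real (exp (- (cmod u)\<^sup>2 * l2n (V n m) / 4))) \<le> B n m" for n m
    unfolding V_def B_def by (rule wi_sum_cf[OF finite_types_upto types_uptoD f[OF types_uptoD] orth])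
  show "(\<lambda>n. \<integral>\<omega>. iexp (Re (cnj u * F n \<omega>)) \<partial>M) \<longlonglongrightarrow> of_real (exp (- (cmod u)\<^sup>2 * s2 / 4))"
  proof (rule LIMSEQ_I)
    fix r :: real assume r: "r > 0"
    \<comment> \<open>The square undoes the root in \<open>cf_l2_diff\<close>, and the summand 1
      covers \<open>u = 0\<close>. Four errors below \<open>r / 4\<close> are added: the tail, the
      Gaussian approximation, and two in the exponent.\<close>
    define \<epsilon> where "\<epsilon> = (r / (4 * (cmod u + 1)))\<^sup>2"
    have e0: "\<epsilon> > 0" using r by (simp add: \<epsilon>_def add_nonneg_eq_0_iff)
    have e1: "cmod (cnj u) * sqrt \<epsilon> < r / 4"
    proof -
      have "sqrt \<epsilon> = r / (4 * (cmod u + 1))" unfolding \<epsilon>_def using r by (intro real_sqrt_unique) auto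
      moreover have "cmod u * r < (cmod u + 1) * r" using r by simp
      ultimately show ?thesis by (simp add: divide_less_eq add_pos_nonneg field_simps add_nonneg_pos)
    qed
    obtain M0 where M0: "\<And>m n. m \<ge> M0 \<Longrightarrow> (\<Sum>\<^sub>\<infinity>(p, q) \<in> {(p, q). m < p + q}. fact p * fact q * tnorm2 p q (f n p q)) \<le> \<epsilon>"
      using tail e0 by blast
    have "(\<lambda>m. exp (- (cmod u)\<^sup>2 * v m / 4)) \<longlonglongrightarrow> exp (- (cmod u)\<^sup>2 * s2 / 4)"
      using s2 unfolding v_def by (intro tendsto_intros) simp_all
    from LIMSEQ_D[OF this, of "r / 4"] r obtain M1 where
      M1: "\<And>m. m \<ge> M1 \<Longrightarrow> \<bar>exp (- (cmod u)\<^sup>2 * v m / 4) - exp (- (cmod u)\<^sup>2 * s2 / 4)\<bar> < r / 4"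
      by (metis real_norm_def divide_pos_pos zero_less_numeral)
    define m where "m = max M0 M1"
    have "(\<lambda>n. exp (- (cmod u)\<^sup>2 * l2n (V n m) / 4)) \<longlonglongrightarrow> exp (- (cmod u)\<^sup>2 * v m / 4)"
      by (intro tendsto_intros nVlim) simp_all
    from LIMSEQ_D[OF this, of "r / 4"] r obtain N1 where
      N1: "\<And>n. n \<ge> N1 \<Longrightarrow> \<bar>exp (- (cmod u)\<^sup>2 * l2n (V n m) / 4) - exp (- (cmod u)\<^sup>2 * v m / 4)\<bar> < r / 4"
      by (metis real_norm_def divide_pos_pos zero_less_numeral)
    from LIMSEQ_D[OF B0[of m], of "r / 4"] r obtain N2 where
      N2: "\<And>n. n \<ge> N2 \<Longrightarrow> \<bar>B n m\<bar> < r / 4"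
      by (metis real_norm_def divide_pos_pos zero_less_numeral diff_zero)
    show "\<exists>n0. \<forall>n\<ge>n0. norm ((\<integral>\<omega>. iexp (Re (cnj u * F n \<omega>)) \<partial>M) - of_real (exp (- (cmod u)\<^sup>2 * s2 / 4))) < r"
    proof (intro exI[of _ "max N1 N2"] allI impI)
      fix n assume n: "max N1 N2 \<le> n"
      let ?a = "\<integral>\<omega>. iexp (Re (cnj u * F n \<omega>)) \<partial>M" and ?b = "\<integral>\<omega>. iexp (Re (cnj u * V n m \<omega>)) \<partial>M"
      let ?c = "exp (- (cmod u)\<^sup>2 * l2n (V n m) / 4)" and ?d = "exp (- (cmod u)\<^sup>2 * v m / 4)" and ?e = "exp (- (cmod u)\<^sup>2 * s2 / 4)"
      have "cmod (?b - ?a) \<le> cmod (cnj u) * sqrt (l2n (\<lambda>\<omega>. V n m \<omega> - F n \<omega>))"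
        by (rule cf_l2_diff[OF lV lF])
      also have "\<dots> \<le> cmod (cnj u) * sqrt \<epsilon>"
        using tl[of n m] M0[of m n] by (intro mult_left_mono real_sqrt_le_mono) (auto simp: m_def)
      finally have 1: "cmod (?a - ?b) < r / 4" using e1 by (simp add: norm_minus_commute)
      have 2: "cmod (?b - of_real ?c) < r / 4" using cfV[of n m] N2[of n] n by auto
      have 3: "cmod (of_real ?c - of_real ?e) < r / 4 + r / 4"
      proof -
        have "\<bar>?c - ?d\<bar> < r / 4" by (rule N1) (use n in simp)
        moreover have "\<bar>?d - ?e\<bar> < r / 4" by (rule M1) (simp add: m_def)
        ultimately show ?thesis unfolding of_real_diff[symmetric] norm_of_real by linarith
      qed
      have "cmod (?a - of_real ?e) \<le> cmod (?a - ?b) + (cmod (?b - of_real ?c) + cmod (of_real ?c - of_real ?e))"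
        using norm_triangle_ineq[of "?a - ?b" "?b - of_real ?e"] norm_triangle_ineq[of "?b - of_real ?c" "of_real ?c - of_real ?e"] by simp
      then show "norm (?a - of_real ?e) < r" using 1 2 3 by simp
    qed
  qed
qed

text \<open>Bounded second moments give tightness by Markov's inequality. A frequency
  \<open>(a, b)\<close> of the plane corresponds to \<open>u = Complex a b\<close>, because
  \<open>Re (cnj u * w) = a * Re w + b * Im w\<close>.\<close>

lemma conv_distr_of_cf:
  fixes F :: "nat \<Rightarrow> 'w \<Rightarrow> complex"
  assumes lF: "\<And>n. l2 (F n)" and C: "\<And>n. l2n (F n) \<le> C" and s2: "s2 \<ge> 0"
    and cf: "\<And>u. (\<lambda>n. \<integral>\<omega>. iexp (Re (cnj u * F n \<omega>)) \<partial>M) \<longlonglongrightarrow> of_real (exp (- (cmod u)\<^sup>2 * s2 / 4))"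
  shows "conv_distr M F (cnormal s2)"
  unfolding conv_distr_def
proof (intro allI impI)
  fix g :: "real \<times> real \<Rightarrow> real" assume g: "continuous_on UNIV g" "bounded (range g)"
  define \<mu> where "\<mu> = (\<lambda>n. distr M borel (\<lambda>\<omega>. (Re (F n \<omega>), Im (F n \<omega>))))"
  have Fm[measurable]: "F n \<in> borel_measurable M" for n using lF by (rule l2_measurable)
  have Xm: "(\<lambda>\<omega>. (Re (F n \<omega>), Im (F n \<omega>))) \<in> measurable M borel" for n by measurable
  have int: "(\<integral>p. h p \<partial>\<mu> n) = (\<integral>\<omega>. h (Re (F n \<omega>), Im (F n \<omega>)) \<partial>M)" if "continuous_on UNIV h"
    for h :: "real \<times> real \<Rightarrow> 'b :: {banach, second_countable_topology}" and n
    unfolding \<mu>_def by (rule integral_distr[OF Xm borel_measurable_continuous_onI[OF that]])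
  have "(\<lambda>n. \<integral>p. g p \<partial>\<mu> n) \<longlonglongrightarrow> (\<integral>p. g p \<partial>cnormal s2)"
  proof (rule levy_continuity_plane)
    show "prob_space (\<mu> n)" for n unfolding \<mu>_def by (rule prob_space_distr[OF Xm])
    show "prob_space (cnormal s2)" by (rule prob_cnormal[OF s2])
    show "sets (\<mu> n) = sets borel" for n by (simp add: \<mu>_def)
    show "sets (cnormal s2) = sets borel" by (rule sets_cnormal)
    show "(\<lambda>n. \<integral>p. iexp (a * fst p + b * snd p) \<partial>\<mu> n) \<longlonglongrightarrow> (\<integral>p. iexp (a * fst p + b * snd p) \<partial>cnormal s2)" for a b
    proof -
      have e: "Re (cnj (Complex a b) * w) = a * Re w + b * Im w" for w by simp
      have c: "continuous_on UNIV (\<lambda>p. iexp (a * fst p + b * snd p))" by (intro continuous_intros)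
      have "(\<integral>p. iexp (a * fst p + b * snd p) \<partial>\<mu> n) = (\<integral>\<omega>. iexp (Re (cnj (Complex a b) * F n \<omega>)) \<partial>M)" for n
        unfolding int[OF c] e by simp
      moreover have "(cmod (Complex a b))\<^sup>2 = a\<^sup>2 + b\<^sup>2" by (simp add: cmod_power2)
      ultimately show ?thesis using cf[of "Complex a b"] by (simp only: cnormal_cf[OF s2])
    qed
    fix \<eta> :: real assume \<eta>: "\<eta> > 0"
    \<comment> \<open>Chosen so that the Markov bound is at most \<eta>; replacing \<open>C\<close>
      by \<open>|C| + 1\<close> keeps the radius positive.\<close>
    define L0 where "L0 = sqrt ((\<bar>C\<bar> + 1) / \<eta>)"
    have L0: "L0 > 0" "L0\<^sup>2 = (\<bar>C\<bar> + 1) / \<eta>" using \<eta> by (simp_all add: L0_def)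
    show "\<exists>l. \<forall>n. measure (\<mu> n) {p. norm p > l} \<le> \<eta>"
    proof (intro exI[of _ L0] allI)
      fix n
      have op: "{p::real \<times> real. norm p > L0} \<in> sets borel"
        by (intro borel_open open_Collect_less continuous_intros)
      have "measure (\<mu> n) {p. norm p > L0} = measure M {\<omega> \<in> space M. L0 < cmod (F n \<omega>)}"
        unfolding \<mu>_def measure_distr[OF Xm op]
        by (rule arg_cong[where f="measure M"]) (auto simp: norm_Pair cmod_def)
      also have "\<dots> \<le> measure M {\<omega> \<in> space M. L0\<^sup>2 \<le> (cmod (F n \<omega>))\<^sup>2}"
        by (intro finite_measure_mono) (use L0(1) in \<open>auto intro!: power_mono\<close>)
      also have "\<dots> \<le> (\<integral>\<omega>. (cmod (F n \<omega>))\<^sup>2 \<partial>M) / L0\<^sup>2"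
        using lF[of n] zero_less_power[OF L0(1), of 2]
        by (intro integral_Markov_inequality_measure[where A="space M"]) (auto simp: l2_def)
      also have "\<dots> \<le> \<eta>"
      proof -
        have "(\<integral>\<omega>. (cmod (F n \<omega>))\<^sup>2 \<partial>M) \<le> \<bar>C\<bar> + 1" using C[of n] unfolding l2n_def by linarith
        then have "(\<integral>\<omega>. (cmod (F n \<omega>))\<^sup>2 \<partial>M) / L0\<^sup>2 \<le> (\<bar>C\<bar> + 1) / L0\<^sup>2" by (intro divide_right_mono) auto
        also have "\<dots> = \<eta>" using \<eta> by (simp add: L0(2))
        finally show ?thesis .
      qed
      finally show "measure (\<mu> n) {p. norm p > L0} \<le> \<eta>" .
    qed
  qed (rule g)+
  then show "(\<lambda>n. \<integral>\<omega>. g (Re (F n \<omega>), Im (F n \<omega>)) \<partial>M) \<longlonglongrightarrow> (\<integral>x. g x \<partial>cnormal s2)"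
    unfolding int[OF g(1)] .
qed

end

theorem theorem5p5:
  fixes M :: "'w measure"
    and zeta :: "nat \<Rightarrow> 'w \<Rightarrow> complex"
    and F :: "nat \<Rightarrow> 'w \<Rightarrow> complex"
    and f :: "nat \<Rightarrow> nat \<Rightarrow> nat \<Rightarrow> nat list \<Rightarrow> nat list \<Rightarrow> complex"
    and sigma2 :: "nat \<Rightarrow> nat \<Rightarrow> real"
    and s2 :: real
  assumes prob: "prob_space M"
    and indep: "prob_space.indep_vars M (\<lambda>_. borel) zeta UNIV"
    and gauss: "\<And>k. distr M borel (\<lambda>\<omega>. (Re (zeta k \<omega>), Im (zeta k \<omega>))) = cnormal 1"
    and tens: "\<And>n p q. 1 \<le> p + q \<Longrightarrow> sym_tensor p q (f n p q)"
    and Fmeas: "\<And>n. F n \<in> borel_measurable M"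
    and chaos: "\<And>n. (\<lambda>m. \<integral>\<^sup>+ \<omega>. ennreal ((cmod (F n \<omega> -
                   (\<Sum>(p, q) \<in> {(p, q). 1 \<le> p + q \<and> p + q \<le> m}. wi M zeta p q (f n p q) \<omega>)))\<^sup>2) \<partial>M)
                 \<longlonglongrightarrow> 0"
    and orth: "\<And>m n p q p' q'. 1 \<le> m \<Longrightarrow> 1 \<le> p + q \<Longrightarrow> p + q \<le> m \<Longrightarrow>
                 1 \<le> p' + q' \<Longrightarrow> p' + q' \<le> m \<Longrightarrow>
                 (\<integral>\<omega>. wi M zeta p q (f n p q) \<omega> * wi M zeta p' q' (f n p' q') \<omega> \<partial>M) = 0"
    and lim_var: "\<And>p q. 1 \<le> p + q \<Longrightarrow>
                 (\<lambda>n. fact p * fact q * tnorm2 p q (f n p q)) \<longlonglongrightarrow> sigma2 p q"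
    and summ: "(\<lambda>(p, q). sigma2 p q) summable_on {(p, q). 1 \<le> p + q}"
    and s2_def: "s2 = (\<Sum>\<^sub>\<infinity>(p, q) \<in> {(p, q). 1 \<le> p + q}. sigma2 p q)"
    and contr_lim: "\<And>p q i j. 2 \<le> p + q \<Longrightarrow> i \<le> p \<Longrightarrow> j \<le> q \<Longrightarrow>
                 0 < i + j \<Longrightarrow> i + j < p + q \<Longrightarrow>
                 (\<lambda>n. tnorm2 (p + q - i - j) (q + p - i - j)
                        (contr p q i j (f n p q) (rev_cnj (f n p q)))) \<longlonglongrightarrow> 0"
    and tail: "\<forall>\<epsilon>>0. \<exists>M0. \<forall>m\<ge>M0. \<forall>n.
                 (\<Sum>\<^sub>\<infinity>(p, q) \<in> {(p, q). m < p + q}. fact p * fact q * tnorm2 p q (f n p q)) \<le> \<epsilon>"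
  shows "conv_distr M F (cnormal s2)"
proof -
  interpret complex_gaussian_family M zeta
    by (intro complex_gaussian_family.intro complex_gaussian_family_axioms.intro prob indep gauss)
  have wl: "l2 (wi_sum (types_upto m) (f n))" for m n
    by (rule l2limD(2)[OF wi_sum_l2lim]) (auto simp: types_upto_def intro: tens)
  have Fl: "l2lim (\<lambda>m. wi_sum (types_upto m) (f n)) (F n)" for n
    using chaos[of n] by (intro l2limI_nn wl Fmeas) (simp add: wi_sum_def types_upto_def)
  \<comment> \<open>The bilinear expansion runs over all pairs of types, and \<open>orth\<close>
    covers each of them: the diagonal ones express that every chaos is circular, the others that
    distinct chaoses have no correlation without conjugation.\<close>
  have orth': "(\<integral>\<omega>. wi_sum (types_upto m) (f n) \<omega> * wi_sum (types_upto m) (f n) \<omega> \<partial>M) = 0" for n m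
  proof -
    define X where "X = (\<lambda>t. wi M zeta (fst t) (snd t) (f n (fst t) (snd t)))"
    have lX: "l2 (X t)" if "t \<in> types_upto m" for t
      unfolding X_def using that by (intro l2limD(2)[OF wi_l2lim] tens) (auto simp: types_upto_def)
    have "(\<integral>\<omega>. wi_sum (types_upto m) (f n) \<omega> * wi_sum (types_upto m) (f n) \<omega> \<partial>M)
        = (\<integral>\<omega>. (\<Sum>s\<in>types_upto m. \<Sum>t\<in>types_upto m. X s \<omega> * X t \<omega>) \<partial>M)"
      unfolding wi_sum_def X_def case_prod_beta' sum_product ..
    also have "\<dots> = (\<Sum>s\<in>types_upto m. \<Sum>t\<in>types_upto m. (\<integral>\<omega>. X s \<omega> * X t \<omega> \<partial>M))"
      by (subst Bochner_Integration.integral_sum, intro Bochner_Integration.integrable_sum l2_mult_integrable lX, assumption, assumption)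
        (intro sum.cong refl Bochner_Integration.integral_sum l2_mult_integrable lX)
    also have "\<dots> = 0"
      unfolding X_def by (intro sum.neutral ballI orth[of m]) (auto simp: types_upto_def)
    finally show ?thesis .
  qed
  have s2l: "(\<lambda>m. \<Sum>(p, q)\<in>types_upto m. sigma2 p q) \<longlonglongrightarrow> s2"
    unfolding s2_def by (rule filterlim_compose[OF infsum_tendsto[OF summ] filterlim_types_upto])
  \<comment> \<open>Limits of squared norms are nonnegative, which makes \<open>cnormal s2\<close> a
    probability law.\<close>
  have s0: "sigma2 p q \<ge> 0" if "1 \<le> p + q" for p q
    by (rule LIMSEQ_le_const[OF lim_var[OF that]]) (auto simp: tnorm2_nonneg)
  have s2_nonneg: "s2 \<ge> 0"
    unfolding s2_def by (rule infsum_nonneg) (auto intro: s0)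
  note cl = chaos_cf_limit[OF tens Fl orth' lim_var s2l contr_lim tail]
  obtain C where "\<And>n. l2n (F n) \<le> C" using cl(2) by blast
  then show ?thesis
    by (intro conv_distr_of_cf[OF l2limD(2)[OF Fl] _ s2_nonneg] cl(1))
qed

end
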